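(* Let $G$ be an optimal $1$-toroidal graph (O1TG) of even order, with quadrangular subgraph $Q(G)$. Then $G$ is $1$-extendable if and only if $Q(G)$ does not contain a subgraph $H$ satisfying both of the following conditions: (i) $H$ (with the embedding inherited from $Q(G)$) is a quadrangulation of the torus $T^2$, and (ii) every facial cycle of $H$ corresponds to a barrier $4$-cycle of $G$ (that is, each face of $H$ contains an odd number of vertices of $G$).
   Context: All graphs are finite, simple and connected. The order of a graph is its number of vertices. A $1$-embedded graph on a closed surface $F^2$ is a graph drawn on $F^2$ (good drawing: vertices at distinct points, adjacent edges do not cross, no three edges cross at one point, no tangential touching) so that every edge is involved in at most one crossing with another edge. Every $1$-embedded graph $G$ on $F^2$ with at least three vertices satisfies $|E(G)|\leq 4|V(G)|-4\chi(F^2)$, where $\chi(F^2)$ is the Euler characteristic; if equality holds, $G$ is optimal. An optimal $1$-toroidal graph (O1TG) is an optimal $1$-embedded graph on the torus $T^2$, so $|E(G)|=4|V(G)|$. An edge is crossing if it crosses another edge and non-crossing otherwise. The quadrangular subgraph $Q(G)$ is the embedded graph consisting of all vertices and all non-crossing edges of $G$; it is known that $Q(G)$ is a quadrangulation and $G$ is obtained from $Q(G)$ by adding a pair of crossing diagonal edges in each face. A quadrangulation of a closed surface is a graph embedded so that every face is a $2$-cell bounded by a $4$-cycle. A barrier $k$-cycle of $G$ is a cycle of length $k$ consisting of non-crossing edges (i.e. a $k$-cycle of $Q(G)$) that bounds a $2$-cell region whose interior contains an odd number of vertices of $G$. A matching $M$ of $G$ is extendable if $G$ has a perfect matching containing $M$.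 A graph with at least $2m+2$ vertices is $m$-extendable if every matching $M$ with $|M|=m$ is extendable. *)

theory Defs
  imports "HOL-Combinatorics.Orbits"
begin

record 'a ugraph =
  verts :: "'a set"
  edges :: "'a set set"

definition connected_graph :: "('a, 'b) ugraph_scheme \<Rightarrow> bool" where
  "connected_graph G \<longleftrightarrow>
     finite (verts G) \<and> verts G \<noteq> {} \<and>
     (\<forall>e\<in>edges G. e \<subseteq> verts G \<and> card e = 2) \<and>
     (\<forall>u\<in>verts G. \<forall>v\<in>verts G. (u, v) \<in> {(a, b). {a, b} \<in> edges G}\<^sup>*)"

definition subgraph :: "('a, 'b) ugraph_scheme \<Rightarrow> ('a, 'c) ugraph_scheme \<Rightarrow> bool" where
  "subgraph H G \<longleftrightarrow> verts H \<subseteq> verts G \<and> edges H \<subseteq> edges G"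

definition matching :: "('a, 'b) ugraph_scheme \<Rightarrow> 'a set set \<Rightarrow> bool" where
  "matching G M \<longleftrightarrow> M \<subseteq> edges G \<and> pairwise disjnt M"

definition perfect_matching :: "('a, 'b) ugraph_scheme \<Rightarrow> 'a set set \<Rightarrow> bool" where
  "perfect_matching G M \<longleftrightarrow> matching G M \<and> \<Union>M = verts G"

definition extendable :: "('a, 'b) ugraph_scheme \<Rightarrow> 'a set set \<Rightarrow> bool" where
  "extendable G M \<longleftrightarrow> (\<exists>N. perfect_matching G N \<and> M \<subseteq> N)"

definition m_extendable :: "nat \<Rightarrow> ('a, 'b) ugraph_scheme \<Rightarrow> bool" where
  "m_extendable m G \<longleftrightarrow>
     2 * m + 2 \<le> card (verts G) \<and>
     (\<forall>M. matching G M \<and> card M = m \<longrightarrow> extendable G M)"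

definition cycle_graph :: "'a list \<Rightarrow> 'a ugraph" where
  "cycle_graph c =
     \<lparr>verts = set c, edges = {{c ! i, c ! (Suc i mod length c)} | i. i < length c}\<rparr>"

definition is_cycle :: "('a, 'b) ugraph_scheme \<Rightarrow> 'a list \<Rightarrow> bool" where
  "is_cycle G c \<longleftrightarrow> 3 \<le> length c \<and> distinct c \<and> subgraph (cycle_graph c) G"


text \<open>
  A drawing on an oriented surface is given by the abstract graph, the set of its
  crossings (a crossing is the pair \<open>{e, f}\<close> of edges that cross), and the rotation system
  of its planarization. The planarization has the vertices and the crossings as its points;
  a non-crossing edge is one segment of it, a crossing edge is divided into two segments.
  \<open>rot p q\<close> is the neighbour of the point \<open>p\<close> that follows \<open>q\<close> in the cyclic order around \<open>p\<close>.
\<close>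

datatype 'a point = Vertex 'a | Crossing "'a set set"

record 'a drawing = "'a ugraph" +
  crossings :: "'a set set set"
  rot :: "'a point \<Rightarrow> 'a point \<Rightarrow> 'a point"

definition quad_subgraph :: "'a drawing \<Rightarrow> 'a ugraph" where
  "quad_subgraph G = \<lparr>verts = verts G, edges = edges G - \<Union>(crossings G)\<rparr>"

definition points :: "'a drawing \<Rightarrow> 'a point set" where
  "points G = Vertex ` verts G \<union> Crossing ` crossings G"

definition segments :: "'a drawing \<Rightarrow> 'a point set set" where
  "segments G =
     (\<lambda>e. Vertex ` e) ` edges (quad_subgraph G) \<union>
     {{Vertex v, Crossing x} | v x. x \<in> crossings G \<and> v \<in> \<Union>x}"

definition nbrs :: "'a drawing \<Rightarrow> 'a point \<Rightarrow> 'a point set" where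
  "nbrs G p = {q. {p, q} \<in> segments G}"

text \<open>
  A dart is a segment with a direction. The orbits of \<open>next_dart\<close> are the facial
  walks of the planarization; a dart belongs to the face on a fixed side of it.
\<close>

definition darts :: "'a drawing \<Rightarrow> ('a point \<times> 'a point) set" where
  "darts G = {(p, q). {p, q} \<in> segments G}"

definition next_dart :: "'a drawing \<Rightarrow> 'a point \<times> 'a point \<Rightarrow> 'a point \<times> 'a point" where
  "next_dart G = (\<lambda>(p, q). (q, rot G q p))"

definition faces :: "'a drawing \<Rightarrow> ('a point \<times> 'a point) set set" where
  "faces G = orbit (next_dart G) ` darts G"

definition euler_char :: "'a drawing \<Rightarrow> int" where
  "euler_char G = int (card (points G)) - int (card (segments G)) + int (card (faces G))"

text \<open>
  The last condition says that two edges cross transversally: their four ends alternate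
  around the crossing point.
\<close>

definition one_embedded :: "'a drawing \<Rightarrow> bool" where
  "one_embedded G \<longleftrightarrow>
     connected_graph G \<and>
     (\<forall>x\<in>crossings G. x \<subseteq> edges G \<and> card x = 2 \<and> pairwise disjnt x) \<and>
     pairwise disjnt (crossings G) \<and>
     (\<forall>p\<in>points G. cyclic_on (rot G p) (nbrs G p)) \<and>
     (\<forall>x\<in>crossings G. \<forall>e\<in>x. \<forall>u\<in>e. rot G (Crossing x) (Vertex u) \<notin> Vertex ` e)"

text \<open>
  The rotation system of a connected drawing on the torus has Euler characteristic \<open>0\<close> if
  all faces of the planarization are 2-cells, and \<open>2\<close> otherwise; conversely, rotation systems
  with these characteristics come from drawings on the torus. The Euler characteristic of a
  connected rotation system is an even number that is at most \<open>2\<close>, so the condition below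
  covers exactly the drawings on the torus, cellular or not.
\<close>

definition one_toroidal :: "'a drawing \<Rightarrow> bool" where
  "one_toroidal G \<longleftrightarrow> one_embedded G \<and> 0 \<le> euler_char G"

definition optimal_one_toroidal :: "'a drawing \<Rightarrow> bool" where
  "optimal_one_toroidal G \<longleftrightarrow>
     one_toroidal G \<and> 3 \<le> card (verts G) \<and> card (edges G) = 4 * card (verts G)"


text \<open>
  Let \<open>H\<close> be a subgraph of \<open>quad_subgraph G\<close>. The components of the surface minus \<open>H\<close> (the faces
  of the inherited embedding of \<open>H\<close>) arise from the faces of the planarization of \<open>G\<close>
  by gluing them along all segments that are not edges of \<open>H\<close>. Such a component is
  represented by the set of darts of the faces it consists of.
\<close>

definition glue :: "'a drawing \<Rightarrow> 'a ugraph \<Rightarrow> (('a point \<times> 'a point) \<times> ('a point \<times> 'a point)) set" where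
  "glue G H =
     {(d, next_dart G d) | d. d \<in> darts G} \<union>
     {((p, q), (q, p)) | p q. (p, q) \<in> darts G \<and> {p, q} \<notin> (\<lambda>e. Vertex ` e) ` edges H}"

definition regions :: "'a drawing \<Rightarrow> 'a ugraph \<Rightarrow> ('a point \<times> 'a point) set set" where
  "regions G H = darts G // (glue G H)\<^sup>*"

definition inner_points :: "'a drawing \<Rightarrow> 'a ugraph \<Rightarrow> ('a point \<times> 'a point) set \<Rightarrow> 'a point set" where
  "inner_points G H R = {p \<in> points G. p \<notin> Vertex ` verts H \<and> (\<exists>q. (p, q) \<in> R)}"

definition inner_vertices :: "'a drawing \<Rightarrow> 'a ugraph \<Rightarrow> ('a point \<times> 'a point) set \<Rightarrow> 'a set" where
  "inner_vertices G H R = {v \<in> verts G. Vertex v \<in> inner_points G H R}"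

definition inner_segments :: "'a drawing \<Rightarrow> 'a ugraph \<Rightarrow> ('a point \<times> 'a point) set \<Rightarrow> 'a point set set" where
  "inner_segments G H R = {{p, q} | p q. (p, q) \<in> R} - (\<lambda>e. Vertex ` e) ` edges H"

definition inner_faces :: "'a drawing \<Rightarrow> ('a point \<times> 'a point) set \<Rightarrow> ('a point \<times> 'a point) set set" where
  "inner_faces G R = {f \<in> faces G. f \<subseteq> R}"

text \<open>
  A component of the complement of a nonempty \<open>H\<close> is a connected open surface, and it is a
  2-cell if and only if the alternating count of the open cells it is made of is \<open>1\<close>. This
  requires the faces of the planarization to be 2-cells, that is \<open>euler_char G = 0\<close> on the
  torus; for optimal drawings counting edges and faces shows that this is always the case.
\<close>

definition two_cell :: "'a drawing \<Rightarrow> 'a ugraph \<Rightarrow> ('a point \<times> 'a point) set \<Rightarrow> bool" where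
  "two_cell G H R \<longleftrightarrow>
     int (card (inner_points G H R)) - int (card (inner_segments G H R))
       + int (card (inner_faces G R)) = 1"

text \<open>
  The boundary of \<open>R\<close> consists of the darts of \<open>R\<close> that run along \<open>H\<close>. The list \<open>c\<close> traverses the
  bounding cycle in the direction that has \<open>R\<close> on its side; every cycle can be listed in
  both directions.
\<close>

definition bounded_by_cycle ::
    "'a drawing \<Rightarrow> 'a ugraph \<Rightarrow> ('a point \<times> 'a point) set \<Rightarrow> 'a list \<Rightarrow> bool" where
  "bounded_by_cycle G H R c \<longleftrightarrow>
     is_cycle H c \<and>
     {(p, q) \<in> R. {p, q} \<in> (\<lambda>e. Vertex ` e) ` edges H} =
     {(Vertex (c ! i), Vertex (c ! (Suc i mod length c))) | i. i < length c}"

text \<open>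
  For \<open>H\<close> embedded in the torus: all its faces are 2-cells bounded by 4-cycles.
\<close>

definition quadrangulation :: "'a drawing \<Rightarrow> 'a ugraph \<Rightarrow> bool" where
  "quadrangulation G H \<longleftrightarrow>
     connected_graph H \<and>
     (\<forall>R\<in>regions G H. two_cell G H R \<and> (\<exists>c. length c = 4 \<and> bounded_by_cycle G H R c))"

definition facial_cycle :: "'a drawing \<Rightarrow> 'a ugraph \<Rightarrow> 'a list \<Rightarrow> bool" where
  "facial_cycle G H c \<longleftrightarrow> (\<exists>R\<in>regions G H. bounded_by_cycle G H R c)"

definition barrier_cycle :: "'a drawing \<Rightarrow> nat \<Rightarrow> 'a list \<Rightarrow> bool" where
  "barrier_cycle G k c \<longleftrightarrow>
     length c = k \<and> is_cycle (quad_subgraph G) c \<and>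
     (\<exists>R\<in>regions G (cycle_graph c).
        two_cell G (cycle_graph c) R \<and> bounded_by_cycle G (cycle_graph c) R c \<and>
        odd (card (inner_vertices G (cycle_graph c) R)))"

end

theory Submission
  imports Defs
begin

text \<open>
  In an optimal drawing all faces of the planarization are triangles, each spanned by one half
  of a crossing edge on either side and one non-crossing edge; this comes from double counting
  against \<open>0 \<le> euler_char G\<close>. The four ends of a crossing are therefore pairwise adjacent.

  A quadrangulation \<open>H\<close> has as many faces as vertices. If every face has an odd number of vertices
  inside, a perfect matching sends one of them to a vertex of \<open>H\<close> from each face, which leaves no
  room for an edge of \<open>H\<close> in the matching.

  Conversely, if an edge is not extendable, Tutte's theorem yields a set \<open>S\<close> containing both of
  its ends such that \<open>G - S\<close> has at least \<open>card S\<close> odd components. Let \<open>H\<close> be induced by \<open>S\<close> in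
  \<open>quad_subgraph G\<close>. Different components lie in different faces of \<open>H\<close>. A face has Euler
  characteristic at most \<open>1\<close>, and its boundary has even length at least \<open>4\<close>. Euler's formula
  expresses \<open>card S\<close> as the sum of \<open>length / 2 - characteristic \<ge> 1\<close> over all faces, hence every
  face is a disk bounded by a 4-cycle and contains exactly one odd component.
\<close>


section \<open>Hall and Tutte\<close>

text \<open>The summation must not presuppose what it is meant to prove: a priori the induced
  \<open>H\<close> may be disconnected, have isolated vertices, and have annular or other non-disk
  faces. Faces are therefore sets of darts, Euler's formula is an additive count of cells over them,
  and the bound 1 is shown for every region whatever its topology. Disks, absence of isolated
  vertices and connectedness are read off only after equality has been forced.

  The constant 1 per face is 4/2 - 1. Boundary length 3 is excluded by parity, since a region is a
  union of whole quadrangles; length 2 is excluded because the boundary starts at an edge with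
  another region on its far side. Such an edge exists unless one region is the whole torus, which
  \<open>2 <= card S\<close> rules out. The same number 2 appears on the matching side: deleting the
  two ends of the edge leaves an even vertex set, where a violation of Tutte's condition has excess
  at least 2, and this pays for putting both ends into \<open>S\<close>.

  Pairwise adjacency of the ends of a crossing stops two components of \<open>G - S\<close> from
  sharing a quadrangle.\<close>

lemma hall_marriage:
  fixes A :: "'i \<Rightarrow> 'b set"
  assumes "finite I" "\<And>i. i \<in> I \<Longrightarrow> finite (A i)"
    and "\<And>J. J \<subseteq> I \<Longrightarrow> card J \<le> card (\<Union>(A ` J))"
  shows "\<exists>f. inj_on f I \<and> (\<forall>i\<in>I. f i \<in> A i)"
  using assms
proof (induction "card I" arbitrary: I A rule: less_induct)
  case less
  show ?case
  proof (cases "I = {}")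
    case True
    then show ?thesis by simp
  next
    case False
    show ?thesis
    proof (cases "\<forall>J. J \<subset> I \<and> J \<noteq> {} \<longrightarrow> card J < card (\<Union>(A ` J))")
      case True
      obtain i where i: "i \<in> I" using False by blast
      have "card {i} \<le> card (\<Union>(A ` {i}))" using less.prems(3)[of "{i}"] i by blast
      then obtain a where a: "a \<in> A i" by (cases "A i = {}") auto
      let ?A = "\<lambda>j. A j - {a}"
      have "\<exists>f. inj_on f (I - {i}) \<and> (\<forall>j\<in>I - {i}. f j \<in> ?A j)"
      proof (rule less.hyps)
        show "card (I - {i}) < card I" using i less.prems(1) by (meson card_Diff1_less)
        show "finite (I - {i})" using less.prems(1) by simp
        show "finite (?A j)" if "j \<in> I - {i}" for j using less.prems(2) that by simp
        show "card J \<le> card (\<Union>(?A ` J))" if J: "J \<subseteq> I - {i}" for J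
        proof (cases "J = {}")
          case False
          have "J \<subset> I" using J i by blast
          then have "card J < card (\<Union>(A ` J))" using True False by blast
          moreover have "\<Union>(?A ` J) = \<Union>(A ` J) - {a}" by auto
          ultimately show ?thesis by (auto simp: card_Diff_singleton_if)
        qed simp
      qed
      then obtain f where f: "inj_on f (I - {i})" "\<forall>j\<in>I - {i}. f j \<in> ?A j" by blast
      have "inj_on (f(i := a)) I"
        using f unfolding inj_on_def by (auto simp: fun_upd_def)
      moreover have "\<forall>j\<in>I. (f(i := a)) j \<in> A j" using f a by auto
      ultimately show ?thesis by blast
    next
      case False
      then obtain J where J: "J \<subset> I" "J \<noteq> {}" "card (\<Union>(A ` J)) \<le> card J"
        using not_less by blast
      have finJ: "finite J" using J(1) less.prems(1) finite_subset by blast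
      have "\<exists>f. inj_on f J \<and> (\<forall>j\<in>J. f j \<in> A j)"
      proof (rule less.hyps)
        show "card J < card I" using psubset_card_mono[OF less.prems(1) J(1)] .
        show "finite J" by (rule finJ)
        show "finite (A i)" if "i \<in> J" for i using less.prems(2) J(1) that by blast
        show "card K \<le> card (\<Union>(A ` K))" if "K \<subseteq> J" for K using less.prems(3)[of K] J(1) that by blast
      qed
      then obtain f where f: "inj_on f J" "\<forall>j\<in>J. f j \<in> A j" by blast
      let ?U = "\<Union>(A ` J)"
      let ?A = "\<lambda>j. A j - ?U"
      have finU: "finite ?U" using finJ less.prems(2) J(1) by auto
      have "\<exists>g. inj_on g (I - J) \<and> (\<forall>j\<in>I - J. g j \<in> ?A j)"
      proof (rule less.hyps)
        have "I - J \<subset> I" using J(1,2) by blast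
        then show "card (I - J) < card I" using less.prems(1) psubset_card_mono by blast
        show "finite (I - J)" using less.prems(1) by simp
        show "finite (?A j)" if "j \<in> I - J" for j using less.prems(2) that by simp
        show "card K \<le> card (\<Union>(?A ` K))" if K: "K \<subseteq> I - J" for K
        proof -
          have finK: "finite K" using K less.prems(1) finite_subset by blast
          have "card K + card J = card (K \<union> J)"
            using K finK finJ by (subst card_Un_disjoint) auto
          also have "\<dots> \<le> card (\<Union>(A ` (K \<union> J)))"
            using less.prems(3)[of "K \<union> J"] K J(1) by blast
          also have "\<Union>(A ` (K \<union> J)) = \<Union>(?A ` K) \<union> ?U" by auto
          also have "card \<dots> \<le> card (\<Union>(?A ` K)) + card ?U" by (rule card_Un_le)
          finally show ?thesis using J(3) by simp
        qed
      qed
      then obtain g where g: "inj_on g (I - J)" "\<forall>j\<in>I - J. g j \<in> ?A j" by blast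
      let ?h = "\<lambda>j. if j \<in> J then f j else g j"
      have "inj_on ?h I"
      proof (rule inj_onI)
        fix x y assume xy: "x \<in> I" "y \<in> I" "?h x = ?h y"
        have fU: "f u \<in> ?U" if "u \<in> J" for u using f(2) that by blast
        have gU: "g u \<notin> ?U" if "u \<in> I - J" for u using g(2) that by blast
        show "x = y"
        proof (cases "x \<in> J"; cases "y \<in> J")
          assume "x \<in> J" "y \<in> J"
          then show ?thesis using xy(3) inj_onD[OF f(1)] by simp
        next
          assume "x \<in> J" "y \<notin> J"
          then show ?thesis using xy fU[of x] gU[of y] by simp
        next
          assume "x \<notin> J" "y \<in> J"
          then show ?thesis using xy fU[of y] gU[of x] by simp
        next
          assume "x \<notin> J" "y \<notin> J"
          then show ?thesis using xy inj_onD[OF g(1), of x y] by simp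
        qed
      qed
      moreover have "\<forall>j\<in>I. ?h j \<in> A j" using f g by auto
      ultimately show ?thesis by blast
    qed
  qed
qed


text \<open>
  Counting the odd components of \<open>G - S\<close> is replaced by exhibiting disjoint odd sets that are
  unions of components.
\<close>

definition odd_pieces :: "'a set \<Rightarrow> 'a set set \<Rightarrow> 'a set \<Rightarrow> 'a set set \<Rightarrow> bool" where
  "odd_pieces V E S P \<longleftrightarrow> pairwise disjnt P \<and>
     (\<forall>X\<in>P. X \<subseteq> V - S \<and> odd (card X) \<and> (\<forall>x\<in>X. \<forall>y\<in>V - S. {x, y} \<in> E \<longrightarrow> y \<in> X))"

lemma odd_pieces_finite: "odd_pieces V E S P \<Longrightarrow> finite V \<Longrightarrow> finite P"
  unfolding odd_pieces_def by (rule finite_subset[of _ "Pow V"]) auto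

text \<open>Modulo 2 every piece counts as one vertex, so \<open>card V\<close> is congruent to the
  sum on the right.\<close>

lemma odd_pieces_parity:
  assumes "odd_pieces V E S P" "finite V" "S \<subseteq> V" "even (card V)"
  shows "even (card S + card P + card (V - S - \<Union>P))"
proof -
  have P: "pairwise disjnt P" "\<And>X. X \<in> P \<Longrightarrow> X \<subseteq> V - S" "\<And>X. X \<in> P \<Longrightarrow> odd (card X)"
    using assms(1) unfolding odd_pieces_def by auto
  have finP: "finite P" by (rule odd_pieces_finite[OF assms(1,2)])
  have finX: "finite X" if "X \<in> P" for X using P(2)[OF that] assms(2) by (meson finite_Diff finite_subset)
  have "card (\<Union>P) = sum card P"
    using P(1) finX by (intro card_Union_disjoint) auto
  moreover have "even (sum card P + card P)"
  proof -
    have "sum card P + card P = (\<Sum>X\<in>P. card X + 1)" by (subst sum.distrib) simp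
    moreover have "even (\<Sum>X\<in>P. card X + 1)" using P(3) by (intro dvd_sum) auto
    ultimately show ?thesis by simp
  qed
  moreover have "card V = card S + (card (\<Union>P) + card (V - S - \<Union>P))"
  proof -
    have "V = S \<union> (\<Union>P \<union> (V - S - \<Union>P))" using P(2) assms(3) by auto
    moreover have "card (S \<union> (\<Union>P \<union> (V - S - \<Union>P))) = card S + card (\<Union>P \<union> (V - S - \<Union>P))"
      using assms(2,3) finP finX P(2) finite_subset by (intro card_Un_disjoint) auto
    moreover have "card (\<Union>P \<union> (V - S - \<Union>P)) = card (\<Union>P) + card (V - S - \<Union>P)"
      using assms(2) finP finX by (intro card_Un_disjoint) auto
    ultimately show ?thesis by metis
  qed
  ultimately show ?thesis using assms(4) by presburger
qed

text \<open>The pieces are closed under adjacency outside \<open>S\<close>, hence so is what they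
  leave over; if it is odd it is one more piece.\<close>

lemma odd_pieces_insert_rest:
  assumes "odd_pieces V E S P" "odd (card (V - S - \<Union>P))"
  shows "odd_pieces V E S (insert (V - S - \<Union>P) P)" "V - S - \<Union>P \<notin> P"
proof -
  let ?W = "V - S - \<Union>P"
  have P: "pairwise disjnt P" "\<And>X. X \<in> P \<Longrightarrow> X \<subseteq> V - S" "\<And>X. X \<in> P \<Longrightarrow> odd (card X)"
    "\<And>X x y. X \<in> P \<Longrightarrow> x \<in> X \<Longrightarrow> y \<in> V - S \<Longrightarrow> {x, y} \<in> E \<Longrightarrow> y \<in> X"
    using assms(1) unfolding odd_pieces_def by blast+
  have "pairwise disjnt (insert ?W P)"
    using P(1) unfolding pairwise_insert disjnt_def by blast
  moreover have "y \<in> ?W" if "x \<in> ?W" "y \<in> V - S" "{x, y} \<in> E" for x y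
    using P(4)[of _ y x] that by (auto simp: insert_commute)
  ultimately show "odd_pieces V E S (insert ?W P)"
    using P(2-4) assms(2) unfolding odd_pieces_def by blast
  show "?W \<notin> P"
  proof
    assume "?W \<in> P"
    then have "?W = {}" by blast
    then show False using assms(2) by (metis card.empty even_zero)
  qed
qed

text \<open>Either the leftover is odd and supplies a further piece, or it is even and
  \<open>card P - card S\<close> is even by parity, so a positive excess is at least two.\<close>

lemma odd_pieces_excess_two:
  assumes "odd_pieces V E S P" "finite V" "S \<subseteq> V" "even (card V)" "card S < card P"
  shows "\<exists>P'. odd_pieces V E S P' \<and> card S + 2 \<le> card P'"
proof (cases "odd (card (V - S - \<Union>P))")
  case True
  have "card (insert (V - S - \<Union>P) P) = Suc (card P)"
    using odd_pieces_insert_rest(2)[OF assms(1) True] odd_pieces_finite[OF assms(1,2)] by simp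
  then show ?thesis using odd_pieces_insert_rest(1)[OF assms(1) True] assms(5)
    by (metis Suc_leI add_2_eq_Suc' not_less_eq_eq)
next
  case False
  then have "even (card S + card P)" using odd_pieces_parity[OF assms(1-4)] by simp
  then have "card S + 2 \<le> card P" using assms(5) by presburger
  then show ?thesis using assms(1) by blast
qed

text \<open>Take a largest \<open>S\<close> that attains equality in Tutte's condition. Its
  maximality makes the pieces cover \<open>V - S\<close> and makes every piece perfectly matchable
  after deletion of any one vertex; Hall's theorem then pairs the pieces with the elements of
  \<open>S\<close>. The induction is needed only inside the pieces.\<close>

theorem tutte:
  assumes "finite V"
    and "\<And>S P. S \<subseteq> V \<Longrightarrow> odd_pieces V E S P \<Longrightarrow> card P \<le> card S"
  shows "\<exists>M\<subseteq>E. pairwise disjnt M \<and> \<Union>M = V"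
  using assms
proof (induction "card V" arbitrary: V rule: less_induct)
  case less
  note finV = less.prems(1) and cond = less.prems(2)
  have evenV: "even (card V)"
  proof (rule ccontr)
    assume "odd (card V)"
    then have "odd_pieces V E {} {V}" unfolding odd_pieces_def by auto
    from cond[OF _ this] show False by simp
  qed
  define Q where "Q S \<longleftrightarrow> S \<subseteq> V \<and> (\<exists>P. odd_pieces V E S P \<and> card P = card S)" for S
  have "Q {}" unfolding Q_def odd_pieces_def by (simp add: exI[of _ "{}"])
  moreover have "\<forall>S. Q S \<longrightarrow> card S < Suc (card V)"
    unfolding Q_def using finV card_mono less_Suc_eq_le by blast
  ultimately have "\<exists>S. Q S \<and> (\<forall>T. Q T \<longrightarrow> card T \<le> card S)"
    by (rule ex_has_greatest_nat)
  then obtain S where S: "Q S" "\<And>T. Q T \<Longrightarrow> card T \<le> card S" by blast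
  then obtain P where P: "odd_pieces V E S P" "card P = card S" and SV: "S \<subseteq> V"
    unfolding Q_def by blast
  have finS: "finite S" using SV finV finite_subset by blast
  have finP: "finite P" by (rule odd_pieces_finite[OF P(1) finV])
  have Pd: "pairwise disjnt P" and PX: "\<And>X. X \<in> P \<Longrightarrow> X \<subseteq> V - S" "\<And>X. X \<in> P \<Longrightarrow> odd (card X)"
    "\<And>X x y. X \<in> P \<Longrightarrow> x \<in> X \<Longrightarrow> y \<in> V - S \<Longrightarrow> {x, y} \<in> E \<Longrightarrow> y \<in> X"
    using P(1) unfolding odd_pieces_def by auto
  have disj: "X \<inter> Y = {}" if "X \<in> P" "Y \<in> P" "X \<noteq> Y" for X Y
    using Pd that unfolding pairwise_def disjnt_def by blast
  have finX: "finite X" if "X \<in> P" for X using PX(1)[OF that] finV by (meson finite_Diff finite_subset)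
  \<comment> \<open>The leftover is even by parity. If it contained a vertex \<open>x\<close>,
    moving \<open>x\<close> into \<open>S\<close> would make the remainder an odd piece and give a
    larger set with equality.\<close>
  have rest: "V - S - \<Union>P = {}"
  proof (rule ccontr)
    let ?W = "V - S - \<Union>P"
    assume "?W \<noteq> {}"
    then obtain x where x: "x \<in> ?W" by blast
    have "even (card ?W)" using odd_pieces_parity[OF P(1) finV SV evenV] P(2) by simp
    then have oddW: "odd (card (?W - {x}))"
      using x finV card_Suc_Diff1[of ?W x] by (metis even_Suc finite_Diff)
    have "pairwise disjnt (insert (?W - {x}) P)"
      using Pd unfolding pairwise_insert disjnt_def by blast
    moreover have "y \<in> ?W - {x}" if "u \<in> ?W - {x}" "y \<in> V - insert x S" "{u, y} \<in> E" for u y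
      using PX(3)[of _ y u] that by (auto simp: insert_commute)
    ultimately have "odd_pieces V E (insert x S) (insert (?W - {x}) P)"
      using PX x oddW unfolding odd_pieces_def by blast
    moreover have "card (insert (?W - {x}) P) = card (insert x S)"
    proof -
      have "?W - {x} \<notin> P"
      proof
        assume "?W - {x} \<in> P"
        then have "?W - {x} = {}" by blast
        then show False using oddW by (metis card.empty even_zero)
      qed
      then show ?thesis using finP finS x P(2) by auto
    qed
    ultimately have "Q (insert x S)" unfolding Q_def using SV x by blast
    then have "card (insert x S) \<le> card S" using S(2) by blast
    then show False using x finS by auto
  qed
  \<comment> \<open>Induction applies because \<open>X - {x}\<close> is smaller than
    \<open>V\<close>. A violation \<open>T\<close> there has excess at least two by parity, as
    \<open>X - {x}\<close> is even.\<close>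
  have del: "\<exists>M\<subseteq>E. pairwise disjnt M \<and> \<Union>M = X - {x}" if X: "X \<in> P" and x: "x \<in> X" for X x
  proof (rule less.hyps)
    have "X \<subseteq> V" using PX(1)[OF X] by blast
    then have "X - {x} \<subset> V" using x by blast
    then show "card (X - {x}) < card V" using finV psubset_card_mono by blast
    show finXx: "finite (X - {x})" using finX[OF X] by simp
    have evenX: "even (card (X - {x}))" using PX(2)[OF X] x finX[OF X] by simp
    fix T R assume T: "T \<subseteq> X - {x}" and R: "odd_pieces (X - {x}) E T R"
    show "card R \<le> card T"
    proof (rule ccontr)
      assume "\<not> card R \<le> card T"
      then obtain R' where R': "odd_pieces (X - {x}) E T R'" "card T + 2 \<le> card R'"
        using odd_pieces_excess_two[OF R finXx T evenX] by auto
      \<comment> \<open>Replacing the piece \<open>X\<close> by the pieces \<open>R'\<close> costs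
        one piece and gains \<open>card T + 2\<close>, while the set grows by
        \<open>card T + 1\<close>. So equality holds again for a set larger than
        \<open>S\<close>.\<close>
      let ?S = "S \<union> insert x T" and ?P = "(P - {X}) \<union> R'"
      have R'X: "Y \<subseteq> X - {x} - T" "odd (card Y)" if "Y \<in> R'" for Y
        using R'(1) that unfolding odd_pieces_def by auto
      have R'c: "y \<in> Y" if "Y \<in> R'" "a \<in> Y" "y \<in> X - {x} - T" "{a, y} \<in> E" for Y a y
        using R'(1) that unfolding odd_pieces_def by blast
      have piece: "odd_pieces V E ?S ?P"
        unfolding odd_pieces_def
      proof (intro conjI ballI impI)
        have "disjnt Y Z" if "Y \<in> ?P" "Z \<in> ?P" "Y \<noteq> Z" for Y Z
        proof -
          have 1: "disjnt Y Z" if "Y \<in> P - {X}" "Z \<in> R'" for Y Z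
            using disj[of Y X] X R'X(1)[OF that(2)] that unfolding disjnt_def by blast
          have 2: "disjnt Y Z" if "Y \<in> R'" "Z \<in> R'" "Y \<noteq> Z"
            using R'(1) that unfolding odd_pieces_def pairwise_def by blast
          have 3: "disjnt Y Z" if "Y \<in> P" "Z \<in> P" "Y \<noteq> Z"
            using Pd that unfolding pairwise_def by blast
          show ?thesis using that 1[of Y Z] 1[of Z Y] 2 3 disjnt_sym[of Z Y] by blast
        qed
        then show "pairwise disjnt ?P" unfolding pairwise_def by blast
        fix Y assume Y: "Y \<in> ?P"
        show "Y \<subseteq> V - ?S"
        proof (cases "Y \<in> R'")
          case True
          then show ?thesis using R'X(1)[OF True] PX(1)[OF X] by blast
        next
          case False
          then have "Y \<in> P" "Y \<noteq> X" using Y by auto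
          then show ?thesis using PX(1)[of Y] disj[of Y X] X x T by blast
        qed
        show "odd (card Y)" using Y PX(2) R'X(2) by blast
        fix a y assume a: "a \<in> Y" and y: "y \<in> V - ?S" and e: "{a, y} \<in> E"
        show "y \<in> Y"
        proof (cases "Y \<in> R'")
          case True
          then have "y \<in> X" using R'X(1)[OF True] PX(3)[OF X _ _ e] a y by blast
          then show ?thesis using R'c[OF True a _ e] y by blast
        next
          case False
          then show ?thesis using PX(3)[of Y a y] Y a y e by blast
        qed
      qed
      have finR': "finite R'" by (rule odd_pieces_finite[OF R'(1) finXx])
      have "(P - {X}) \<inter> R' = {}"
      proof -
        { fix Y assume "Y \<in> P - {X}" "Y \<in> R'"
          then have "Y = {}" using disj[of Y X] X R'X(1)[of Y] by blast
          then have False using R'X(2)[OF \<open>Y \<in> R'\<close>] by simp }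
        then show ?thesis by blast
      qed
      then have cP: "card ?P = card (P - {X}) + card R'"
        using finP finR' by (intro card_Un_disjoint) auto
      moreover have "card (P - {X}) + 1 = card P" using X finP
        by (metis Suc_eq_plus1 card_Suc_Diff1)
      moreover have cS: "card ?S = card S + Suc (card T)"
      proof -
        have "finite T" using T finXx finite_subset by blast
        moreover have "x \<notin> T" "S \<inter> insert x T = {}" using T PX(1)[OF X] x by auto
        ultimately show ?thesis using finS by (subst card_Un_disjoint) auto
      qed
      ultimately have "card ?S \<le> card ?P" using R'(2) P(2) by linarith
      moreover have SSV: "?S \<subseteq> V" using SV T PX(1)[OF X] x by auto
      ultimately have "Q ?S" unfolding Q_def using cond[OF SSV piece] piece by (metis le_antisym)
      then have "card ?S \<le> card S" using S(2) by blast
      then show False using cS by simp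
    qed
  qed
  let ?A = "\<lambda>X. {s \<in> S. \<exists>x\<in>X. {x, s} \<in> E}"
  have "\<exists>f. inj_on f P \<and> (\<forall>X\<in>P. f X \<in> ?A X)"
  proof (rule hall_marriage)
    show "finite P" by (rule finP)
    show "finite (?A X)" for X using finS by simp
    fix J assume J: "J \<subseteq> P"
    \<comment> \<open>Hall's condition for \<open>J\<close> is Tutte's condition for the set of
      neighbours of \<open>J\<close> in \<open>S\<close>: once those are removed, the members of
      \<open>J\<close> are still closed under adjacency.\<close>
    have "odd_pieces V E (\<Union>(?A ` J)) J"
      unfolding odd_pieces_def
    proof (intro conjI ballI impI)
      show "pairwise disjnt J" using Pd J pairwise_subset by blast
      fix X assume X: "X \<in> J"
      then show "X \<subseteq> V - \<Union>(?A ` J)" "odd (card X)" using PX J by blast+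
      fix x y assume "x \<in> X" "y \<in> V - \<Union>(?A ` J)" "{x, y} \<in> E"
      then show "y \<in> X" using PX(3)[of X x y] X J by blast
    qed
    then show "card J \<le> card (\<Union>(?A ` J))" by (intro cond) (use SV in auto)
  qed
  then obtain f where f: "inj_on f P" "\<forall>X\<in>P. f X \<in> ?A X" by blast
  have fS: "f ` P = S"
    using f P(2) finS by (intro card_subset_eq) (auto simp: card_image)
  have "\<forall>X\<in>P. \<exists>x. x \<in> X \<and> {x, f X} \<in> E" using f(2) by blast
  then obtain g where g: "\<And>X. X \<in> P \<Longrightarrow> g X \<in> X" "\<And>X. X \<in> P \<Longrightarrow> {g X, f X} \<in> E" by metis
  have "\<exists>M. X \<in> P \<longrightarrow> M \<subseteq> E \<and> pairwise disjnt M \<and> \<Union>M = X - {g X}" for X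
    using del[of X "g X"] g(1)[of X] by (cases "X \<in> P") auto
  then obtain M where "\<And>X. X \<in> P \<longrightarrow> M X \<subseteq> E \<and> pairwise disjnt (M X) \<and> \<Union>(M X) = X - {g X}"
    by metis
  then have M: "\<And>X. X \<in> P \<Longrightarrow> M X \<subseteq> E" "\<And>X. X \<in> P \<Longrightarrow> pairwise disjnt (M X)"
    "\<And>X. X \<in> P \<Longrightarrow> \<Union>(M X) = X - {g X}" by simp_all
  let ?N = "\<lambda>X. insert {g X, f X} (M X)"
  have UN: "\<Union>(?N X) = insert (f X) X" if "X \<in> P" for X
    using M(3)[OF that] g(1)[OF that] by auto
  have fX: "f X \<in> S" "f X \<notin> \<Union>P" if "X \<in> P" for X using f(2) PX(1) that by blast+
  have N: "pairwise disjnt (?N X)" if X: "X \<in> P" for X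
    unfolding pairwise_insert
  proof (intro conjI allI impI)
    show "pairwise disjnt (M X)" by (rule M(2)[OF X])
    fix e assume "e \<in> M X \<and> e \<noteq> {g X, f X}"
    then have "e \<subseteq> X - {g X}" using M(3)[OF X] by blast
    then show "disjnt {g X, f X} e" "disjnt e {g X, f X}"
      using fX[OF X] X unfolding disjnt_def by auto
  qed
  have dN: "insert (f X) X \<inter> insert (f Y) Y = {}" if "X \<in> P" "Y \<in> P" "X \<noteq> Y" for X Y
    using disj[OF that] fX[OF that(1)] fX[OF that(2)] that inj_onD[OF f(1)] by blast
  have "pairwise disjnt (\<Union>(?N ` P))"
    unfolding pairwise_def
  proof (intro ballI impI)
    fix d e assume "d \<in> \<Union>(?N ` P)" "e \<in> \<Union>(?N ` P)" and de: "d \<noteq> e"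
    then obtain X Y where XY: "X \<in> P" "d \<in> ?N X" "Y \<in> P" "e \<in> ?N Y" by blast
    show "disjnt d e"
    proof (cases "X = Y")
      case True
      then show ?thesis using pairwiseD[OF N[OF XY(1)]] XY(2,4) de by blast
    next
      case False
      have "d \<subseteq> insert (f X) X" "e \<subseteq> insert (f Y) Y"
        using UN[OF XY(1)] UN[OF XY(3)] XY(2,4) by blast+
      then show ?thesis using dN[OF XY(1,3) False] unfolding disjnt_def by blast
    qed
  qed
  moreover have "\<Union>(\<Union>(?N ` P)) = V"
  proof -
    have "\<Union>(\<Union>(?N ` P)) = (\<Union>X\<in>P. \<Union>(?N X))" by blast
    also have "\<dots> = (\<Union>X\<in>P. insert (f X) X)" using UN by auto
    also have "\<dots> = S \<union> \<Union>P" using fS by auto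
    also have "\<dots> = V" using rest SV PX(1) by blast
    finally show ?thesis .
  qed
  moreover have "\<Union>(?N ` P) \<subseteq> E" using M(1) g(2) by blast
  ultimately show ?case by blast
qed


section \<open>Rotation systems\<close>

locale drawn_graph =
  fixes G :: "'a drawing"
  assumes embedded: "one_embedded G" and three_verts: "3 \<le> card (verts G)"
begin

lemma connected: "connected_graph G"
  using embedded unfolding one_embedded_def by blast

lemma finite_verts: "finite (verts G)"
  using connected unfolding connected_graph_def by blast

lemma edge_subset: "e \<in> edges G \<Longrightarrow> e \<subseteq> verts G"
  and edge_card: "e \<in> edges G \<Longrightarrow> card e = 2"
  using connected unfolding connected_graph_def by blast+

lemma finite_edges: "finite (edges G)"
  using finite_subset[of "edges G" "Pow (verts G)"] edge_subset finite_verts by blast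

lemma crossing_subset: "x \<in> crossings G \<Longrightarrow> x \<subseteq> edges G"
  and crossing_card: "x \<in> crossings G \<Longrightarrow> card x = 2"
  and crossing_disjnt: "x \<in> crossings G \<Longrightarrow> pairwise disjnt x"
  and crossings_disjnt: "pairwise disjnt (crossings G)"
  and rot_cyclic: "p \<in> points G \<Longrightarrow> cyclic_on (rot G p) (nbrs G p)"
  and rot_alternates: "x \<in> crossings G \<Longrightarrow> e \<in> x \<Longrightarrow> u \<in> e \<Longrightarrow>
    rot G (Crossing x) (Vertex u) \<notin> Vertex ` e"
  using embedded unfolding one_embedded_def by blast+

lemma finite_crossings: "finite (crossings G)"
  using finite_subset[of "crossings G" "Pow (edges G)"] crossing_subset finite_edges by blast

lemma crossing_ends_verts: "x \<in> crossings G \<Longrightarrow> u \<in> \<Union>x \<Longrightarrow> u \<in> verts G"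
  using crossing_subset edge_subset by blast

lemma crossing_eq:
  assumes "x \<in> crossings G"
  obtains e f where "x = {e, f}" "e \<in> edges G" "f \<in> edges G" "e \<inter> f = {}" "e \<noteq> f"
proof -
  obtain e f where ef: "x = {e, f}" "e \<noteq> f"
    using crossing_card[OF assms] by (meson card_2_iff)
  then show thesis
    using that[OF ef(1)] crossing_subset[OF assms] crossing_disjnt[OF assms]
    unfolding pairwise_def disjnt_def by auto
qed

lemma crossing_ends_card: "x \<in> crossings G \<Longrightarrow> card (\<Union>x) = 4"
proof -
  assume "x \<in> crossings G"
  then obtain e f where "x = {e, f}" "e \<in> edges G" "f \<in> edges G" "e \<inter> f = {}"
    by (rule crossing_eq)
  moreover from this have "finite e" "finite f" using edge_card by (metis card.infinite zero_neq_numeral)+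
  ultimately show ?thesis using edge_card by (simp add: card_Un_disjoint)
qed

lemma seg_vv: "{Vertex u, Vertex v} \<in> segments G \<longleftrightarrow> {u, v} \<in> edges (quad_subgraph G)"
proof -
  have "{Vertex u, Vertex v} = Vertex ` e \<longleftrightarrow> {u, v} = e" for e :: "'a set"
    using inj_image_eq_iff[of Vertex "{u, v}" e] by (simp add: inj_def)
  then have "{Vertex u, Vertex v} \<in> (`) Vertex ` A \<longleftrightarrow> {u, v} \<in> A" for A :: "'a set set"
    by (simp add: image_iff)
  then show ?thesis unfolding segments_def by (auto simp: doubleton_eq_iff)
qed

lemma seg_vx: "{Vertex u, Crossing x} \<in> segments G \<longleftrightarrow> x \<in> crossings G \<and> u \<in> \<Union>x"
  unfolding segments_def by (auto simp: doubleton_eq_iff)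

lemma seg_xv: "{Crossing x, Vertex u} \<in> segments G \<longleftrightarrow> x \<in> crossings G \<and> u \<in> \<Union>x"
  using seg_vx by (simp add: insert_commute)

lemma seg_xx: "{Crossing x, Crossing y} \<notin> segments G"
  unfolding segments_def by (auto simp: doubleton_eq_iff)

lemma quad_edge: "{u, v} \<in> edges (quad_subgraph G) \<Longrightarrow> u \<noteq> v \<and> u \<in> verts G \<and> v \<in> verts G \<and> {u, v} \<in> edges G"
  using edge_card[of "{u, v}"] edge_subset[of "{u, v}"] unfolding quad_subgraph_def
  by (cases "u = v") auto

lemma dart_sym: "(p, q) \<in> darts G \<longleftrightarrow> (q, p) \<in> darts G"
  unfolding darts_def by (simp add: insert_commute)

lemma nbrs_iff: "q \<in> nbrs G p \<longleftrightarrow> (p, q) \<in> darts G"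
  unfolding darts_def nbrs_def by simp

lemma dart_vv: "(Vertex u, Vertex v) \<in> darts G \<longleftrightarrow> {u, v} \<in> edges (quad_subgraph G)"
  and dart_vx: "(Vertex u, Crossing x) \<in> darts G \<longleftrightarrow> x \<in> crossings G \<and> u \<in> \<Union>x"
  and dart_xv: "(Crossing x, Vertex u) \<in> darts G \<longleftrightarrow> x \<in> crossings G \<and> u \<in> \<Union>x"
  and dart_xx: "(Crossing x, Crossing y) \<notin> darts G"
  unfolding darts_def using seg_vv seg_vx seg_xv seg_xx by auto

lemma dart_points: "(p, q) \<in> darts G \<Longrightarrow> p \<in> points G \<and> q \<in> points G \<and> p \<noteq> q"
  by (cases p; cases q)
    (auto simp: points_def dart_vv dart_vx dart_xv dart_xx image_iff quad_edge
      intro: crossing_ends_verts[OF _ UnionI])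

lemma finite_points: "finite (points G)"
  unfolding points_def using finite_verts finite_crossings by simp

lemma finite_darts: "finite (darts G)"
proof (rule finite_subset)
  show "darts G \<subseteq> points G \<times> points G" using dart_points by auto
  show "finite (points G \<times> points G)" using finite_points by simp
qed

lemma segments_eq: "segments G = {{p, q} |p q. (p, q) \<in> darts G}"
proof -
  have "\<exists>p q. s = {p, q}" if "s \<in> segments G" for s
  proof -
    from that consider e where "s = Vertex ` e" "e \<in> edges G" | v x where "s = {Vertex v, Crossing x}"
      unfolding segments_def quad_subgraph_def by auto
    then show ?thesis
    proof cases
      case 1
      then obtain u v where "e = {u, v}" using edge_card by (meson card_2_iff)
      then show ?thesis using 1 by auto
    qed auto
  qed
  then show ?thesis unfolding darts_def by blast
qed

lemma nbrs_nonempty: "p \<in> points G \<Longrightarrow> nbrs G p \<noteq> {}"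
  using rot_cyclic cyclic_on_alldef by blast

lemma rot_dart: "(p, q) \<in> darts G \<Longrightarrow> (p, rot G p q) \<in> darts G"
  using cyclic_on_inI[OF rot_cyclic] dart_points by (metis nbrs_iff)

lemma rot_inj: "p \<in> points G \<Longrightarrow> inj_on (rot G p) (nbrs G p)"
proof -
  assume p: "p \<in> points G"
  have "finite (nbrs G p)" using finite_cyclic_on[OF rot_cyclic[OF p]] .
  moreover have "rot G p ` nbrs G p = nbrs G p"
  proof
    show "rot G p ` nbrs G p \<subseteq> nbrs G p" using cyclic_on_inI[OF rot_cyclic[OF p]] by blast
    show "nbrs G p \<subseteq> rot G p ` nbrs G p"
    proof
      fix q assume q: "q \<in> nbrs G p"
      then have "q \<in> orbit (rot G p) q" using orbit_cyclic_eq3[OF rot_cyclic[OF p]] by blast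
      then show "q \<in> rot G p ` nbrs G p"
        using orbit_cyclic_eq3[OF rot_cyclic[OF p] q] by (cases rule: orbit.cases) (use q in auto)
    qed
  qed
  ultimately show ?thesis by (simp add: eq_card_imp_inj_on)
qed

text \<open>All neighbours of \<open>p\<close> form one cycle of \<open>rot G p\<close>, so a
  property preserved by a single turn spreads from one neighbour to every other.\<close>

lemma rot_induct [consumes 2, case_names base step]:
  assumes "(p, q) \<in> darts G" "(p, r) \<in> darts G"
    and "P q" "\<And>s. (p, s) \<in> darts G \<Longrightarrow> P s \<Longrightarrow> P (rot G p s)"
  shows "P r"
proof -
  have "p \<in> points G" using assms(1) dart_points by blast
  then have "orbit (rot G p) q = nbrs G p"
    using orbit_cyclic_eq3[OF rot_cyclic] assms(1) nbrs_iff by blast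
  then have "r \<in> orbit (rot G p) q" using assms(2) nbrs_iff by blast
  then have "P r \<and> (p, r) \<in> darts G"
    by induction (use assms rot_dart in auto)
  then show ?thesis ..
qed

lemma next_dart_simp [simp]: "next_dart G (p, q) = (q, rot G q p)"
  unfolding next_dart_def by simp

lemma next_dart_in: "d \<in> darts G \<Longrightarrow> next_dart G d \<in> darts G"
proof -
  assume "d \<in> darts G"
  moreover obtain p q where "d = (p, q)" by fastforce
  ultimately show ?thesis using rot_dart[of q p] dart_sym by simp
qed

lemma next_dart_inj: "inj_on (next_dart G) (darts G)"
proof (rule inj_onI, clarify)
  fix p q p' q' assume pq: "(p, q) \<in> darts G" "(p', q') \<in> darts G"
    and "next_dart G (p, q) = next_dart G (p', q')"
  then have q: "q' = q" "rot G q p = rot G q p'" by auto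
  have "p \<in> nbrs G q" "p' \<in> nbrs G q" unfolding nbrs_iff using pq dart_sym q(1) by blast+
  then show "p = p' \<and> q = q'"
    using inj_onD[OF rot_inj[of q] q(2)] dart_points[OF pq(1)] q(1) by blast
qed

lemma next_dart_invariant_image:
  assumes "X \<subseteq> darts G" "\<And>d. d \<in> X \<Longrightarrow> next_dart G d \<in> X"
  shows "next_dart G ` X = X"
  by (rule endo_inj_surj[OF finite_subset[OF assms(1) finite_darts] _
        inj_on_subset[OF next_dart_inj assms(1)]]) (use assms(2) in blast)

lemma orbit_subset_darts:
  assumes "d \<in> X" "\<And>d. d \<in> X \<Longrightarrow> next_dart G d \<in> X"
  shows "orbit (next_dart G) d \<subseteq> X"
proof
  fix e assume "e \<in> orbit (next_dart G) d"
  then show "e \<in> X" by induction (use assms in auto)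
qed

text \<open>\<open>orbit\<close> begins with the image of its starting point. That the walk comes
  back to \<open>d\<close> itself uses that \<open>next_dart G\<close> is injective on the finite
  set of darts.\<close>

lemma self_in_face: "d \<in> darts G \<Longrightarrow> d \<in> orbit (next_dart G) d"
proof -
  assume d: "d \<in> darts G"
  let ?X = "orbit (next_dart G) d"
  have X: "?X \<subseteq> darts G" by (rule orbit_subset_darts[OF d next_dart_in])
  have "next_dart G ` ?X = ?X"
    by (rule next_dart_invariant_image[OF X]) (rule orbit.step)
  then have "next_dart G d \<in> next_dart G ` ?X" using orbit.base by fast
  then obtain e where e: "e \<in> ?X" "next_dart G d = next_dart G e" by blast
  then have "d = e" using inj_onD[OF next_dart_inj _ d] X by blast
  then show ?thesis using e by simp
qed

lemma face_subset: "d \<in> darts G \<Longrightarrow> orbit (next_dart G) d \<subseteq> darts G"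
  by (rule orbit_subset_darts[OF _ next_dart_in])

lemma face_eq: "d \<in> darts G \<Longrightarrow> e \<in> orbit (next_dart G) d \<Longrightarrow> orbit (next_dart G) e = orbit (next_dart G) d"
  using orbit_swap[OF self_in_face] orbit_trans[of _ "next_dart G"] by blast

lemma faces_disjoint: "f \<in> faces G \<Longrightarrow> g \<in> faces G \<Longrightarrow> f \<noteq> g \<Longrightarrow> f \<inter> g = {}"
proof (rule ccontr)
  assume "f \<in> faces G" "g \<in> faces G" "f \<noteq> g" "f \<inter> g \<noteq> {}"
  then obtain d e c where "d \<in> darts G" "e \<in> darts G" "f = orbit (next_dart G) d"
    "g = orbit (next_dart G) e" "c \<in> f" "c \<in> g" unfolding faces_def by blast
  then show False using face_eq[of d c] face_eq[of e c] \<open>f \<noteq> g\<close> by simp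
qed

lemma faces_Union: "\<Union>(faces G) = darts G"
  unfolding faces_def using self_in_face face_subset by blast

lemma finite_faces: "finite (faces G)"
  unfolding faces_def using finite_darts by simp

lemma face_mem: "f \<in> faces G \<Longrightarrow> d \<in> f \<Longrightarrow> d \<in> darts G \<and> f = orbit (next_dart G) d"
  unfolding faces_def using face_eq[of _ d] face_subset by blast

lemma face_next: "f \<in> faces G \<Longrightarrow> d \<in> f \<Longrightarrow> next_dart G d \<in> f"
  unfolding faces_def using orbit.step by fast

lemma face_nonempty: "f \<in> faces G \<Longrightarrow> f \<noteq> {}"
  unfolding faces_def using self_in_face by blast

text \<open>Connectedness is given for the abstract graph and is transferred to the planarization: a
  crossing edge is replaced by the detour through its crossing, and every crossing is next to a
  vertex.\<close>

lemma points_connected: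
  assumes "p \<in> points G" "q \<in> points G" "P p" "\<And>r s. (r, s) \<in> darts G \<Longrightarrow> P r \<Longrightarrow> P s"
  shows "P q"
proof -
  have vstep: "P (Vertex v)" if e: "{u, v} \<in> edges G" and "P (Vertex u)" for u v
  proof (cases "{u, v} \<in> \<Union>(crossings G)")
    case True
    then obtain x where "x \<in> crossings G" "{u, v} \<in> x" by blast
    then have "(Vertex u, Crossing x) \<in> darts G" "(Crossing x, Vertex v) \<in> darts G"
      unfolding dart_vx dart_xv by blast+
    then show ?thesis using that assms(4) by blast
  next
    case False
    then have "(Vertex u, Vertex v) \<in> darts G" using e unfolding dart_vv quad_subgraph_def by simp
    then show ?thesis using that assms(4) by blast
  qed
  have vert: "\<exists>v\<in>verts G. r = Vertex v \<or> (r, Vertex v) \<in> darts G" if r: "r \<in> points G" for r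
  proof -
    obtain s where s: "(r, s) \<in> darts G" using nbrs_nonempty[OF r] nbrs_iff by blast
    show ?thesis
    proof (cases r)
      case (Vertex v)
      then show ?thesis using r unfolding points_def by auto
    next
      case (Crossing x)
      then obtain v where "s = Vertex v" using s dart_xx by (cases s) auto
      then show ?thesis using s dart_points unfolding points_def by blast
    qed
  qed
  obtain u where u: "u \<in> verts G" "p = Vertex u \<or> (p, Vertex u) \<in> darts G" using vert[OF assms(1)] by blast
  obtain v where v: "v \<in> verts G" "q = Vertex v \<or> (q, Vertex v) \<in> darts G" using vert[OF assms(2)] by blast
  have "P (Vertex u)" using u assms(3,4) by blast
  moreover have "(u, v) \<in> {(a, b). {a, b} \<in> edges G}\<^sup>*"
    using connected u(1) v(1) unfolding connected_graph_def by blast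
  then have "P (Vertex u) \<longrightarrow> P (Vertex v)"
    by (induction rule: rtrancl_induct) (use vstep in auto)
  ultimately show ?thesis using v(2) assms(4) dart_sym by blast
qed

text \<open>Reversing a dart into \<open>p\<close> and then following the facial walk amounts to one
  turn around a point. Hence \<open>D\<close> contains all darts at a point as soon as it contains
  one, and connectedness of the points does the rest.\<close>

lemma darts_connected:
  assumes "d \<in> D" "D \<subseteq> darts G" "\<And>d. d \<in> D \<Longrightarrow> next_dart G d \<in> D" "\<And>p q. (p, q) \<in> D \<Longrightarrow> (q, p) \<in> D"
  shows "D = darts G"
proof
  show "darts G \<subseteq> D"
  proof
    fix e assume e: "e \<in> darts G"
    have all: "(p, r) \<in> D" if pq: "(p, q) \<in> D" and "(p, r) \<in> darts G" for p q r
    proof -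
      have "(p, q) \<in> darts G" using pq assms(2) by blast
      then show ?thesis using that(2)
      proof (induction rule: rot_induct)
        case base
        show ?case by (rule pq)
      next
        case (step s)
        show ?case using assms(3)[OF assms(4)[OF step(2)]] by simp
      qed
    qed
    obtain p q p' q' where d: "d = (p, q)" "e = (p', q')" by (metis surj_pair)
    have "\<exists>r. (p', r) \<in> D"
    proof (rule points_connected[where p = p])
      show "p \<in> points G" "p' \<in> points G" using d e assms(1,2) dart_points by blast+
      show "\<exists>r. (p, r) \<in> D" using assms(1) d by blast
      show "\<exists>t. (s, t) \<in> D" if "(r, s) \<in> darts G" "\<exists>t. (r, t) \<in> D" for r s
        using all[OF _ that(1)] assms(4) that(2) by blast
    qed
    then show "e \<in> D" using all e d by blast
  qed
qed (rule assms(2))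

end


section \<open>Optimal drawings\<close>

lemma card_symmetric_pairs:
  assumes "finite D" "\<And>p q. (p, q) \<in> D \<Longrightarrow> (q, p) \<in> D" "\<And>p q. (p, q) \<in> D \<Longrightarrow> p \<noteq> q"
  shows "card D = 2 * card {{p, q} |p q. (p, q) \<in> D}"
proof -
  let ?g = "\<lambda>(p, q). {p, q}"
  have im: "?g ` D = {{p, q} |p q. (p, q) \<in> D}" by auto
  have fib: "card {d \<in> D. ?g d = s} = 2" if s: "s \<in> ?g ` D" for s
  proof -
    obtain p q where pq: "(p, q) \<in> D" "s = {p, q}" using s by auto
    have "{d \<in> D. ?g d = s} = {(p, q), (q, p)}"
      using pq assms(2) by (auto simp: doubleton_eq_iff)
    then show ?thesis using assms(3)[OF pq(1)] by simp
  qed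
  have "card D = (\<Sum>d\<in>D. 1)" by simp
  also have "\<dots> = (\<Sum>s\<in>?g ` D. \<Sum>d\<in>{d \<in> D. ?g d = s}. 1)"
    by (rule sum.image_gen[OF assms(1)])
  also have "\<dots> = (\<Sum>s\<in>?g ` D. 2)" using fib by (intro sum.cong) auto
  finally show ?thesis using im by simp
qed

lemma sum_eq_lower_bound:
  fixes g :: "'b \<Rightarrow> nat"
  assumes "finite A" "\<And>a. a \<in> A \<Longrightarrow> m \<le> g a" "sum g A \<le> m * card A" "a \<in> A"
  shows "g a = m"
proof (rule ccontr)
  assume "g a \<noteq> m"
  then have "m < g a" using assms(2,4) le_neq_implies_less by metis
  then have "(\<Sum>a\<in>A. m) < sum g A"
    using assms by (intro sum_strict_mono_ex1) auto
  then show False using assms(3) by (simp add: mult.commute)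
qed

context drawn_graph
begin

definition vv_darts :: "('a point \<times> 'a point) set" where
  "vv_darts = darts G \<inter> range Vertex \<times> range Vertex"

definition vx_darts :: "('a point \<times> 'a point) set" where
  "vx_darts = darts G \<inter> range Vertex \<times> range Crossing"

definition xv_darts :: "('a point \<times> 'a point) set" where
  "xv_darts = darts G \<inter> range Crossing \<times> range Vertex"

lemma darts_split: "darts G = vv_darts \<union> (vx_darts \<union> xv_darts)"
proof -
  have "(p, q) \<in> vv_darts \<union> (vx_darts \<union> xv_darts)" if "(p, q) \<in> darts G" for p q
    using that dart_xx unfolding vv_darts_def vx_darts_def xv_darts_def
    by (cases p; cases q) auto
  then show ?thesis unfolding vv_darts_def vx_darts_def xv_darts_def by auto
qed

text \<open>No two crossings are neighbours, so a facial walk that enters a crossing leaves it for a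
  vertex. Within a face the half-edges into crossings and those out of crossings are thus equally
  many.\<close>

lemma next_vx:
  assumes "X \<subseteq> darts G" "\<And>d. d \<in> X \<Longrightarrow> next_dart G d \<in> X"
  shows "next_dart G ` (vx_darts \<inter> X) = xv_darts \<inter> X"
proof
  show "next_dart G ` (vx_darts \<inter> X) \<subseteq> xv_darts \<inter> X"
  proof
    fix e assume "e \<in> next_dart G ` (vx_darts \<inter> X)"
    then obtain u x where d: "(Vertex u, Crossing x) \<in> X" "e = next_dart G (Vertex u, Crossing x)"
      unfolding vx_darts_def by auto
    have e: "e \<in> X" "e \<in> darts G" using d assms by blast+
    obtain w where "rot G (Crossing x) (Vertex u) = Vertex w"
      using e(2) d(2) dart_xx by (cases "rot G (Crossing x) (Vertex u)") auto
    then show "e \<in> xv_darts \<inter> X" using e d(2) unfolding xv_darts_def by auto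
  qed
  show "xv_darts \<inter> X \<subseteq> next_dart G ` (vx_darts \<inter> X)"
  proof
    fix e assume e: "e \<in> xv_darts \<inter> X"
    then obtain d where d: "d \<in> X" "e = next_dart G d"
      using next_dart_invariant_image[OF assms] by blast
    obtain x w where x: "e = (Crossing x, Vertex w)" using e unfolding xv_darts_def by auto
    obtain p q where pq: "d = (p, q)" by fastforce
    have q: "q = Crossing x" using d(2) x pq by simp
    have dd: "(p, q) \<in> darts G" using d(1) pq assms(1) by blast
    then obtain u where "p = Vertex u" using q dart_xx by (cases p) auto
    then have "d \<in> vx_darts" using dd q pq unfolding vx_darts_def by auto
    then show "e \<in> next_dart G ` (vx_darts \<inter> X)" using d by blast
  qed
qed

lemma card_vx_eq_xv:
  assumes "X \<subseteq> darts G" "\<And>d. d \<in> X \<Longrightarrow> next_dart G d \<in> X"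
  shows "card (vx_darts \<inter> X) = card (xv_darts \<inter> X)"
proof -
  have "inj_on (next_dart G) (vx_darts \<inter> X)"
    by (rule inj_on_subset[OF next_dart_inj]) (use assms(1) in blast)
  then show ?thesis using card_image next_vx[OF assms] by metis
qed

lemma card_dart_split:
  assumes "X \<subseteq> darts G" "\<And>d. d \<in> X \<Longrightarrow> next_dart G d \<in> X"
  shows "card X = card (vv_darts \<inter> X) + 2 * card (xv_darts \<inter> X)"
proof -
  have fin: "finite X" using assms(1) finite_darts finite_subset by blast
  have "X = (vv_darts \<inter> X) \<union> ((vx_darts \<inter> X) \<union> (xv_darts \<inter> X))" using darts_split assms(1) by blast
  then have "card X = card ((vv_darts \<inter> X) \<union> ((vx_darts \<inter> X) \<union> (xv_darts \<inter> X)))" by simp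
  also have "\<dots> = card (vv_darts \<inter> X) + card ((vx_darts \<inter> X) \<union> (xv_darts \<inter> X))"
    using fin by (intro card_Un_disjoint) (auto simp: vv_darts_def vx_darts_def xv_darts_def)
  also have "card ((vx_darts \<inter> X) \<union> (xv_darts \<inter> X)) = card (vx_darts \<inter> X) + card (xv_darts \<inter> X)"
    using fin by (intro card_Un_disjoint) (auto simp: vv_darts_def vx_darts_def xv_darts_def)
  finally show ?thesis using card_vx_eq_xv[OF assms] by simp
qed

lemma card_xv: "card xv_darts = 4 * card (crossings G)"
proof -
  let ?h = "\<lambda>(x, u). (Crossing x, Vertex u) :: 'a point \<times> 'a point"
  have "(Crossing x, Vertex u) \<in> xv_darts \<longleftrightarrow> x \<in> crossings G \<and> u \<in> \<Union>x" for x u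
    unfolding xv_darts_def dart_xv[symmetric] by auto
  moreover have "d \<in> xv_darts \<Longrightarrow> \<exists>x u. d = (Crossing x, Vertex u)" for d
    unfolding xv_darts_def by auto
  ultimately have "xv_darts = ?h ` (SIGMA x:crossings G. \<Union>x)" by force
  moreover have "inj_on ?h A" for A by (auto simp: inj_on_def)
  ultimately have "card xv_darts = card (SIGMA x:crossings G. \<Union>x)" by (simp add: card_image)
  also have "\<dots> = (\<Sum>x\<in>crossings G. card (\<Union>x))"
  proof (rule card_SigmaI)
    show "finite (crossings G)" by (rule finite_crossings)
    show "\<forall>x\<in>crossings G. finite (\<Union>x)"
      using crossing_ends_card by (metis card.infinite zero_neq_numeral)
  qed
  also have "\<dots> = 4 * card (crossings G)" using crossing_ends_card by simp
  finally show ?thesis .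
qed

lemma card_crossing_edges: "card (\<Union>(crossings G)) = 2 * card (crossings G)"
proof -
  have "card (\<Union>(crossings G)) = sum card (crossings G)"
    using crossings_disjnt crossing_card
    by (intro card_Union_disjoint) (auto intro: card_ge_0_finite)
  then show ?thesis using crossing_card by simp
qed

lemma card_quad_edges: "card (edges (quad_subgraph G)) + 2 * card (crossings G) = card (edges G)"
proof -
  have "\<Union>(crossings G) \<subseteq> edges G" using crossing_subset by blast
  then have "card (edges G - \<Union>(crossings G)) = card (edges G) - card (\<Union>(crossings G))"
    "card (\<Union>(crossings G)) \<le> card (edges G)"
    by (simp_all add: card_Diff_subset finite_subset[OF _ finite_edges] card_mono[OF finite_edges])
  then show ?thesis using card_crossing_edges unfolding quad_subgraph_def by simp
qed

lemma card_vv: "card vv_darts = 2 * card (edges (quad_subgraph G))"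
proof -
  let ?D = "{(u, v). {u, v} \<in> edges (quad_subgraph G)}"
  have "finite ?D"
    by (rule finite_subset[of _ "verts G \<times> verts G"]) (use quad_edge finite_verts in auto)
  then have "card ?D = 2 * card {{u, v} |u v. (u, v) \<in> ?D}"
    by (rule card_symmetric_pairs) (use quad_edge in \<open>auto simp: insert_commute\<close>)
  moreover have "{{u, v} |u v. (u, v) \<in> ?D} = edges (quad_subgraph G)"
  proof -
    have "\<exists>u v. e = {u, v}" if "e \<in> edges (quad_subgraph G)" for e
      using that edge_card[of e] unfolding quad_subgraph_def by (auto simp: card_2_iff)
    then show ?thesis by blast
  qed
  moreover have "vv_darts = map_prod Vertex Vertex ` ?D"
    unfolding vv_darts_def using dart_vv by (auto simp: image_iff)
  moreover have "inj_on (map_prod Vertex Vertex) ?D" by (auto simp: inj_on_def)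
  ultimately show ?thesis by (simp add: card_image)
qed

lemma card_darts: "card (darts G) = 2 * card (segments G)"
  unfolding segments_eq
proof (rule card_symmetric_pairs[OF finite_darts])
  show "(q, p) \<in> darts G" if "(p, q) \<in> darts G" for p q using that dart_sym by blast
  show "p \<noteq> q" if "(p, q) \<in> darts G" for p q using that dart_points by blast
qed

lemma card_segments: "card (segments G) = card (edges G) + 2 * card (crossings G)"
proof -
  have "card (darts G) = card vv_darts + 2 * card xv_darts"
    using card_dart_split[OF subset_refl next_dart_in] darts_split
    by (metis Int_absorb2 Un_upper1 Un_upper2 order_trans)
  then show ?thesis using card_darts card_xv card_vv card_quad_edges by simp
qed

lemma card_points: "card (points G) = card (verts G) + card (crossings G)"
proof -
  have "card (points G) = card (Vertex ` verts G) + card ((Crossing :: _ \<Rightarrow> 'a point) ` crossings G)"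
    unfolding points_def using finite_verts finite_crossings by (intro card_Un_disjoint) auto
  then show ?thesis by (simp add: card_image inj_on_def)
qed

text \<open>A facial walk of length two would make both ends of its segment points of degree one, so
  that the planarization had only these two points, against the three vertices.\<close>

lemma next_dart_ne:
  assumes "d \<in> darts G"
  shows "next_dart G d \<noteq> d" "next_dart G (next_dart G d) \<noteq> d"
proof -
  obtain p q where d: "d = (p, q)" by fastforce
  have pq: "(p, q) \<in> darts G" using assms d by simp
  show "next_dart G d \<noteq> d" using dart_points[OF pq] d by auto
  show "next_dart G (next_dart G d) \<noteq> d"
  proof
    assume "next_dart G (next_dart G d) = d"
    then have r: "rot G q p = p" "rot G p q = q" using d by auto
    have np: "s = q" if "(p, s) \<in> darts G" for s
      using pq that by (induction rule: rot_induct) (use r in auto)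
    have qp: "(q, p) \<in> darts G" using pq dart_sym by blast
    have nq: "s = p" if "(q, s) \<in> darts G" for s
      using qp that by (induction rule: rot_induct) (use r in auto)
    have "r \<in> {p, q}" if "r \<in> points G" for r
      by (rule points_connected[of p r]) (use dart_points[OF pq] that np nq in auto)
    then have "Vertex ` verts G \<subseteq> {p, q}" unfolding points_def by blast
    then have "card (Vertex ` verts G) \<le> card {p, q}" by (intro card_mono) auto
    also have "\<dots> \<le> 2" by (simp add: card_insert_if)
    finally show False using three_verts by (simp add: card_image inj_on_def)
  qed
qed

lemma face_triple:
  assumes "f \<in> faces G" "d \<in> f"
  shows "{d, next_dart G d, next_dart G (next_dart G d)} \<subseteq> f"
    and "card {d, next_dart G d, next_dart G (next_dart G d)} = 3"
proof -
  show "{d, next_dart G d, next_dart G (next_dart G d)} \<subseteq> f" using face_next assms by blast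
  have "d \<in> darts G" using face_mem assms by blast
  then show "card {d, next_dart G d, next_dart G (next_dart G d)} = 3"
    using next_dart_ne[of d] next_dart_ne(1)[of "next_dart G d"] next_dart_in by auto
qed

lemma finite_face: "f \<in> faces G \<Longrightarrow> finite f"
  by (rule finite_subset[OF _ finite_darts]) (use faces_Union in blast)

lemma card_face_ge: "f \<in> faces G \<Longrightarrow> 3 \<le> card f"
proof -
  assume f: "f \<in> faces G"
  then obtain d where "d \<in> f" using face_nonempty by blast
  then show ?thesis using face_triple[OF f] card_mono[OF finite_face[OF f]] by metis
qed

lemma card_by_faces: "D \<subseteq> darts G \<Longrightarrow> card D = (\<Sum>f\<in>faces G. card (D \<inter> f))"
proof -
  assume D: "D \<subseteq> darts G"
  have "card (\<Union>f\<in>faces G. D \<inter> f) = (\<Sum>f\<in>faces G. card (D \<inter> f))"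
    using finite_faces finite_face faces_disjoint by (intro card_UN_disjoint) auto
  moreover have "(\<Union>f\<in>faces G. D \<inter> f) = D" using D faces_Union by blast
  ultimately show ?thesis by simp
qed

end


section \<open>The triangles of an optimal drawing\<close>

locale optimal_toroidal = drawn_graph +
  assumes optimal: "card (edges G) = 4 * card (verts G)" and toroidal: "0 \<le> euler_char G"
begin

text \<open>For a face let \<open>a\<close> and \<open>c\<close> count its darts between vertices
  and its darts out of crossings; its length \<open>a + 2c\<close> is at least 3, hence also
  \<open>a + c \<ge> 2\<close>. With \<open>n\<close> vertices, \<open>k\<close> crossings and
  \<open>F\<close> faces, summation gives \<open>3F \<le> 8n + 4k\<close> and
  \<open>2F \<le> 8n\<close>.\<close>

lemma face_counts:
  shows "euler_char G = 0"
    and "f \<in> faces G \<Longrightarrow> card (vv_darts \<inter> f) = 1" "f \<in> faces G \<Longrightarrow> card f = 3"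
proof -
  let ?a = "\<lambda>f. card (vv_darts \<inter> f)" and ?c = "\<lambda>f. card (xv_darts \<inter> f)"
  let ?n = "card (verts G)" and ?k = "card (crossings G)" and ?F = "card (faces G)"
  have fsplit: "card f = ?a f + 2 * ?c f" if "f \<in> faces G" for f
    using card_dart_split[of f] face_mem[OF that] face_next[OF that] by blast
  have sa: "(\<Sum>f\<in>faces G. ?a f) + 4 * ?k = 8 * ?n"
    using card_by_faces[of vv_darts] card_vv card_quad_edges optimal
    unfolding vv_darts_def by simp
  have sc: "(\<Sum>f\<in>faces G. ?c f) = 4 * ?k"
    using card_by_faces[of xv_darts] card_xv unfolding xv_darts_def by simp
  have g2: "2 \<le> ?a f + ?c f" if "f \<in> faces G" for f
    using fsplit[OF that] card_face_ge[OF that] by linarith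
  have g3: "3 \<le> ?a f + 2 * ?c f" if "f \<in> faces G" for f
    using fsplit[OF that] card_face_ge[OF that] by linarith
  have s2: "(\<Sum>f\<in>faces G. ?a f + ?c f) = 8 * ?n"
    using sa sc by (simp add: sum.distrib)
  have s3: "(\<Sum>f\<in>faces G. ?a f + 2 * ?c f) = 8 * ?n + 4 * ?k"
    using sa sc by (simp add: sum.distrib sum_distrib_left[symmetric])
  have F2: "?F * 2 \<le> 8 * ?n"
    using sum_bounded_below[of "faces G" 2 "\<lambda>f. ?a f + ?c f"] g2 unfolding s2 by simp
  have F3: "?F * 3 \<le> 8 * ?n + 4 * ?k"
    using sum_bounded_below[of "faces G" 3 "\<lambda>f. ?a f + 2 * ?c f"] g3 unfolding s3 by simp
  have chi: "euler_char G = int ?F - 3 * int ?n - int ?k"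
    unfolding euler_char_def using card_points card_segments optimal by simp
  \<comment> \<open>The Euler characteristic gives \<open>F \<ge> 3n + k\<close>. Combined with
    \<open>F \<le> 4n\<close> it yields \<open>k \<le> n\<close>, combined with
    \<open>3F \<le> 8n + 4k\<close> it yields \<open>n \<le> k\<close>. All estimates are then
    equalities, so each face has \<open>a + c = 2\<close> and \<open>a + 2c = 3\<close>.\<close>
  have eqs: "?k = ?n" "?F = 4 * ?n" using chi toroidal F2 F3 by linarith+
  show "euler_char G = 0" using chi eqs by simp
  have "?a f = 1 \<and> card f = 3" if f: "f \<in> faces G" for f
  proof -
    have "?a f + ?c f = 2"
      by (rule sum_eq_lower_bound[OF finite_faces g2 _ f]) (use s2 eqs in auto)
    moreover have "?a f + 2 * ?c f = 3"
      by (rule sum_eq_lower_bound[OF finite_faces g3 _ f]) (use s3 eqs in auto)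
    ultimately show ?thesis using fsplit[OF f] by linarith
  qed
  then show "f \<in> faces G \<Longrightarrow> card (vv_darts \<inter> f) = 1" "f \<in> faces G \<Longrightarrow> card f = 3" by blast+
qed

lemma dart_in_face: "d \<in> darts G \<Longrightarrow> orbit (next_dart G) d \<in> faces G"
  unfolding faces_def by blast

lemma next_dart_cubed:
  assumes "d \<in> darts G"
  shows "next_dart G (next_dart G (next_dart G d)) = d"
proof -
  let ?f = "orbit (next_dart G) d"
  let ?T = "{d, next_dart G d, next_dart G (next_dart G d)}"
  have f: "?f \<in> faces G" "d \<in> ?f" using dart_in_face self_in_face assms by blast+
  have "?T = ?f"
    using face_triple[OF f] face_counts(3)[OF f(1)] finite_face[OF f(1)] by (intro card_subset_eq) auto
  moreover have "next_dart G (next_dart G (next_dart G d)) \<in> ?f" using f face_next by blast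
  moreover have "next_dart G (next_dart G (next_dart G d)) \<noteq> next_dart G d"
    "next_dart G (next_dart G (next_dart G d)) \<noteq> next_dart G (next_dart G d)"
    using next_dart_ne next_dart_in assms by blast+
  ultimately show ?thesis by blast
qed

text \<open>The facial walk that enters \<open>x\<close> from \<open>u\<close> closes after three
  darts, so its third side joins the end \<open>w\<close> that follows \<open>u\<close> around
  \<open>x\<close> back to \<open>u\<close>, without meeting another crossing.\<close>

lemma corner_of_crossing:
  assumes "x \<in> crossings G" "u \<in> \<Union>x"
  obtains w where "rot G (Crossing x) (Vertex u) = Vertex w" "w \<in> \<Union>x"
    "(Vertex w, Vertex u) \<in> darts G" "rot G (Vertex u) (Vertex w) = Crossing x"
proof -
  have d: "(Vertex u, Crossing x) \<in> darts G" using assms dart_vx by blast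
  then have e: "(Crossing x, rot G (Crossing x) (Vertex u)) \<in> darts G" using next_dart_in by fastforce
  then obtain w where w: "rot G (Crossing x) (Vertex u) = Vertex w"
    using dart_xx by (cases "rot G (Crossing x) (Vertex u)") auto
  then have g: "(Vertex w, rot G (Vertex w) (Crossing x)) \<in> darts G"
    using next_dart_in[OF e] by simp
  have "next_dart G (next_dart G (next_dart G (Vertex u, Crossing x))) = (Vertex u, Crossing x)"
    by (rule next_dart_cubed[OF d])
  then have r: "rot G (Vertex w) (Crossing x) = Vertex u" using w by simp
  have "rot G (rot G (Vertex w) (Crossing x)) (Vertex w) = Crossing x"
    using next_dart_cubed[OF d] unfolding next_dart_simp w prod.inject by blast
  then show thesis
    using that[OF w] e g unfolding r w dart_xv by blast
qed

text \<open>A triangle has only one side between two vertices, so the point opposite to a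
  non-crossing edge is a crossing with both ends of that edge among its own.\<close>

lemma crossing_of_edge:
  assumes "(Vertex w, Vertex u) \<in> darts G"
  obtains x where "rot G (Vertex u) (Vertex w) = Crossing x" "x \<in> crossings G"
    "u \<in> \<Union>x" "w \<in> \<Union>x"
proof -
  let ?d = "(Vertex w, Vertex u)" and ?r = "rot G (Vertex u) (Vertex w)"
  let ?f = "orbit (next_dart G) ?d"
  have f: "?f \<in> faces G" "?d \<in> ?f" using dart_in_face self_in_face assms by blast+
  have nd: "(Vertex u, ?r) \<in> darts G" using next_dart_in[OF assms] by simp
  have "?r \<noteq> Vertex v" for v
  proof
    assume v: "?r = Vertex v"
    have "(Vertex u, Vertex v) \<in> vv_darts \<inter> ?f" "?d \<in> vv_darts \<inter> ?f"
      using f face_next[OF f] nd v assms unfolding vv_darts_def by auto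
    moreover have "is_singleton (vv_darts \<inter> ?f)"
      using face_counts(2)[OF f(1)] unfolding is_singleton_altdef .
    ultimately have "(Vertex u, Vertex v) = ?d" unfolding is_singleton_def by (metis singletonD)
    then show False using dart_points[OF assms] by simp
  qed
  then obtain x where x: "?r = Crossing x" by (cases ?r) auto
  have "rot G (Crossing x) (Vertex u) = Vertex w"
    using next_dart_cubed[OF assms] x by simp
  moreover have "(Crossing x, rot G (Crossing x) (Vertex u)) \<in> darts G"
    using next_dart_in[OF nd] x by simp
  ultimately show thesis using that[OF x] nd x dart_xv dart_vx by simp
qed

text \<open>Ends that follow each other around the crossing are joined by the third side of their
  triangle, and the two ends of one crossing edge by that edge. By alternation the rotation runs
  through both ends of \<open>e\<close> and both ends of \<open>f\<close> in turn; it cannot return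
  after two steps (\<open>no2\<close>), because it would then miss two of the four ends.\<close>

lemma crossing_ends_adjacent:
  assumes x: "x \<in> crossings G" and uv: "u \<in> \<Union>x" "v \<in> \<Union>x" "u \<noteq> v"
  shows "{u, v} \<in> edges G"
proof -
  obtain e f where ef: "x = {e, f}" "e \<in> edges G" "f \<in> edges G" "e \<inter> f = {}" "e \<noteq> f"
    by (rule crossing_eq[OF x])
  obtain a a' where e: "e = {a, a'}" "a \<noteq> a'" using edge_card[OF ef(2)] by (meson card_2_iff)
  obtain b b' where f: "f = {b, b'}" "b \<noteq> b'" using edge_card[OF ef(3)] by (meson card_2_iff)
  let ?r = "\<lambda>u. rot G (Crossing x) (Vertex u)"
  have inj: "s = t" if "?r s = ?r t" "s \<in> \<Union>x" "t \<in> \<Union>x" for s t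
    using inj_onD[OF rot_inj[of "Crossing x"] that(1)] that(2,3) x dart_xv nbrs_iff
    unfolding points_def by auto
  have adj: "\<exists>w. ?r s = Vertex w \<and> w \<in> \<Union>x \<and> {w, s} \<in> edges G" if "s \<in> \<Union>x" for s
    using corner_of_crossing[OF x that] dart_vv quad_edge by metis
  have re: "\<exists>w\<in>f. ?r s = Vertex w \<and> {w, s} \<in> edges G" if s: "s \<in> e" for s
  proof -
    obtain w where w: "?r s = Vertex w" "w \<in> \<Union>x" "{w, s} \<in> edges G" using adj s ef(1) by blast
    then have "w \<notin> e" using rot_alternates[OF x _ s] ef(1) by auto
    then show ?thesis using w ef(1) by auto
  qed
  have rf: "\<exists>w\<in>e. ?r s = Vertex w \<and> {w, s} \<in> edges G" if s: "s \<in> f" for s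
  proof -
    obtain w where w: "?r s = Vertex w" "w \<in> \<Union>x" "{w, s} \<in> edges G" using adj s ef(1) by blast
    then have "w \<notin> f" using rot_alternates[OF x _ s] ef(1) by auto
    then show ?thesis using w ef(1) by auto
  qed
  have no2: False if "?r s = Vertex t" "?r t = Vertex s" "s \<in> e" "t \<in> f" for s t
  proof -
    have nb: "(Crossing x, Vertex y) \<in> darts G" if "y \<in> \<Union>x" for y using that x dart_xv by blast
    have "y = s \<or> y = t" if "y \<in> \<Union>x" for y
    proof -
      have "(Crossing x, Vertex s) \<in> darts G" using nb \<open>s \<in> e\<close> ef(1) by blast
      then have "Vertex y \<in> {Vertex s, Vertex t}"
        using nb[OF that] by (induction rule: rot_induct) (use \<open>?r s = _\<close> \<open>?r t = _\<close> in auto)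
      then show ?thesis by auto
    qed
    then have "\<Union>x \<subseteq> {s, t}" by blast
    then have "card (\<Union>x) \<le> card {s, t}" by (intro card_mono) auto
    then show False using crossing_ends_card[OF x] card_insert_le_m1[of 2 "{t}" s] by simp
  qed
  have Ux: "\<Union>x = {a, a', b, b'}" using ef(1) e f by auto
  have mem: "a \<in> e" "a' \<in> e" "b \<in> f" "b' \<in> f" using e f by auto
  obtain w w' where w: "w \<in> f" "?r a = Vertex w" "{w, a} \<in> edges G"
    "w' \<in> f" "?r a' = Vertex w'" "{w', a'} \<in> edges G" using re[OF mem(1)] re[OF mem(2)] by blast
  have ww: "w \<noteq> w'"
  proof
    assume "w = w'"
    then have "a = a'" by (intro inj) (use w Ux in auto)
    then show False using e by simp
  qed
  obtain z z' where z: "z \<in> e" "?r w = Vertex z" "{z, w} \<in> edges G"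
    "z' \<in> e" "?r w' = Vertex z'" "{z', w'} \<in> edges G" using rf[OF w(1)] rf[OF w(4)] by blast
  have "z = a'" "z' = a" using no2[of a w] no2[of a' w'] w z mem e by auto
  then have "{a', w} \<in> edges G" "{a, w'} \<in> edges G" "{a, w} \<in> edges G" "{a', w'} \<in> edges G"
    using z w by (auto simp: insert_commute)
  moreover have "f = {w, w'}" using w ww f by auto
  ultimately have "\<forall>s\<in>e. \<forall>t\<in>f. {s, t} \<in> edges G \<and> {t, s} \<in> edges G"
    using e by (auto simp: insert_commute)
  moreover have "u \<in> e \<and> v \<in> e \<or> u \<in> f \<and> v \<in> f \<or> u \<in> e \<and> v \<in> f \<or> u \<in> f \<and> v \<in> e"
    using uv ef(1) by auto
  moreover have "u \<in> e \<and> v \<in> e \<Longrightarrow> {u, v} = e" "u \<in> f \<and> v \<in> f \<Longrightarrow> {u, v} = f"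
    using uv(3) e f by auto
  ultimately show ?thesis using ef(2,3) by metis
qed

text \<open>The vertices of the face of \<open>quad_subgraph G\<close> that contains a dart.\<close>

fun corners :: "'a point \<times> 'a point \<Rightarrow> 'a set" where
  "corners (p, Crossing x) = \<Union>x"
| "corners (Crossing x, Vertex v) = \<Union>x"
| "corners (Vertex u, Vertex v) = (case rot G (Vertex v) (Vertex u) of Crossing x \<Rightarrow> \<Union>x | Vertex _ \<Rightarrow> {})"

text \<open>All three darts of a triangle refer to its only crossing. Since the two directions of a
  half-edge have the same \<open>corners\<close> by definition, \<open>corners\<close> is constant
  on each quadrangle and can change only across a non-crossing edge.\<close>

lemma corners_next:
  assumes "d \<in> darts G"
  shows "corners (next_dart G d) = corners d"
proof -
  obtain p q where d: "d = (p, q)" by fastforce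
  show ?thesis
  proof (cases q)
    case (Crossing x)
    then show ?thesis using d assms next_dart_in[OF assms] dart_xx
      by (cases "rot G q p") auto
  next
    case q: (Vertex v)
    show ?thesis
    proof (cases p)
      case (Vertex u)
      have "(Vertex u, Vertex v) \<in> darts G" using assms d q Vertex by simp
      then obtain x where "rot G (Vertex v) (Vertex u) = Crossing x" by (rule crossing_of_edge)
      then show ?thesis using d q Vertex by simp
    next
      case (Crossing x)
      have x: "x \<in> crossings G" "v \<in> \<Union>x" using assms d q Crossing dart_xv by blast+
      have cube: "next_dart G (next_dart G (next_dart G d)) = d" by (rule next_dart_cubed[OF assms])
      then obtain u where u: "rot G (Vertex v) (Crossing x) = Vertex u"
        "rot G (Vertex u) (Vertex v) = Crossing x"
      proof -
        let ?r = "rot G (Vertex v) (Crossing x)"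
        have c: "rot G ?r (Vertex v) = Crossing x" using cube d q Crossing by simp
        have "(?r, rot G ?r (Vertex v)) \<in> darts G"
          using next_dart_in[OF next_dart_in[OF assms]] d q Crossing by simp
        then have "(?r, Crossing x) \<in> darts G" using c by simp
        then obtain u where "?r = Vertex u" using dart_xx by (cases ?r) auto
        then show thesis using that c by simp
      qed
      then show ?thesis using d q Crossing by simp
    qed
  qed
qed

lemma corners_crossing:
  assumes "d \<in> darts G"
  obtains x where "x \<in> crossings G" "corners d = \<Union>x"
proof -
  obtain p q where d: "d = (p, q)" by fastforce
  then have pq: "(p, q) \<in> darts G" using assms by simp
  show thesis
  proof (cases q)
    case (Crossing x)
    then show ?thesis using that[of x] pq d dart_vx dart_xx by (cases p) auto
  next
    case q: (Vertex v)
    show ?thesis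
    proof (cases p)
      case (Crossing x)
      then show ?thesis using that[of x] pq d q dart_xv by auto
    next
      case (Vertex u)
      then have "(Vertex u, Vertex v) \<in> darts G" using pq q by simp
      then obtain x where "rot G (Vertex v) (Vertex u) = Crossing x" "x \<in> crossings G"
        by (rule crossing_of_edge)
      then show ?thesis using that[of x] d q Vertex by simp
    qed
  qed
qed

lemma corners_adjacent:
  "d \<in> darts G \<Longrightarrow> u \<in> corners d \<Longrightarrow> v \<in> corners d \<Longrightarrow> u \<noteq> v \<Longrightarrow> {u, v} \<in> edges G"
  by (rule corners_crossing[of d]) (auto intro: crossing_ends_adjacent simp del: Union_iff)

lemma corners_verts: "d \<in> darts G \<Longrightarrow> corners d \<subseteq> verts G"
  by (rule corners_crossing[of d]) (auto intro: crossing_ends_verts simp del: Union_iff)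

lemma corners_fst: "(Vertex u, q) \<in> darts G \<Longrightarrow> u \<in> corners (Vertex u, q)"
proof (cases q)
  case (Crossing x)
  then show "(Vertex u, q) \<in> darts G \<Longrightarrow> u \<in> corners (Vertex u, q)" using dart_vx by simp
next
  case (Vertex v)
  assume "(Vertex u, q) \<in> darts G"
  then have "(Vertex u, Vertex v) \<in> darts G" using Vertex by simp
  then obtain x where "rot G (Vertex v) (Vertex u) = Crossing x" "u \<in> \<Union>x" by (rule crossing_of_edge)
  then show "u \<in> corners (Vertex u, q)" using Vertex by simp
qed

lemma corners_snd:
  assumes "(p, Vertex v) \<in> darts G"
  shows "v \<in> corners (p, Vertex v)"
proof -
  have "(Vertex v, rot G (Vertex v) p) \<in> darts G" using next_dart_in[OF assms] by simp
  then show ?thesis using corners_fst[of v "rot G (Vertex v) p"] corners_next[OF assms] by simp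
qed

end


section \<open>Regions\<close>

context drawn_graph
begin

abbreviation hsegs :: "'a ugraph \<Rightarrow> 'a point set set" where
  "hsegs H \<equiv> (\<lambda>e. Vertex ` e) ` edges H"

definition boundary :: "'a ugraph \<Rightarrow> ('a point \<times> 'a point) set \<Rightarrow> ('a point \<times> 'a point) set" where
  "boundary H R = {(p, q) \<in> R. {p, q} \<in> hsegs H}"

lemma boundary_iff: "(p, q) \<in> boundary H R \<longleftrightarrow> (p, q) \<in> R \<and> {p, q} \<in> hsegs H"
  unfolding boundary_def by simp

lemma boundary_subset: "boundary H R \<subseteq> R"
  unfolding boundary_def by blast

lemma glue_next: "d \<in> darts G \<Longrightarrow> (d, next_dart G d) \<in> glue G H"
  unfolding glue_def by blast

lemma glue_rev: "(p, q) \<in> darts G \<Longrightarrow> {p, q} \<notin> hsegs H \<Longrightarrow> ((p, q), (q, p)) \<in> glue G H"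
  unfolding glue_def by blast

lemma glue_cases:
  assumes "(d, e) \<in> glue G H"
  obtains "d \<in> darts G" "e = next_dart G d"
  | p q where "d = (p, q)" "e = (q, p)" "(p, q) \<in> darts G" "{p, q} \<notin> hsegs H"
  using assms unfolding glue_def by blast

lemma glue_rtrancl_darts: "(d, e) \<in> (glue G H)\<^sup>* \<Longrightarrow> d \<in> darts G \<Longrightarrow> e \<in> darts G"
proof (induction rule: rtrancl_induct)
  case (step e c)
  from step(2) show ?case
    by (rule glue_cases) (use step(3,4) next_dart_in dart_sym in auto)
qed

lemma orbit_glue:
  assumes "d \<in> darts G" "e \<in> orbit (next_dart G) d"
  shows "(d, e) \<in> (glue G H)\<^sup>*"
proof -
  have "e \<in> darts G \<and> (d, e) \<in> (glue G H)\<^sup>*"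
    using assms(2)
  proof induction
    case base
    show ?case using glue_next[OF assms(1)] next_dart_in[OF assms(1)] by blast
  next
    case (step e)
    then show ?case using glue_next next_dart_in by (meson rtrancl.rtrancl_into_rtrancl)
  qed
  then show ?thesis ..
qed

text \<open>\<open>glue\<close> is not symmetric, but a step along a facial walk can be undone by
  continuing around the face. This makes the regions equivalence classes.\<close>

lemma glue_rtrancl_sym: "(d, e) \<in> (glue G H)\<^sup>* \<Longrightarrow> (e, d) \<in> (glue G H)\<^sup>*"
proof (induction rule: rtrancl_induct)
  case (step e c)
  from step(2) have "(c, e) \<in> (glue G H)\<^sup>*"
  proof (rule glue_cases)
    assume e: "e \<in> darts G" "c = next_dart G e"
    then have "e \<in> orbit (next_dart G) c"
      using self_in_face[OF e(1)] self_in_orbit_step by metis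
    then show ?thesis using e orbit_glue next_dart_in by blast
  next
    fix p q assume pq: "e = (p, q)" "c = (q, p)" "(p, q) \<in> darts G" "{p, q} \<notin> hsegs H"
    then have "((q, p), (p, q)) \<in> glue G H"
      using glue_rev[of q p H] dart_sym by (simp add: insert_commute)
    then show ?thesis using pq by blast
  qed
  then show ?case using step.IH by (rule rtrancl_trans)
qed simp

lemma region_mem:
  assumes "R \<in> regions G H" "d \<in> R"
  shows "d \<in> darts G" "R = (glue G H)\<^sup>* `` {d}"
proof -
  obtain c where c: "c \<in> darts G" "R = (glue G H)\<^sup>* `` {c}"
    using assms(1) unfolding regions_def by (auto elim: quotientE)
  then have cd: "(c, d) \<in> (glue G H)\<^sup>*" using assms(2) by blast
  then show "d \<in> darts G" using c(1) glue_rtrancl_darts by blast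
  show "R = (glue G H)\<^sup>* `` {d}"
    unfolding c(2) using cd glue_rtrancl_sym[OF cd] by (auto intro: rtrancl_trans)
qed

lemma region_ex: "d \<in> darts G \<Longrightarrow> \<exists>R\<in>regions G H. d \<in> R"
  unfolding regions_def by (blast intro: quotientI)

lemma region_eqI: "R \<in> regions G H \<Longrightarrow> R' \<in> regions G H \<Longrightarrow> d \<in> R \<Longrightarrow> d \<in> R' \<Longrightarrow> R = R'"
  using region_mem(2)[of R H d] region_mem(2)[of R' H d] by simp

lemma region_subset: "R \<in> regions G H \<Longrightarrow> R \<subseteq> darts G"
  using region_mem(1) by blast

lemma region_nonempty: "R \<in> regions G H \<Longrightarrow> R \<noteq> {}"
  unfolding regions_def by (auto elim: quotientE)

lemma finite_region: "R \<in> regions G H \<Longrightarrow> finite R"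
  using finite_subset[OF region_subset finite_darts] .

lemma finite_regions: "finite (regions G H)"
  by (rule finite_subset[of _ "Pow (darts G)"]) (use region_subset finite_darts in auto)

lemma region_next: "R \<in> regions G H \<Longrightarrow> d \<in> R \<Longrightarrow> next_dart G d \<in> R"
  using region_mem[of R H d] glue_next[of d H] by auto

lemma region_prev:
  assumes "R \<in> regions G H" "next_dart G d \<in> R" "d \<in> darts G"
  shows "d \<in> R"
  using glue_rtrancl_sym[OF r_into_rtrancl[OF glue_next[OF assms(3), of H]]] region_mem(2)[OF assms(1,2)]
  by simp

lemma region_rev: "R \<in> regions G H \<Longrightarrow> (p, q) \<in> R \<Longrightarrow> {p, q} \<notin> hsegs H \<Longrightarrow> (q, p) \<in> R"
  using region_mem[of R H "(p, q)"] glue_rev[of p q H] by auto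

text \<open>Induction over a region: from one dart everything is reached along facial walks and
  across segments outside \<open>H\<close>.\<close>

lemma region_minimal:
  assumes "R \<in> regions G H" "d \<in> R" "d \<in> X"
    and "\<And>d. d \<in> R \<Longrightarrow> d \<in> X \<Longrightarrow> next_dart G d \<in> X"
    and "\<And>p q. (p, q) \<in> R \<Longrightarrow> (p, q) \<in> X \<Longrightarrow> {p, q} \<notin> hsegs H \<Longrightarrow> (q, p) \<in> X"
  shows "R \<subseteq> X"
proof
  fix e assume "e \<in> R"
  then have "(d, e) \<in> (glue G H)\<^sup>*" using region_mem(2)[OF assms(1,2)] by blast
  then have "e \<in> X \<and> e \<in> R"
  proof (induction rule: rtrancl_induct)
    case base
    show ?case using assms(2,3) by blast
  next
    case (step e c)
    from step(2) show ?case
      by (rule glue_cases) (use step(3) assms(4,5) region_next[OF assms(1)] region_rev[OF assms(1)] in auto)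
  qed
  then show "e \<in> X" ..
qed

text \<open>A reversal followed by \<open>next_dart G\<close> is one turn around \<open>p\<close>.
  At a point that meets no edge of \<open>H\<close> every reversal stays inside the region, so the
  region contains all darts there.\<close>

lemma region_at_point:
  assumes "R \<in> regions G H" "(p, q) \<in> R" "(p, r) \<in> darts G" "\<And>s. {p, s} \<notin> hsegs H"
  shows "(p, r) \<in> R"
proof -
  have "(p, q) \<in> darts G" using assms(1,2) region_subset by blast
  then show ?thesis using assms(3)
  proof (induction rule: rot_induct)
    case base
    show ?case by (rule assms(2))
  next
    case (step s)
    show ?case using region_next[OF assms(1) region_rev[OF assms(1) step(2) assms(4)]] by simp
  qed
qed

text \<open>Under this hypothesis \<open>R\<close> is closed under all reversals. It is used in
  contrapositive form: a region other than the whole surface has a boundary dart whose reverse lies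
  in another region.\<close>

lemma region_all_darts:
  assumes "R \<in> regions G H" "\<And>p q. (p, q) \<in> boundary H R \<Longrightarrow> (q, p) \<in> R"
  shows "R = darts G"
proof -
  obtain d where "d \<in> R" using region_nonempty[OF assms(1)] by blast
  then show ?thesis
  proof (rule darts_connected[OF _ region_subset[OF assms(1)] region_next[OF assms(1)]])
    show "(q, p) \<in> R" if "(p, q) \<in> R" for p q
      using that region_rev[OF assms(1) that] assms(2)[of p q] unfolding boundary_iff by blast
  qed
qed

lemma sum_regions:
  assumes "\<And>R. R \<in> regions G H \<Longrightarrow> finite (A R)"
    and "\<And>R R' a. R \<in> regions G H \<Longrightarrow> R' \<in> regions G H \<Longrightarrow> a \<in> A R \<Longrightarrow> a \<in> A R' \<Longrightarrow> R = R'"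
    and "(\<Union>R\<in>regions G H. A R) = T"
  shows "(\<Sum>R\<in>regions G H. card (A R)) = card T"
proof -
  have "\<forall>R\<in>regions G H. \<forall>R'\<in>regions G H. R \<noteq> R' \<longrightarrow> A R \<inter> A R' = {}" using assms(2) by blast
  then show ?thesis
    unfolding assms(3)[symmetric]
    by (intro card_UN_disjoint[OF finite_regions, symmetric]) (use assms(1) in blast)+
qed

text \<open>The alternating count of open cells that \<open>two_cell\<close> requires to be 1, kept
  as a number so that it can be summed over regions and bounded.\<close>

definition euler_region :: "'a ugraph \<Rightarrow> ('a point \<times> 'a point) set \<Rightarrow> int" where
  "euler_region H R = int (card (inner_points G H R)) - int (card (inner_segments G H R))
     + int (card (inner_faces G R))"

end


text \<open>\<open>subgraph\<close> compares vertex sets and edge sets separately, so it has to be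
  said that the edges of \<open>H\<close> end in vertices of \<open>H\<close>.\<close>

locale drawn_subgraph = drawn_graph +
  fixes H :: "'a ugraph"
  assumes sub: "subgraph H (quad_subgraph G)" and edge_in_verts: "e \<in> edges H \<Longrightarrow> e \<subseteq> verts H"
begin

lemma hseg_vertex:
  assumes "{p, q} \<in> hsegs H"
  obtains u v where "p = Vertex u" "q = Vertex v" "{u, v} \<in> edges H" "u \<in> verts H" "v \<in> verts H"
proof -
  obtain e where e: "e \<in> edges H" "{p, q} = Vertex ` e" using assms by blast
  then obtain u v where uv: "p = Vertex u" "q = Vertex v" by blast
  then have "e = {u, v}" using e(2) inj_image_eq_iff[of Vertex "{u, v}" e] by (simp add: inj_def)
  then show thesis using that uv e edge_in_verts by blast
qed

lemma hseg_iff: "{Vertex u, Vertex v} \<in> hsegs H \<longleftrightarrow> {u, v} \<in> edges H"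
proof -
  have "{Vertex u, Vertex v} = Vertex ` e \<longleftrightarrow> {u, v} = e" for e :: "'a set"
    using inj_image_eq_iff[of Vertex "{u, v}" e] by (simp add: inj_def)
  then show ?thesis by (simp add: image_iff)
qed

lemma hseg_dart: "{p, q} \<in> hsegs H \<Longrightarrow> (p, q) \<in> darts G"
proof -
  assume "{p, q} \<in> hsegs H"
  then obtain u v where "p = Vertex u" "q = Vertex v" "{u, v} \<in> edges H" by (rule hseg_vertex)
  then show ?thesis using sub dart_vv unfolding subgraph_def by blast
qed

lemma no_hseg: "p \<notin> Vertex ` verts H \<Longrightarrow> {p, s} \<notin> hsegs H"
  using hseg_vertex by blast

lemma finite_hverts: "finite (verts H)"
  using sub finite_verts finite_subset unfolding subgraph_def quad_subgraph_def by auto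

lemma hverts_subset: "verts H \<subseteq> verts G"
  using sub unfolding subgraph_def quad_subgraph_def by auto

lemma sum_inner_points:
  "(\<Sum>R\<in>regions G H. card (inner_points G H R)) = card (points G) - card (verts H)"
proof -
  have "(\<Sum>R\<in>regions G H. card (inner_points G H R)) = card (points G - Vertex ` verts H)"
  proof (rule sum_regions)
    show "finite (inner_points G H R)" for R
      unfolding inner_points_def using finite_points by simp
    show "R = R'" if R: "R \<in> regions G H" "R' \<in> regions G H"
      and p: "p \<in> inner_points G H R" "p \<in> inner_points G H R'" for R R' p
    proof -
      obtain q r where qr: "(p, q) \<in> R" "(p, r) \<in> R'" "p \<notin> Vertex ` verts H"
        using p unfolding inner_points_def by blast
      have "(p, r) \<in> darts G" using qr(2) R(2) region_subset by blast
      then have "(p, r) \<in> R" by (rule region_at_point[OF R(1) qr(1) _ no_hseg[OF qr(3)]])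
      then show ?thesis using region_eqI[OF R] qr(2) by blast
    qed
    have "\<exists>R\<in>regions G H. p \<in> inner_points G H R" if p: "p \<in> points G" "p \<notin> Vertex ` verts H" for p
    proof -
      obtain q where "(p, q) \<in> darts G" using nbrs_nonempty[OF p(1)] nbrs_iff by blast
      then obtain R where "R \<in> regions G H" "(p, q) \<in> R" using region_ex by blast
      then show ?thesis using p unfolding inner_points_def by blast
    qed
    moreover have "inner_points G H R \<subseteq> points G - Vertex ` verts H" for R
      unfolding inner_points_def by auto
    ultimately show "(\<Union>R\<in>regions G H. inner_points G H R) = points G - Vertex ` verts H"
      by auto
  qed
  moreover have "card (points G - Vertex ` verts H) = card (points G) - card (Vertex ` verts H)"
    using hverts_subset finite_hverts unfolding points_def by (intro card_Diff_subset) auto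
  ultimately show ?thesis by (simp add: card_image inj_on_def)
qed

lemma card_hsegs: "card (hsegs H) = card (edges H)"
  by (rule card_image) (auto simp: inj_on_def inj_image_eq_iff)

lemma hsegs_subset: "hsegs H \<subseteq> segments G"
proof
  fix s assume s: "s \<in> hsegs H"
  then obtain e where e: "e \<in> edges H" "s = Vertex ` e" by blast
  then have "e \<in> edges G" using sub unfolding subgraph_def quad_subgraph_def by auto
  then obtain u v where "e = {u, v}" using edge_card by (meson card_2_iff)
  then have "s = {Vertex u, Vertex v}" using e by simp
  then show "s \<in> segments G" using s hseg_dart unfolding darts_def by blast
qed

lemma finite_segments: "finite (segments G)"
  unfolding segments_eq
  by (rule finite_subset[of _ "(\<lambda>(p, q). {p, q}) ` darts G"]) (use finite_darts in auto)

lemma finite_inner_segments: "R \<in> regions G H \<Longrightarrow> finite (inner_segments G H R)"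
  unfolding inner_segments_def
  by (rule finite_subset[of _ "(\<lambda>(p, q). {p, q}) ` R"]) (use finite_region in auto)

lemma inner_segment_iff:
  assumes "R \<in> regions G H"
  shows "{p, q} \<in> inner_segments G H R \<longleftrightarrow> (p, q) \<in> R \<and> {p, q} \<notin> hsegs H"
proof
  assume "{p, q} \<in> inner_segments G H R"
  then obtain p' q' where *: "{p, q} = {p', q'}" "(p', q') \<in> R" "{p', q'} \<notin> hsegs H"
    unfolding inner_segments_def by (auto simp del: image_iff)
  then show "(p, q) \<in> R \<and> {p, q} \<notin> hsegs H"
    using region_rev[OF assms *(2,3)] by (auto simp: doubleton_eq_iff)
qed (auto simp: inner_segments_def)

lemma inner_segment_ex: "s \<in> inner_segments G H R \<Longrightarrow> \<exists>p q. s = {p, q}"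
  unfolding inner_segments_def by auto

lemma sum_inner_segments:
  "(\<Sum>R\<in>regions G H. card (inner_segments G H R)) = card (segments G) - card (edges H)"
proof -
  have "(\<Sum>R\<in>regions G H. card (inner_segments G H R)) = card (segments G - hsegs H)"
  proof (rule sum_regions)
    show "finite (inner_segments G H R)" if "R \<in> regions G H" for R
      using that by (rule finite_inner_segments)
    show "R = R'" if R: "R \<in> regions G H" "R' \<in> regions G H"
      and s: "s \<in> inner_segments G H R" "s \<in> inner_segments G H R'" for R R' s
    proof -
      obtain p q where pq: "s = {p, q}" using inner_segment_ex[OF s(1)] by blast
      then show ?thesis using s inner_segment_iff R region_eqI[OF R, of "(p, q)"] by simp
    qed
    show "(\<Union>R\<in>regions G H. inner_segments G H R) = segments G - hsegs H"
    proof
      have "inner_segments G H R \<subseteq> segments G - hsegs H" if "R \<in> regions G H" for R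
        unfolding inner_segments_def segments_eq using region_subset[OF that] by blast
      then show "(\<Union>R\<in>regions G H. inner_segments G H R) \<subseteq> segments G - hsegs H" by blast
      have "\<exists>R\<in>regions G H. s \<in> inner_segments G H R" if s: "s \<in> segments G" "s \<notin> hsegs H" for s
      proof -
        obtain p q where pq: "s = {p, q}" "(p, q) \<in> darts G" using s(1) unfolding segments_eq by blast
        obtain R where "R \<in> regions G H" "(p, q) \<in> R" using region_ex[OF pq(2)] by blast
        then show ?thesis using inner_segment_iff[of R p q] pq(1) s(2) by blast
      qed
      then show "segments G - hsegs H \<subseteq> (\<Union>R\<in>regions G H. inner_segments G H R)" by blast
    qed
  qed
  moreover have "card (segments G - hsegs H) = card (segments G) - card (hsegs H)"
    by (rule card_Diff_subset[OF finite_subset[OF hsegs_subset finite_segments] hsegs_subset])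
  ultimately show ?thesis using card_hsegs by simp
qed

lemma sum_inner_faces: "(\<Sum>R\<in>regions G H. card (inner_faces G R)) = card (faces G)"
proof (rule sum_regions)
  show "finite (inner_faces G R)" for R unfolding inner_faces_def using finite_faces by simp
  show "R = R'" if "R \<in> regions G H" "R' \<in> regions G H" "f \<in> inner_faces G R" "f \<in> inner_faces G R'" for R R' f
    using that face_nonempty[of f] region_eqI[OF that(1,2)] unfolding inner_faces_def by blast
  have "\<exists>R\<in>regions G H. f \<subseteq> R" if f: "f \<in> faces G" for f
  proof -
    obtain d where d: "d \<in> f" using face_nonempty[OF f] by blast
    then have fd: "f = orbit (next_dart G) d" "d \<in> darts G" using face_mem[OF f d] by auto
    then obtain R where R: "R \<in> regions G H" "d \<in> R" using region_ex by blast
    then have "f \<subseteq> R" unfolding fd(1) using orbit_subset_darts[OF R(2) region_next[OF R(1)]] by blast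
    then show ?thesis using R by blast
  qed
  then show "(\<Union>R\<in>regions G H. inner_faces G R) = faces G" unfolding inner_faces_def by blast
qed

text \<open>Euler's formula by bookkeeping: every point, segment and face of the planarization that
  is not part of \<open>H\<close> belongs to exactly one region.\<close>

lemma sum_euler_region:
  "(\<Sum>R\<in>regions G H. euler_region H R) = euler_char G - int (card (verts H)) + int (card (edges H))"
proof -
  have le: "card (verts H) \<le> card (points G)" "card (edges H) \<le> card (segments G)"
  proof -
    have "card (verts H) \<le> card (verts G)" by (rule card_mono[OF finite_verts hverts_subset])
    then show "card (verts H) \<le> card (points G)" using card_points by simp
    show "card (edges H) \<le> card (segments G)"
      unfolding card_hsegs[symmetric] by (rule card_mono[OF finite_segments hsegs_subset])
  qed
  have "(\<Sum>R\<in>regions G H. euler_region H R)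
    = int (\<Sum>R\<in>regions G H. card (inner_points G H R)) - int (\<Sum>R\<in>regions G H. card (inner_segments G H R))
      + int (\<Sum>R\<in>regions G H. card (inner_faces G R))"
    unfolding euler_region_def by (simp add: sum.distrib sum_subtractf)
  then show ?thesis
    unfolding sum_inner_points sum_inner_segments sum_inner_faces euler_char_def using le by simp
qed

lemma sum_boundary: "(\<Sum>R\<in>regions G H. card (boundary H R)) = 2 * card (edges H)"
proof -
  let ?D = "{(p, q). {p, q} \<in> hsegs H}"
  have "(\<Sum>R\<in>regions G H. card (boundary H R)) = card ?D"
  proof (rule sum_regions)
    show "finite (boundary H R)" if "R \<in> regions G H" for R
      by (rule finite_subset[OF boundary_subset finite_region[OF that]])
    show "R = R'" if "R \<in> regions G H" "R' \<in> regions G H" "d \<in> boundary H R" "d \<in> boundary H R'" for R R' d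
      using that region_eqI[OF that(1,2)] unfolding boundary_def by blast
    show "(\<Union>R\<in>regions G H. boundary H R) = ?D"
    proof
      show "(\<Union>R\<in>regions G H. boundary H R) \<subseteq> ?D" unfolding boundary_def by blast
      have "\<exists>R\<in>regions G H. (p, q) \<in> boundary H R" if pq: "{p, q} \<in> hsegs H" for p q
        using region_ex[OF hseg_dart[OF pq], of H] pq unfolding boundary_iff by blast
      then show "?D \<subseteq> (\<Union>R\<in>regions G H. boundary H R)" by blast
    qed
  qed
  also have "card ?D = 2 * card {{p, q} |p q. (p, q) \<in> ?D}"
  proof (rule card_symmetric_pairs)
    show "finite ?D" by (rule finite_subset[OF _ finite_darts]) (use hseg_dart in auto)
    show "(q, p) \<in> ?D" if "(p, q) \<in> ?D" for p q using that by (simp add: insert_commute)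
    show "p \<noteq> q" if "(p, q) \<in> ?D" for p q using that hseg_dart dart_points by blast
  qed
  also have "{{p, q} |p q. (p, q) \<in> ?D} = hsegs H"
  proof -
    have "s \<in> {{p, q} |p q. (p, q) \<in> ?D}" if s: "s \<in> hsegs H" for s
    proof -
      obtain p q where "s = {p, q}" using subsetD[OF hsegs_subset s] unfolding segments_eq by auto
      moreover from this have "{p, q} \<in> hsegs H" using s by simp
      ultimately show ?thesis by auto
    qed
    moreover have "{{p, q} |p q. (p, q) \<in> ?D} \<subseteq> hsegs H" by auto
    ultimately show ?thesis by (intro equalityI subsetI) auto
  qed
  finally show ?thesis using card_hsegs by simp
qed

text \<open>Darts of \<open>R\<close> off \<open>H\<close> occur in reverse pairs. The identity ties
  the parity of the boundary length to that of \<open>card R\<close>.\<close>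

lemma card_region:
  assumes "R \<in> regions G H"
  shows "card R = 2 * card (inner_segments G H R) + card (boundary H R)"
proof -
  have "card (R - boundary H R) = 2 * card {{p, q} |p q. (p, q) \<in> R - boundary H R}"
  proof (rule card_symmetric_pairs)
    show "finite (R - boundary H R)" using finite_region[OF assms] by simp
    show "(q, p) \<in> R - boundary H R" if "(p, q) \<in> R - boundary H R" for p q
      using that region_rev[OF assms] by (auto simp: boundary_iff insert_commute)
    show "p \<noteq> q" if "(p, q) \<in> R - boundary H R" for p q
      using that region_subset[OF assms] dart_points by blast
  qed
  moreover have "{{p, q} |p q. (p, q) \<in> R - boundary H R} = inner_segments G H R"
    unfolding inner_segments_def boundary_def by blast
  moreover have "card (R - boundary H R) + card (boundary H R) = card R"
    using card_Diff_subset[OF finite_subset[OF boundary_subset finite_region[OF assms]] boundary_subset]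
      card_mono[OF finite_region[OF assms] boundary_subset[of H R]] by simp
  ultimately show ?thesis by simp
qed

end


section \<open>Euler characteristic of a region\<close>

text \<open>\<open>d\<close> is the distance to \<open>Z\<close> and \<open>par\<close> the next
  element on a shortest path. The strict decrease excludes cycles; the lemma serves both for the
  forest on the points and for the tree on the faces.\<close>

lemma parent_function:
  fixes r :: "('b \<times> 'b) set"
  shows "\<exists>par d. \<forall>x. x \<notin> Z \<longrightarrow> (\<exists>z\<in>Z. (x, z) \<in> r\<^sup>*) \<longrightarrow> (x, par x) \<in> r \<and> d (par x) < (d x :: nat)"
proof -
  define d where "d x = (LEAST n. \<exists>z\<in>Z. (x, z) \<in> r ^^ n)" for x
  have "\<exists>y. (x, y) \<in> r \<and> d y < d x" if x: "x \<notin> Z" and reach: "\<exists>z\<in>Z. (x, z) \<in> r\<^sup>*" for x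
  proof -
    have "\<exists>n. \<exists>z\<in>Z. (x, z) \<in> r ^^ n" using reach unfolding rtrancl_power by blast
    then have "\<exists>z\<in>Z. (x, z) \<in> r ^^ d x" unfolding d_def by (rule LeastI_ex)
    then obtain z where z: "z \<in> Z" "(x, z) \<in> r ^^ d x" by blast
    then obtain m where m: "d x = Suc m" using x by (cases "d x") auto
    then obtain y where y: "(x, y) \<in> r" "(y, z) \<in> r ^^ m" using relpow_Suc_D2 z(2) by metis
    have "d y \<le> m" unfolding d_def by (rule Least_le) (use y z in blast)
    then show ?thesis using y m by auto
  qed
  then have "\<forall>x. \<exists>y. x \<notin> Z \<longrightarrow> (\<exists>z\<in>Z. (x, z) \<in> r\<^sup>*) \<longrightarrow> (x, y) \<in> r \<and> d y < d x" by blast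
  then show ?thesis by metis
qed

lemma card_disjoint_subsets_le:
  assumes "finite S" "A \<subseteq> S" "B \<subseteq> S - A"
  shows "card A + card B \<le> card S"
proof -
  have "finite A" "finite B" using finite_subset[OF _ assms(1)] assms(2,3) by blast+
  moreover have "A \<inter> B = {}" "A \<union> B \<subseteq> S" using assms by auto
  ultimately show ?thesis using card_Un_disjoint[of A B] card_mono[OF assms(1), of "A \<union> B"] by simp
qed

context drawn_subgraph
begin

text \<open>
  Tree-cotree argument: the segments from the inner points towards \<open>H\<close> form a forest, and the
  faces of the region are still connected through the remaining inner segments.
\<close>

lemma euler_region_le_1:
  assumes R: "R \<in> regions G H" and ne: "verts H \<noteq> {}"
  shows "euler_region H R \<le> 1"
proof -
  let ?Z = "Vertex ` verts H" and ?I = "inner_points G H R" and ?S = "inner_segments G H R"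
  have reach: "\<exists>z\<in>?Z. (p, z) \<in> (darts G)\<^sup>*" if p: "p \<in> points G" for p
  proof -
    obtain v where v: "v \<in> verts H" using ne by blast
    then have "Vertex v \<in> points G" using hverts_subset unfolding points_def by blast
    then have "(p, Vertex v) \<in> (darts G)\<^sup>*"
      by (rule points_connected[OF p]) (auto intro: rtrancl_into_rtrancl)
    then show ?thesis using v by blast
  qed
  obtain par and d :: "'a point \<Rightarrow> nat" where
    par0: "\<forall>x. x \<notin> ?Z \<longrightarrow> (\<exists>z\<in>?Z. (x, z) \<in> (darts G)\<^sup>*) \<longrightarrow> (x, par x) \<in> darts G \<and> d (par x) < d x"
    using parent_function[of ?Z "darts G"] by blast
  \<comment> \<open>All segments at an inner point are inner segments of \<open>R\<close>, even when
    the parent already lies on \<open>H\<close>.\<close>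
  have par: "(p, par p) \<in> R" "{p, par p} \<in> ?S" "d (par p) < d p" if p: "p \<in> ?I" for p
  proof -
    obtain q where q: "(p, q) \<in> R" "p \<in> points G" "p \<notin> ?Z" using p unfolding inner_points_def by blast
    have "(p, par p) \<in> darts G" "d (par p) < d p" using par0 reach q by blast+
    then show "(p, par p) \<in> R" "d (par p) < d p"
      using region_at_point[OF R q(1) _ no_hseg[OF q(3)]] by blast+
    then show "{p, par p} \<in> ?S" using inner_segment_iff[OF R] no_hseg[OF q(3)] by blast
  qed
  let ?F = "(\<lambda>p. {p, par p}) ` ?I"
  have injF: "inj_on (\<lambda>p. {p, par p}) ?I"
  proof (rule inj_onI)
    fix p q assume pq: "p \<in> ?I" "q \<in> ?I" "{p, par p} = {q, par q}"
    then show "p = q" using par(3)[of p] par(3)[of q] by (auto simp: doubleton_eq_iff)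
  qed
  let ?fc = "orbit (next_dart G)"
  \<comment> \<open>The dual graph: two faces of \<open>R\<close> are related when they share an
    inner segment outside the forest \<open>?F\<close>.\<close>
  define r where "r = {(?fc (p, q), ?fc (q, p)) |p q. (p, q) \<in> R \<and> {p, q} \<notin> hsegs H \<and> {p, q} \<notin> ?F}"
  obtain c where c: "c \<in> R" using region_nonempty[OF R] by blast
  \<comment> \<open>The part of \<open>R\<close> whose faces reach the face of \<open>c\<close> in
    the dual graph. The aim is \<open>R \<subseteq> \<Phi>\<close>, that is, cutting along the
    forest does not disconnect the region.\<close>
  define \<Phi> where "\<Phi> = {e \<in> R. (?fc e, ?fc c) \<in> r\<^sup>*}"
  have \<Phi>_next: "e \<in> \<Phi> \<longleftrightarrow> next_dart G e \<in> \<Phi>" if e: "e \<in> R" for e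
  proof -
    have "?fc (next_dart G e) = ?fc e"
      using self_in_orbit_step[OF self_in_face[OF region_mem(1)[OF R e]]] .
    then show ?thesis using region_next[OF R e] e unfolding \<Phi>_def by simp
  qed
  have \<Phi>_rev1: "(q, p) \<in> \<Phi>" if pq: "(p, q) \<in> \<Phi>" "{p, q} \<notin> hsegs H" "{p, q} \<notin> ?F" for p q
  proof -
    have inR: "(p, q) \<in> R" "(q, p) \<in> R" using pq region_rev[OF R] unfolding \<Phi>_def by blast+
    have "{q, p} \<notin> hsegs H" "{q, p} \<notin> ?F" using pq(2,3) unfolding insert_commute[of q p "{}"] by blast+
    then have "(?fc (q, p), ?fc (p, q)) \<in> r" unfolding r_def using inR by blast
    then show ?thesis using pq(1) inR unfolding \<Phi>_def by (simp add: converse_rtrancl_into_rtrancl)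
  qed
  have \<Phi>_rev: "(p, q) \<in> \<Phi> \<longleftrightarrow> (q, p) \<in> \<Phi>" if pq: "{p, q} \<notin> hsegs H" "{p, q} \<notin> ?F" for p q
  proof -
    have qp: "{q, p} \<notin> hsegs H" "{q, p} \<notin> ?F" using pq unfolding insert_commute[of q p "{}"] by blast+
    show ?thesis using \<Phi>_rev1[OF _ pq] \<Phi>_rev1[OF _ qp] by blast
  qed
  \<comment> \<open>Suppose forest segments separate \<open>\<Phi>\<close> from its complement, and
    take such a segment with its lower end \<open>b\<close> as far from \<open>H\<close> as
    possible. No segment from a child of \<open>b\<close> separates, so a full turn around
    \<open>b\<close> that avoids only the parent segment never changes membership. This turn leads
    from one side of the parent segment to its other side.\<close>
  have \<Phi>_tree: "(p, par p) \<in> \<Phi> \<longleftrightarrow> (par p, p) \<in> \<Phi>" if "p \<in> ?I" for p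
  proof (rule ccontr)
    define B where "B = {p \<in> ?I. ((p, par p) \<in> \<Phi>) \<noteq> ((par p, p) \<in> \<Phi>)}"
    assume "\<not> ((p, par p) \<in> \<Phi> \<longleftrightarrow> (par p, p) \<in> \<Phi>)"
    then have "B \<noteq> {}" using that unfolding B_def by blast
    moreover have finB: "finite B" using finite_points unfolding B_def inner_points_def by simp
    ultimately have "Max (d ` B) \<in> d ` B" by (intro Max_in) auto
    then obtain b where b: "b \<in> B" "d b = Max (d ` B)" by auto
    have bmax: "d b' \<le> d b" if "b' \<in> B" for b'
      unfolding b(2) using finB that by (intro Max_ge) auto
    have bI: "b \<in> ?I" "b \<notin> ?Z" using b(1) unfolding B_def inner_points_def by blast+
    let ?s = "par b"
    have bs: "(b, ?s) \<in> R" by (rule par(1)[OF bI(1)])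
    have sb: "(?s, b) \<in> R" using region_rev[OF R bs] no_hseg[OF bI(2)] by blast
    have inR: "(b, s) \<in> R" if "(b, s) \<in> darts G" for s
      by (rule region_at_point[OF R bs that]) (rule no_hseg[OF bI(2)])
    have turn: "(b, s) \<in> \<Phi> \<longleftrightarrow> (b, rot G b s) \<in> \<Phi>" if s: "(b, s) \<in> darts G" "s \<noteq> ?s" for s
    proof -
      have sR: "(s, b) \<in> R" using region_rev[OF R inR[OF s(1)]] no_hseg[OF bI(2)] by blast
      have "(b, s) \<in> \<Phi> \<longleftrightarrow> (s, b) \<in> \<Phi>"
      proof (cases "{b, s} \<in> ?F")
        case False
        then show ?thesis using \<Phi>_rev[OF no_hseg[OF bI(2)]] by blast
      next
        case True
        then obtain b' where b': "b' \<in> ?I" "{b, s} = {b', par b'}" by blast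
        then have "b' = s" "par b' = b" using s(2) by (auto simp: doubleton_eq_iff)
        then show ?thesis using bmax[of b'] par(3)[OF b'(1)] b'(1) unfolding B_def by auto
      qed
      also have "\<dots> \<longleftrightarrow> (b, rot G b s) \<in> \<Phi>" using \<Phi>_next[OF sR] by simp
      finally show ?thesis .
    qed
    have bsd: "(b, ?s) \<in> darts G" using bs region_subset[OF R] by blast
    have "(b, t) \<in> \<Phi> \<longleftrightarrow> (b, rot G b ?s) \<in> \<Phi>" if "(b, t) \<in> darts G" for t
      using rot_dart[OF bsd] that
    proof (induction t rule: rot_induct)
      case (step s)
      then show ?case using turn[OF step(1)] by (cases "s = ?s") auto
    qed simp
    then have "(b, ?s) \<in> \<Phi> \<longleftrightarrow> (b, rot G b ?s) \<in> \<Phi>" using bsd .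
    moreover have "(?s, b) \<in> \<Phi> \<longleftrightarrow> (b, rot G b ?s) \<in> \<Phi>" using \<Phi>_next[OF sb] by simp
    ultimately show False using b(1) unfolding B_def by blast
  qed
  have "R \<subseteq> \<Phi>"
  proof (rule region_minimal[OF R c])
    show "c \<in> \<Phi>" using c unfolding \<Phi>_def by simp
    show "next_dart G e \<in> \<Phi>" if "e \<in> R" "e \<in> \<Phi>" for e using that \<Phi>_next by blast
    show "(q, p) \<in> \<Phi>" if pq: "(p, q) \<in> R" "(p, q) \<in> \<Phi>" "{p, q} \<notin> hsegs H" for p q
    proof (cases "{p, q} \<in> ?F")
      case True
      then obtain b where b: "b \<in> ?I" "{p, q} = {b, par b}" by blast
      then show ?thesis using \<Phi>_tree[OF b(1)] pq(2) by (auto simp: doubleton_eq_iff)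
    qed (use \<Phi>_rev pq in blast)
  qed
  then have freach: "(f, ?fc c) \<in> r\<^sup>*" if "f \<in> inner_faces G R" for f
  proof -
    obtain e where e: "e \<in> f" "f \<in> faces G" "f \<subseteq> R"
      using \<open>f \<in> inner_faces G R\<close> face_nonempty unfolding inner_faces_def by blast
    then have "e \<in> \<Phi>" "f = ?fc e" using \<open>R \<subseteq> \<Phi>\<close> face_mem by blast+
    then show ?thesis unfolding \<Phi>_def by blast
  qed
  obtain fpar and fd :: "('a point \<times> 'a point) set \<Rightarrow> nat" where
    fpar: "\<forall>f. f \<notin> {?fc c} \<longrightarrow> (\<exists>z\<in>{?fc c}. (f, z) \<in> r\<^sup>*) \<longrightarrow> (f, fpar f) \<in> r \<and> fd (fpar f) < fd f"
    using parent_function[of "{?fc c}" r] by blast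
  let ?J = "inner_faces G R - {?fc c}"
  \<comment> \<open>A label of \<open>f\<close> is a dart of \<open>f\<close> across which the
    parent face lies. The \<open>card ?J\<close> labelled segments avoid the forest, whose size is
    the number of inner points; together they fit into the inner segments.\<close>
  define label where "label f pq \<longleftrightarrow> pq \<in> R \<and> {fst pq, snd pq} \<in> ?S - ?F \<and> f = ?fc pq \<and>
      fpar f = ?fc (snd pq, fst pq) \<and> fd (fpar f) < fd f" for f pq
  have "\<exists>pq. f \<in> ?J \<longrightarrow> label f pq" for f
  proof (cases "f \<in> ?J")
    case True
    then have *: "(f, fpar f) \<in> r" "fd (fpar f) < fd f" using fpar freach by blast+
    then obtain p q where pq: "f = ?fc (p, q)" "fpar f = ?fc (q, p)" "(p, q) \<in> R"
      "{p, q} \<notin> hsegs H" "{p, q} \<notin> ?F" unfolding r_def by blast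
    then show ?thesis using * inner_segment_iff[OF R] unfolding label_def
      by (intro exI[of _ "(p, q)"]) auto
  qed blast
  then obtain g where g: "\<And>f. f \<in> ?J \<Longrightarrow> label f (g f)" by metis
  let ?e = "\<lambda>f. {fst (g f), snd (g f)}"
  have inje: "inj_on ?e ?J"
  proof (rule inj_onI)
    fix f f' assume ff: "f \<in> ?J" "f' \<in> ?J" "?e f = ?e f'"
    obtain p q where pq: "g f = (p, q)" by fastforce
    obtain p' q' where pq': "g f' = (p', q')" by fastforce
    have "p = p' \<and> q = q' \<or> p = q' \<and> q = p'" using ff(3) pq pq' by (auto simp: doubleton_eq_iff)
    then show "f = f'"
    proof
      assume "p = p' \<and> q = q'"
      then show ?thesis using g[OF ff(1)] g[OF ff(2)] pq pq' unfolding label_def by simp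
    next
      \<comment> \<open>Each of the two faces would be the parent of the other, so \<open>fd\<close>
        would decrease in both directions.\<close>
      assume sw: "p = q' \<and> q = p'"
      have f1: "f = ?fc (p, q)" "fpar f = ?fc (q, p)" "fd (fpar f) < fd f" using g[OF ff(1)] unfolding pq label_def by auto
      have f2: "f' = ?fc (q, p)" "fpar f' = ?fc (p, q)" "fd (fpar f') < fd f'"
        using g[OF ff(2)] sw unfolding pq' label_def by auto
      show ?thesis using f1 f2 by simp
    qed
  qed
  have finS: "finite ?S" by (rule finite_inner_segments[OF R])
  have "?F \<subseteq> ?S" using par(2) by blast
  moreover have "?e ` ?J \<subseteq> ?S - ?F" using g unfolding label_def by blast
  ultimately have "card ?F + card (?e ` ?J) \<le> card ?S"
    by (rule card_disjoint_subsets_le[OF finS])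
  moreover have "card ?F = card ?I" by (rule card_image[OF injF])
  moreover have "card (?e ` ?J) = card ?J" by (rule card_image[OF inje])
  moreover have "card ?J + 1 = card (inner_faces G R)"
  proof -
    have "?fc c \<in> inner_faces G R"
      using c region_mem(1)[OF R c] orbit_subset_darts[OF c region_next[OF R]]
      unfolding inner_faces_def faces_def by blast
    moreover have "finite (inner_faces G R)" using finite_faces unfolding inner_faces_def by simp
    ultimately show ?thesis using card_Suc_Diff1 by fastforce
  qed
  ultimately show ?thesis unfolding euler_region_def by linarith
qed

end


section \<open>Boundaries of regions\<close>

definition first_return :: "('b \<Rightarrow> 'b) \<Rightarrow> 'b set \<Rightarrow> 'b \<Rightarrow> nat" where
  "first_return f A p = (LEAST k. 0 < k \<and> (f ^^ k) p \<in> A)"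

lemma first_return_in:
  assumes "p \<in> A" "p \<in> orbit f p"
  shows "0 < first_return f A p" "(f ^^ first_return f A p) p \<in> A"
proof -
  obtain k where "0 < k" "(f ^^ k) p = p" using assms(2) unfolding orbit_altdef by auto
  then have "\<exists>k. 0 < k \<and> (f ^^ k) p \<in> A" using assms(1) by metis
  then have "0 < first_return f A p \<and> (f ^^ first_return f A p) p \<in> A"
    unfolding first_return_def by (rule LeastI_ex)
  then show "0 < first_return f A p" "(f ^^ first_return f A p) p \<in> A" by blast+
qed

lemma first_return_least:
  "0 < k \<Longrightarrow> k < first_return f A p \<Longrightarrow> (f ^^ k) p \<notin> A"
  unfolding first_return_def using not_less_Least by blast

lemma inj_on_funpow_closed:
  assumes "inj_on f N" "f ` N \<subseteq> N"
  shows "inj_on (f ^^ k) N \<and> (f ^^ k) ` N \<subseteq> N"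
proof (induction k)
  case (Suc k)
  have "inj_on (f \<circ> f ^^ k) N"
    using Suc assms(1) by (intro comp_inj_on) (auto intro: inj_on_subset)
  then show ?case using Suc assms(2) by (auto simp: image_comp[symmetric] comp_def)
qed simp

text \<open>If \<open>p\<close> returns no later than \<open>q\<close>, cancelling the common
  iterations leaves \<open>p\<close> as an iterate of \<open>q\<close>. Were it a proper one,
  \<open>q\<close> would already have been back in \<open>A\<close> before its first return.\<close>

lemma first_return_inj:
  assumes inj: "inj_on f N" "f ` N \<subseteq> N" and A: "A \<subseteq> N" "p \<in> A" "q \<in> A" "p \<in> orbit f p" "q \<in> orbit f q"
    and eq: "(f ^^ first_return f A p) p = (f ^^ first_return f A q) q"
  shows "p = q"
proof -
  have main: "p = q" if le: "first_return f A p \<le> first_return f A q" and A: "p \<in> A" "q \<in> A" "p \<in> orbit f p"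
    and eq: "(f ^^ first_return f A p) p = (f ^^ first_return f A q) q" for p q
  proof -
    let ?k = "first_return f A p" and ?l = "first_return f A q"
    have "(f ^^ ?l) q = (f ^^ ?k) ((f ^^ (?l - ?k)) q)"
      using le by (metis comp_apply funpow_add le_add_diff_inverse)
    moreover have "(f ^^ (?l - ?k)) q \<in> N"
      using inj_on_funpow_closed[OF inj, of "?l - ?k"] A(2) \<open>A \<subseteq> N\<close> by blast
    ultimately have pq: "p = (f ^^ (?l - ?k)) q"
      using eq inj_onD[OF conjunct1[OF inj_on_funpow_closed[OF inj, of ?k]]] A(1) \<open>A \<subseteq> N\<close> by (metis subsetD)
    show "p = q"
    proof (cases "?l - ?k = 0")
      case True
      then show ?thesis using pq by simp
    next
      case False
      then have "(f ^^ (?l - ?k)) q \<notin> A"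
        using first_return_in(1)[OF A(1,3)] le by (intro first_return_least) auto
      then show ?thesis using pq A(1) by simp
    qed
  qed
  show ?thesis
    using main[of p q] main[of q p] A eq by (cases "first_return f A p \<le> first_return f A q") auto
qed

context drawn_subgraph
begin

text \<open>
  Turning around the end of a boundary dart until the next edge of \<open>H\<close> traverses the boundary
  of the region.
\<close>

lemma boundary_permutation:
  assumes R: "R \<in> regions G H"
  obtains \<pi> where "inj_on \<pi> (boundary H R)" "\<forall>d\<in>boundary H R. \<pi> d \<in> boundary H R \<and> fst (\<pi> d) = snd d"
proof
  let ?A = "\<lambda>q. {s. {q, s} \<in> hsegs H}"
  let ?ret = "\<lambda>p q. (rot G q ^^ first_return (rot G q) (?A q) p) p"
  let ?\<pi> = "\<lambda>(p, q). (q, ?ret p q)"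
  have AN: "?A q \<subseteq> nbrs G q" for q using hseg_dart nbrs_iff by blast
  have inA: "p \<in> ?A q" "q \<in> points G" if "(p, q) \<in> boundary H R" for p q
    using that hseg_dart dart_points unfolding boundary_iff by (auto simp: insert_commute)
  have cyc: "s \<in> orbit (rot G q) s" if "s \<in> ?A q" "q \<in> points G" for q s
    using orbit_cyclic_eq3[OF rot_cyclic[OF that(2)], of s] AN that(1) by blast
  have in_boundary: "(q, ?ret p q) \<in> boundary H R" if pq: "(p, q) \<in> boundary H R" for p q
  proof -
    let ?k = "first_return (rot G q) (?A q) p"
    have k: "0 < ?k" "?ret p q \<in> ?A q"
      using first_return_in[OF inA(1)[OF pq] cyc[OF inA[OF pq]]] by blast+
    \<comment> \<open>The first turn is the facial walk from \<open>(p, q)\<close> itself, because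
      \<open>(q, p)\<close> may belong to another region. Every later turn passes a segment outside
      \<open>H\<close> and may therefore reverse it.\<close>
    have "0 < j \<Longrightarrow> j \<le> ?k \<Longrightarrow> (q, (rot G q ^^ j) p) \<in> R" for j
    proof (induction j)
      case (Suc j)
      show ?case
      proof (cases "j = 0")
        case True
        have "(p, q) \<in> R" using pq unfolding boundary_iff by blast
        then show ?thesis using region_next[OF R] True by fastforce
      next
        case False
        then have "(q, (rot G q ^^ j) p) \<in> R" using Suc by simp
        moreover have "(rot G q ^^ j) p \<notin> ?A q"
          using False Suc.prems by (intro first_return_least) auto
        ultimately have "((rot G q ^^ j) p, q) \<in> R" using region_rev[OF R] by blast
        then show ?thesis using region_next[OF R] by fastforce
      qed
    qed simp
    then show ?thesis using k unfolding boundary_iff by blast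
  qed
  then show "\<forall>d\<in>boundary H R. ?\<pi> d \<in> boundary H R \<and> fst (?\<pi> d) = snd d" by auto
  show "inj_on ?\<pi> (boundary H R)"
  proof (rule inj_onI)
    fix d d' assume d: "d \<in> boundary H R" "d' \<in> boundary H R" "?\<pi> d = ?\<pi> d'"
    obtain p q p' q' where pq: "d = (p, q)" "d' = (p', q')" by fastforce
    have q: "q' = q" "?ret p q = ?ret p' q" using d(3) pq by auto
    have p: "p \<in> ?A q" "p' \<in> ?A q" "q \<in> points G" using inA d pq q(1) by blast+
    have "rot G q ` nbrs G q \<subseteq> nbrs G q" using rot_dart nbrs_iff by blast
    then have "p = p'"
      using first_return_inj[OF rot_inj[OF p(3)] _ AN p(1,2) cyc[OF p(1,3)] cyc[OF p(2,3)] q(2)] by blast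
    then show "d = d'" using pq q by simp
  qed
qed

lemma boundary_ne: "(p, q) \<in> boundary H R \<Longrightarrow> p \<noteq> q"
  unfolding boundary_iff using hseg_dart dart_points by blast

text \<open>Three consecutive boundary darts, starting at one whose reverse is outside
  \<open>R\<close>. This choice makes \<open>w\<close> differ from \<open>u\<close>: the boundary
  walk cannot turn back along its first edge.\<close>

lemma boundary_triple:
  assumes R: "R \<in> regions G H" "R \<noteq> darts G"
  obtains u v w z \<pi> where "inj_on \<pi> (boundary H R)"
    "\<forall>d\<in>boundary H R. \<pi> d \<in> boundary H R \<and> fst (\<pi> d) = snd d"
    "(u, v) \<in> boundary H R" "(v, u) \<notin> R" "\<pi> (u, v) = (v, w)" "\<pi> (v, w) = (w, z)"
    "u \<noteq> v" "v \<noteq> w" "w \<noteq> u" "w \<noteq> z"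
proof -
  obtain \<pi> where \<pi>0: "inj_on \<pi> (boundary H R)"
    "\<forall>d\<in>boundary H R. \<pi> d \<in> boundary H R \<and> fst (\<pi> d) = snd d"
    by (rule boundary_permutation[OF R(1)])
  have \<pi>: "\<pi> d \<in> boundary H R" "fst (\<pi> d) = snd d" if "d \<in> boundary H R" for d
    using \<pi>0(2) that by blast+
  obtain u v where uv: "(u, v) \<in> boundary H R" "(v, u) \<notin> R" using region_all_darts[OF R(1)] R(2) by blast
  obtain w where w: "\<pi> (u, v) = (v, w)" using \<pi>(2)[OF uv(1)] by (cases "\<pi> (u, v)") auto
  then have vw: "(v, w) \<in> boundary H R" using \<pi>(1)[OF uv(1)] by simp
  obtain z where z: "\<pi> (v, w) = (w, z)" using \<pi>(2)[OF vw] by (cases "\<pi> (v, w)") auto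
  then have wz: "(w, z) \<in> boundary H R" using \<pi>(1)[OF vw] by simp
  have "w \<noteq> u" using vw uv(2) unfolding boundary_iff by blast
  then show thesis using that[OF \<pi>0 uv w z] boundary_ne uv vw wz by blast
qed

end


locale optimal_subgraph = optimal_toroidal + drawn_subgraph
begin

text \<open>\<open>R\<close> is a union of triangles with exactly one dart out of a crossing each,
  and it contains all four such darts of a crossing or none. So the number of triangles is a
  multiple of four, \<open>card R\<close> is even, and the darts off \<open>H\<close> pair
  up.\<close>

lemma even_card_boundary:
  assumes R: "R \<in> regions G H"
  shows "even (card (boundary H R))"
proof -
  have RD: "R \<subseteq> darts G" by (rule region_subset[OF R])
  have per_face: "card (R \<inter> f) = 3 * card (vv_darts \<inter> R \<inter> f)" if f: "f \<in> faces G" for f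
  proof (cases "R \<inter> f = {}")
    case True
    then show ?thesis by (simp add: Int_assoc)
  next
    case False
    then obtain d where d: "d \<in> R" "d \<in> f" by blast
    have "f \<subseteq> R"
      using face_mem[OF f d(2)] orbit_subset_darts[OF d(1) region_next[OF R]] by blast
    then have "R \<inter> f = f" "vv_darts \<inter> R \<inter> f = vv_darts \<inter> f" by auto
    then show ?thesis using face_counts(2,3)[OF f] by simp
  qed
  have "card R = (\<Sum>f\<in>faces G. card (R \<inter> f))" by (rule card_by_faces[OF RD])
  also have "\<dots> = 3 * (\<Sum>f\<in>faces G. card (vv_darts \<inter> R \<inter> f))"
    using per_face by (simp add: sum_distrib_left)
  also have "(\<Sum>f\<in>faces G. card (vv_darts \<inter> R \<inter> f)) = card (vv_darts \<inter> R)"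
    by (rule card_by_faces[symmetric]) (use RD in blast)
  finally have "card R = 3 * card (vv_darts \<inter> R)" .
  moreover have "card R = card (vv_darts \<inter> R) + 2 * card (xv_darts \<inter> R)"
    by (rule card_dart_split[OF RD region_next[OF R]])
  ultimately have R3: "card R = 3 * card (xv_darts \<inter> R)" by simp
  have "even (card (xv_darts \<inter> R))"
  proof -
    let ?X = "{x \<in> crossings G. \<exists>q. (Crossing x, q) \<in> R}"
    let ?h = "\<lambda>(x, u). (Crossing x, Vertex u) :: 'a point \<times> 'a point"
    have "?h y \<in> xv_darts \<inter> R" if y: "y \<in> (SIGMA x:?X. \<Union>x)" for y
    proof -
      obtain x u q where xu: "y = (x, u)" "x \<in> crossings G" "u \<in> \<Union>x" "(Crossing x, q) \<in> R"
        using y by auto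
      have d: "(Crossing x, Vertex u) \<in> darts G" using xu dart_xv by blast
      have "(Crossing x, Vertex u) \<in> R"
        by (rule region_at_point[OF R xu(4) d]) (rule no_hseg, auto)
      then show ?thesis using d xu(1) unfolding xv_darts_def by simp
    qed
    moreover have "d \<in> ?h ` (SIGMA x:?X. \<Union>x)" if d: "d \<in> xv_darts \<inter> R" for d
    proof -
      obtain x u where xu: "d = (Crossing x, Vertex u)" "(Crossing x, Vertex u) \<in> R" "(Crossing x, Vertex u) \<in> darts G"
        using d unfolding xv_darts_def by auto
      then have "(x, u) \<in> (SIGMA x:?X. \<Union>x)" using dart_xv by auto
      then show ?thesis using xu(1) by force
    qed
    ultimately have "xv_darts \<inter> R = ?h ` (SIGMA x:?X. \<Union>x)" by blast
    moreover have "inj_on ?h A" for A by (auto simp: inj_on_def)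
    ultimately have "card (xv_darts \<inter> R) = card (SIGMA x:?X. \<Union>x)" by (simp add: card_image)
    also have "\<dots> = (\<Sum>x\<in>?X. card (\<Union>x))"
    proof (rule card_SigmaI)
      show "finite ?X" using finite_crossings by simp
      show "\<forall>x\<in>?X. finite (\<Union>x)"
        using crossing_ends_card by (metis (no_types, lifting) card.infinite mem_Collect_eq zero_neq_numeral)
    qed
    also have "\<dots> = 4 * card ?X" using crossing_ends_card by simp
    finally show ?thesis by simp
  qed
  then show ?thesis using R3 card_region[OF R] by presburger
qed

text \<open>The three darts of \<open>boundary_triple\<close> are distinct; parity supplies the
  fourth.\<close>

lemma card_boundary_ge:
  assumes R: "R \<in> regions G H" "R \<noteq> darts G"
  shows "4 \<le> card (boundary H R)"
proof -
  obtain u v w z \<pi> where *: "\<forall>d\<in>boundary H R. \<pi> d \<in> boundary H R \<and> fst (\<pi> d) = snd d"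
    "(u, v) \<in> boundary H R" "\<pi> (u, v) = (v, w)" "\<pi> (v, w) = (w, z)"
    "u \<noteq> v" "v \<noteq> w" "w \<noteq> u" "w \<noteq> z" by (rule boundary_triple[OF R])
  have "(v, w) \<in> boundary H R" using bspec[OF *(1,2)] *(3) by simp
  moreover from this have "(w, z) \<in> boundary H R" using bspec[OF *(1), of "(v, w)"] *(4) by simp
  ultimately have "{(u, v), (v, w), (w, z)} \<subseteq> boundary H R" using *(2) by simp
  moreover have "finite (boundary H R)" by (rule finite_subset[OF boundary_subset finite_region[OF R(1)]])
  ultimately have "card {(u, v), (v, w), (w, z)} \<le> card (boundary H R)" by (intro card_mono)
  moreover have "card {(u, v), (v, w), (w, z)} = 3" using *(5-8) by auto
  ultimately show ?thesis using even_card_boundary[OF R(1)] by presburger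
qed

text \<open>The successor map \<pi> permutes four darts and has no fixed point, since no dart is a
  loop. Once orbits of length three and shorter are excluded, it is one closed walk of length
  four.\<close>

lemma bounded_by_four_cycle:
  assumes R: "R \<in> regions G H" "R \<noteq> darts G" and four: "card (boundary H R) = 4"
  shows "\<exists>c. length c = 4 \<and> bounded_by_cycle G H R c"
proof -
  let ?B = "boundary H R"
  obtain u v w z \<pi> where \<pi>0: "inj_on \<pi> ?B" "\<forall>d\<in>?B. \<pi> d \<in> ?B \<and> fst (\<pi> d) = snd d"
    and uv: "(u, v) \<in> ?B" "(v, u) \<notin> R" "\<pi> (u, v) = (v, w)" "\<pi> (v, w) = (w, z)"
    and ne: "u \<noteq> v" "v \<noteq> w" "w \<noteq> u" "w \<noteq> z" by (rule boundary_triple[OF R])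
  have \<pi>: "inj_on \<pi> ?B" "\<And>d. d \<in> ?B \<Longrightarrow> \<pi> d \<in> ?B" "\<And>d. d \<in> ?B \<Longrightarrow> fst (\<pi> d) = snd d"
    using \<pi>0 by blast+
  have vw: "(v, w) \<in> ?B" using \<pi>(2)[OF uv(1)] uv(3) by simp
  have wz: "(w, z) \<in> ?B" using \<pi>(2)[OF vw] uv(4) by simp
  obtain y where y: "\<pi> (w, z) = (z, y)" using \<pi>(3)[OF wz] by (cases "\<pi> (w, z)") auto
  have zy: "(z, y) \<in> ?B" using \<pi>(2)[OF wz] y by simp
  have finB: "finite ?B" by (rule finite_subset[OF boundary_subset finite_region[OF R(1)]])
  have inj: "d = e" if "\<pi> d = \<pi> e" "d \<in> ?B" "e \<in> ?B" for d e using inj_onD[OF \<pi>(1)] that by blast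
  have nofix: "\<pi> d \<noteq> d" if d: "d \<in> ?B" for d
  proof
    assume "\<pi> d = d"
    then have "fst d = snd d" using \<pi>(3)[OF d] by simp
    then show False using boundary_ne[of "fst d" "snd d"] d by simp
  qed
  \<comment> \<open>If three darts closed up, the fourth boundary dart would have to be fixed by
    \<pi>.\<close>
  have d30: "(z, y) \<noteq> (u, v)"
  proof
    assume zyuv: "(z, y) = (u, v)"
    have "\<not> ?B \<subseteq> {(u, v), (v, w), (w, z)}"
    proof
      assume "?B \<subseteq> {(u, v), (v, w), (w, z)}"
      then have "card ?B \<le> card {(u, v), (v, w), (w, z)}" by (intro card_mono) auto
      also have "\<dots> \<le> 3" by (simp add: card_insert_if)
      finally show False using four by simp
    qed
    then obtain e where e: "e \<in> ?B" "e \<noteq> (u, v)" "e \<noteq> (v, w)" "e \<noteq> (w, z)" by blast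
    have "\<pi> e \<noteq> \<pi> (u, v)" "\<pi> e \<noteq> \<pi> (v, w)" "\<pi> e \<noteq> \<pi> (w, z)" "\<pi> e \<noteq> e"
      using inj[OF _ e(1)] e uv(1) vw wz nofix by blast+
    then have ne4: "\<pi> e \<notin> {(v, w), (w, z), (u, v), e}" using uv y zyuv by simp
    have "card {(v, w), (w, z), (u, v), e} = 4" using e ne by auto
    then have "{(v, w), (w, z), (u, v), e} = ?B"
      using e(1) uv(1) vw wz four finB by (intro card_subset_eq) auto
    then show False using \<pi>(2)[OF e(1)] ne4 by simp
  qed
  have d31: "(z, y) \<noteq> (v, w)" using inj[of "(w, z)" "(u, v)"] uv y wz ne by auto
  have d32: "(z, y) \<noteq> (w, z)" using ne by auto
  have "card {(u, v), (v, w), (w, z), (z, y)} = 4" using ne d30 d31 d32 by auto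
  then have B: "?B = {(u, v), (v, w), (w, z), (z, y)}"
    using uv(1) vw wz zy four finB by (intro card_subset_eq[symmetric]) auto
  have "\<pi> (z, y) \<in> ?B" by (rule \<pi>(2)[OF zy])
  moreover have "\<pi> (z, y) \<noteq> (v, w)" using inj[OF _ zy uv(1)] d30 uv(3) by metis
  moreover have "\<pi> (z, y) \<noteq> (w, z)" using inj[OF _ zy vw] d31 uv(4) by metis
  moreover have "\<pi> (z, y) \<noteq> (z, y)" by (rule nofix[OF zy])
  ultimately have "\<pi> (z, y) = (u, v)" unfolding B by blast
  then have yu: "y = u" using \<pi>(3)[OF zy] by simp
  \<comment> \<open>If \<open>z = v\<close>, the last dart would be \<open>(v, u)\<close>, which
    lies outside \<open>R\<close> by the choice of the first dart.\<close>
  have zv: "z \<noteq> v" using zy uv(2) unfolding yu boundary_iff by blast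
  have zu: "z \<noteq> u" using boundary_ne[OF zy] yu by simp
  have hseg: "{u, v} \<in> hsegs H" "{v, w} \<in> hsegs H" "{w, z} \<in> hsegs H" "{z, u} \<in> hsegs H"
    using uv(1) vw wz zy yu unfolding boundary_iff by blast+
  obtain u' v' where uv': "u = Vertex u'" "v = Vertex v'" "{u', v'} \<in> edges H" "u' \<in> verts H" "v' \<in> verts H"
    by (rule hseg_vertex[OF hseg(1)])
  obtain w' z' where wz': "w = Vertex w'" "z = Vertex z'" "{w', z'} \<in> edges H" "w' \<in> verts H" "z' \<in> verts H"
    by (rule hseg_vertex[OF hseg(3)])
  have e: "{v', w'} \<in> edges H" "{z', u'} \<in> edges H" using hseg(2,4) hseg_iff uv' wz' by auto
  let ?c = "[u', v', w', z']"
  have ix: "{f i |i. i < length ?c} = {f 0, f 1, f 2, f 3}" for f :: "nat \<Rightarrow> 'c"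
    by (auto simp: less_Suc_eq numeral_eq_Suc)
  have vals: "?c ! 0 = u'" "?c ! 1 = v'" "?c ! 2 = w'" "?c ! 3 = z'"
    "Suc 0 mod length ?c = 1" "Suc 1 mod length ?c = 2" "Suc 2 mod length ?c = 3" "Suc 3 mod length ?c = 0"
    by simp_all
  have "distinct ?c" using ne zv zu uv' wz' by auto
  moreover have "edges (cycle_graph ?c) = {{u', v'}, {v', w'}, {w', z'}, {z', u'}}"
    unfolding cycle_graph_def ugraph.select_convs ix vals ..
  moreover have "verts (cycle_graph ?c) = {u', v', w', z'}" unfolding cycle_graph_def by simp
  ultimately have "is_cycle H ?c"
    unfolding is_cycle_def subgraph_def using uv' wz' e by simp
  moreover have "?B = {(Vertex (?c ! i), Vertex (?c ! (Suc i mod length ?c))) |i. i < length ?c}"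
    unfolding ix vals B using yu uv' wz' by simp
  ultimately have "bounded_by_cycle G H R ?c" unfolding bounded_by_cycle_def boundary_def by blast
  then show ?thesis by (intro exI[of _ ?c]) simp
qed

end

section \<open>A face of \<open>H\<close> as a region of its bounding cycle alone\<close>

context drawn_graph
begin

definition cycle_darts :: "'a list \<Rightarrow> ('a point \<times> 'a point) set" where
  "cycle_darts c = {(Vertex (c ! i), Vertex (c ! (Suc i mod length c))) |i. i < length c}"

lemma bounded_by_cycle_iff: "bounded_by_cycle G H R c \<longleftrightarrow> is_cycle H c \<and> boundary H R = cycle_darts c"
  unfolding bounded_by_cycle_def boundary_def cycle_darts_def by blast

lemma cycle_darts_hsegs: "(p, q) \<in> cycle_darts c \<Longrightarrow> {p, q} \<in> hsegs (cycle_graph c)"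
proof -
  assume "(p, q) \<in> cycle_darts c"
  then obtain i where i: "i < length c" "p = Vertex (c ! i)" "q = Vertex (c ! (Suc i mod length c))"
    unfolding cycle_darts_def by auto
  then have "{c ! i, c ! (Suc i mod length c)} \<in> edges (cycle_graph c)"
    unfolding cycle_graph_def by auto
  then have "Vertex ` {c ! i, c ! (Suc i mod length c)} \<in> hsegs (cycle_graph c)" by (rule imageI)
  then show ?thesis using i by simp
qed

lemma cycle_darts_set: "(p, q) \<in> cycle_darts c \<Longrightarrow> p \<in> Vertex ` set c \<and> q \<in> Vertex ` set c"
  unfolding cycle_darts_def by (force intro!: imageI nth_mem mod_less_divisor)

lemma card_cycle_darts: "distinct c \<Longrightarrow> card (cycle_darts c) = length c"
proof -
  assume c: "distinct c"
  let ?f = "\<lambda>i. (Vertex (c ! i), Vertex (c ! (Suc i mod length c)))"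
  have "cycle_darts c = ?f ` {..<length c}" unfolding cycle_darts_def by auto
  moreover have "inj_on ?f {..<length c}" using c by (auto simp: inj_on_def nth_eq_iff_index_eq)
  ultimately show ?thesis by (simp add: card_image)
qed

end

context drawn_subgraph
begin

lemma cycle_hsegs_subset: "is_cycle H c \<Longrightarrow> hsegs (cycle_graph c) \<subseteq> hsegs H"
  unfolding is_cycle_def subgraph_def by blast

text \<open>\<open>quadrangulation\<close> speaks about regions of \<open>H\<close>,
  \<open>barrier_cycle\<close> about regions of the single cycle. Dropping the other edges of
  \<open>H\<close> does not enlarge \<open>R\<close>, because every edge of \<open>H\<close> along
  \<open>R\<close> belongs to \<open>c\<close>.\<close>

lemma region_of_bounding_cycle:
  assumes R: "R \<in> regions G H" and c: "bounded_by_cycle G H R c"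
  shows "R \<in> regions G (cycle_graph c)" "bounded_by_cycle G (cycle_graph c) R c"
proof -
  have cyc: "is_cycle H c" and bd: "boundary H R = cycle_darts c"
    using c unfolding bounded_by_cycle_iff by auto
  obtain d where d: "d \<in> R" using region_nonempty[OF R] by blast
  obtain R' where R': "R' \<in> regions G (cycle_graph c)" "d \<in> R'"
    using region_ex[OF region_mem(1)[OF R d]] by blast
  have "R \<subseteq> R'"
  proof (rule region_minimal[OF R d R'(2)])
    show "next_dart G e \<in> R'" if "e \<in> R'" for e by (rule region_next[OF R'(1) that])
    show "(q, p) \<in> R'" if "(p, q) \<in> R'" "{p, q} \<notin> hsegs H" for p q
      using region_rev[OF R'(1) that(1)] that(2) cycle_hsegs_subset[OF cyc] by blast
  qed
  moreover have "R' \<subseteq> R"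
  proof (rule region_minimal[OF R' d])
    show "next_dart G e \<in> R" if "e \<in> R" for e by (rule region_next[OF R that])
    show "(q, p) \<in> R" if pq: "(p, q) \<in> R" "{p, q} \<notin> hsegs (cycle_graph c)" for p q
    proof (rule region_rev[OF R pq(1)])
      show "{p, q} \<notin> hsegs H" using pq cycle_darts_hsegs[of p q c] bd boundary_iff[of p q H R] by blast
    qed
  qed
  ultimately show "R \<in> regions G (cycle_graph c)" using R'(1) by simp
  have "boundary (cycle_graph c) R = boundary H R"
  proof
    show "boundary (cycle_graph c) R \<subseteq> boundary H R"
      using cycle_hsegs_subset[OF cyc] unfolding boundary_def by blast
    show "boundary H R \<subseteq> boundary (cycle_graph c) R"
    proof
      fix e assume e: "e \<in> boundary H R"
      obtain p q where "e = (p, q)" by fastforce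
      then show "e \<in> boundary (cycle_graph c) R"
        using e boundary_iff[of p q "cycle_graph c" R] cycle_darts_hsegs[of p q c] bd
          subsetD[OF boundary_subset e] by simp
    qed
  qed
  moreover have "is_cycle (cycle_graph c) c" using cyc unfolding is_cycle_def subgraph_def by simp
  ultimately show "bounded_by_cycle G (cycle_graph c) R c" using bd unfolding bounded_by_cycle_iff by simp
qed

text \<open>A vertex of \<open>H\<close> off \<open>c\<close> at which \<open>R\<close> has a dart
  would become a new inner point. Turning around such a vertex inside \<open>R\<close> would meet
  one of its edges in \<open>H\<close>, hence a boundary dart off \<open>c\<close>. An isolated
  vertex of \<open>H\<close> has no such edge, which explains \<open>no_isolated\<close>.\<close>

lemma inner_of_bounding_cycle:
  assumes R: "R \<in> regions G H" and c: "bounded_by_cycle G H R c"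
    and no_isolated: "\<And>v. v \<in> verts H \<Longrightarrow> \<exists>w. {v, w} \<in> edges H"
  shows "inner_points G (cycle_graph c) R = inner_points G H R"
    and "inner_segments G (cycle_graph c) R = inner_segments G H R"
proof -
  have cyc: "is_cycle H c" and bd: "boundary H R = cycle_darts c"
    using c unfolding bounded_by_cycle_iff by auto
  have "p \<in> Vertex ` set c" if p: "p \<in> Vertex ` verts H" "(p, q) \<in> R" for p q
  proof (rule ccontr)
    assume np: "p \<notin> Vertex ` set c"
    obtain v w where v: "p = Vertex v" "{v, w} \<in> edges H" using no_isolated p(1) by blast
    have nb: "(p, s) \<notin> boundary H R" for s using np cycle_darts_set bd by blast
    have hs: "{p, Vertex w} \<in> hsegs H" using v hseg_iff by simp
    have "(p, q) \<in> darts G" using p(2) region_subset[OF R] by blast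
    then have "(p, Vertex w) \<in> R" using hseg_dart[OF hs]
    proof (induction rule: rot_induct)
      case base
      show ?case by (rule p(2))
    next
      case (step s)
      have "{p, s} \<notin> hsegs H" using nb[of s] step(2) unfolding boundary_iff by blast
      then show ?case using region_next[OF R region_rev[OF R step(2)]] by simp
    qed
    then show False using nb[of "Vertex w"] hs unfolding boundary_iff by blast
  qed
  moreover have "set c \<subseteq> verts H" using cyc unfolding is_cycle_def subgraph_def cycle_graph_def by simp
  ultimately show "inner_points G (cycle_graph c) R = inner_points G H R"
    unfolding inner_points_def cycle_graph_def by auto
  have "{p, q} \<in> hsegs (cycle_graph c) \<longleftrightarrow> {p, q} \<in> hsegs H" if "(p, q) \<in> R" for p q
    using cycle_darts_hsegs[of p q c] bd that cycle_hsegs_subset[OF cyc] boundary_iff[of p q H R] by blast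
  then show "inner_segments G (cycle_graph c) R = inner_segments G H R"
    unfolding inner_segments_def by (intro set_eqI) (auto simp del: image_iff)
qed

end


section \<open>Extendability\<close>

context drawn_graph
begin

lemma two_cell_iff: "two_cell G H R \<longleftrightarrow> euler_region H R = 1"
  unfolding two_cell_def euler_region_def ..

lemma darts_at_vertex: "v \<in> verts G \<Longrightarrow> \<exists>q. (Vertex v, q) \<in> darts G"
proof -
  assume "v \<in> verts G"
  then have "Vertex v \<in> points G" unfolding points_def by blast
  then show ?thesis using nbrs_nonempty nbrs_iff by blast
qed

lemma inner_vertices_iff:
  "v \<in> inner_vertices G H R \<longleftrightarrow> v \<in> verts G \<and> v \<notin> verts H \<and> (\<exists>q. (Vertex v, q) \<in> R)"
  unfolding inner_vertices_def inner_points_def points_def by auto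

end

context drawn_subgraph
begin

lemma inner_vertex_region:
  assumes R: "R \<in> regions G H" "R' \<in> regions G H" and v: "v \<in> inner_vertices G H R" "v \<in> inner_vertices G H R'"
  shows "R = R'"
proof -
  obtain q r where qr: "(Vertex v, q) \<in> R" "(Vertex v, r) \<in> R'" and vH: "v \<notin> verts H"
    using v unfolding inner_vertices_iff by blast
  have "Vertex v \<notin> Vertex ` verts H" using vH by auto
  then have "(Vertex v, r) \<in> R"
    using region_at_point[OF R(1) qr(1) _ no_hseg] region_subset[OF R(2)] qr(2) by blast
  then show ?thesis using region_eqI[OF R] qr(2) by blast
qed

text \<open>An edge of \<open>G\<close> that starts inside a region can leave it only through a
  vertex of \<open>H\<close>: edges of \<open>H\<close> are non-crossing, so a crossing edge stays
  in the region when it passes its crossing.\<close>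

lemma inner_vertices_closed:
  assumes R: "R \<in> regions G H" and v: "v \<in> inner_vertices G H R"
    and vw: "{v, w} \<in> edges G" "w \<notin> verts H"
  shows "w \<in> inner_vertices G H R"
proof -
  obtain q where q: "(Vertex v, q) \<in> R" and vH: "v \<notin> verts H"
    using v unfolding inner_vertices_iff by blast
  have wG: "w \<in> verts G" using edge_subset[OF vw(1)] by blast
  have nh: "{Vertex v, s} \<notin> hsegs H" for s using no_hseg[of "Vertex v"] vH by auto
  have at_v: "(Vertex v, s) \<in> R" if "(Vertex v, s) \<in> darts G" for s
    by (rule region_at_point[OF R q that nh])
  have "\<exists>s. (Vertex w, s) \<in> R"
  proof (cases "{v, w} \<in> \<Union>(crossings G)")
    case True
    then obtain x where x: "x \<in> crossings G" "{v, w} \<in> x" by blast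
    then have "(Vertex v, Crossing x) \<in> darts G" "(Crossing x, Vertex w) \<in> darts G"
      unfolding dart_vx dart_xv by blast+
    moreover have nx: "{Crossing x, s} \<notin> hsegs H" for s
      by (rule no_hseg) auto
    ultimately have "(Crossing x, Vertex w) \<in> R"
      using region_at_point[OF R region_rev[OF R at_v nh] _ nx] by blast
    then show ?thesis using region_rev[OF R _ nx] by blast
  next
    case False
    then have "(Vertex v, Vertex w) \<in> darts G" using vw unfolding dart_vv quad_subgraph_def by simp
    then show ?thesis using region_rev[OF R at_v nh] by blast
  qed
  then show ?thesis using wG vw(2) unfolding inner_vertices_iff by blast
qed

lemma inner_vertices_of_bounding_cycle:
  assumes "R \<in> regions G H" "bounded_by_cycle G H R c" "\<And>v. v \<in> verts H \<Longrightarrow> \<exists>w. {v, w} \<in> edges H"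
  shows "inner_vertices G (cycle_graph c) R = inner_vertices G H R"
  unfolding inner_vertices_def using inner_of_bounding_cycle(1)[OF assms] by simp

lemma card_bounding_cycle: "bounded_by_cycle G H R c \<Longrightarrow> card (boundary H R) = length c"
  unfolding bounded_by_cycle_iff is_cycle_def using card_cycle_darts by auto

end

section \<open>Barrier faces prevent extendability\<close>

lemma (in optimal_toroidal) barrier_quadrangulation_not_extendable:
  assumes sub: "subgraph H (quad_subgraph G)" and quad: "quadrangulation G H"
    and barrier: "\<And>c. facial_cycle G H c \<Longrightarrow> barrier_cycle G 4 c"
  shows "\<not> m_extendable 1 G"
proof
  assume ext: "m_extendable 1 G"
  have conH: "connected_graph H" using quad unfolding quadrangulation_def by blast
  interpret optimal_subgraph G H
  proof unfold_locales
    show "subgraph H (quad_subgraph G)" by (rule sub)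
    show "e \<subseteq> verts H" if "e \<in> edges H" for e using conH that unfolding connected_graph_def by blast
  qed
  have reg: "\<exists>c. length c = 4 \<and> bounded_by_cycle G H R c" "euler_region H R = 1"
    if "R \<in> regions G H" for R
    using quad that unfolding quadrangulation_def two_cell_iff by blast+
  have b4: "card (boundary H R) = 4" if "R \<in> regions G H" for R
    using reg(1)[OF that] card_bounding_cycle by auto
  \<comment> \<open>With \<open>V\<close>, \<open>E\<close>, \<open>F\<close> for the numbers of
    vertices, edges and faces of \<open>H\<close>: \<open>4F = 2E\<close> and
    \<open>F = E - V\<close> give \<open>F = V\<close>.\<close>
  have "card (regions G H) * 4 = 2 * card (edges H)"
    using sum_boundary b4 by simp
  moreover have "int (card (regions G H)) = - int (card (verts H)) + int (card (edges H))"
    using sum_euler_region face_counts(1) reg(2) by simp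
  ultimately have count: "card (regions G H) = card (verts H)" by linarith
  have "darts G \<noteq> {}"
  proof -
    obtain v where "v \<in> verts G" using three_verts by (cases "verts G = {}") auto
    then show ?thesis using darts_at_vertex by blast
  qed
  then obtain R0 where R0: "R0 \<in> regions G H" using region_ex by blast
  obtain c0 where c0: "is_cycle H c0" using reg(1)[OF R0] unfolding bounded_by_cycle_iff by blast
  have c0H: "set c0 \<subseteq> verts H" "card (set c0) \<ge> 3"
    using c0 distinct_card unfolding is_cycle_def subgraph_def cycle_graph_def by fastforce+
  have no_isolated: "\<exists>w. {v, w} \<in> edges H" if v: "v \<in> verts H" for v
  proof -
    have "\<not> set c0 \<subseteq> {v}"
    proof
      assume "set c0 \<subseteq> {v}"
      then have "card (set c0) \<le> card {v}" by (intro card_mono) auto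
      then show False using c0H(2) by simp
    qed
    then obtain a where a: "a \<in> verts H" "a \<noteq> v" using c0H(1) by blast
    then have "(v, a) \<in> {(a, b). {a, b} \<in> edges H}\<^sup>*"
      using conH v unfolding connected_graph_def by blast
    then show ?thesis using a(2) by (cases rule: converse_rtranclE) auto
  qed
  \<comment> \<open>\<open>barrier_cycle\<close> yields some odd region \<open>R'\<close> of the
    cycle. Both \<open>R\<close> and \<open>R'\<close> contain the darts of \<open>c\<close> in the
    same direction, so they lie on the same side of it and coincide.\<close>
  have oddR: "odd (card (inner_vertices G H R))" if R: "R \<in> regions G H" for R
  proof -
    obtain c where c: "length c = 4" "bounded_by_cycle G H R c" using reg(1)[OF R] by blast
    then have "barrier_cycle G 4 c" using barrier R unfolding facial_cycle_def by blast
    then obtain R' where R': "R' \<in> regions G (cycle_graph c)" "bounded_by_cycle G (cycle_graph c) R' c"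
      "odd (card (inner_vertices G (cycle_graph c) R'))" unfolding barrier_cycle_def by blast
    note Rc = region_of_bounding_cycle[OF R c(2)]
    have "cycle_darts c \<subseteq> R" "cycle_darts c \<subseteq> R'"
      using Rc(2) R'(2) boundary_subset unfolding bounded_by_cycle_iff by metis+
    moreover have "cycle_darts c \<noteq> {}" unfolding cycle_darts_def using c(1) by fastforce
    ultimately have "R = R'" using region_eqI[OF Rc(1) R'(1)] by blast
    then show ?thesis using R'(3) inner_vertices_of_bounding_cycle[OF R c(2) no_isolated] by simp
  qed
  obtain a b where ab: "{a, b} \<in> edges H"
    using no_isolated c0H by (metis all_not_in_conv card.empty not_numeral_le_zero subset_eq)
  let ?e = "{a, b}"
  have eG: "?e \<in> edges G" using ab sub unfolding subgraph_def quad_subgraph_def by auto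
  have eH: "?e \<subseteq> verts H" by (rule edge_in_verts[OF ab])
  have "matching G {?e} \<and> card {?e} = 1" unfolding matching_def using eG by simp
  then have "extendable G {?e}" using ext unfolding m_extendable_def by blast
  then obtain N where N: "N \<subseteq> edges G" "pairwise disjnt N" "\<Union>N = verts G" "?e \<in> N"
    unfolding extendable_def perfect_matching_def matching_def by blast
  have same: "m = m'" if "m \<in> N" "m' \<in> N" "v \<in> m" "v \<in> m'" for m m' v
    using pairwiseD[OF N(2), of m m'] that unfolding disjnt_def by blast
  have "\<exists>ms. R \<in> regions G H \<longrightarrow> fst ms \<in> inner_vertices G H R \<and> snd ms \<in> verts H \<and> {fst ms, snd ms} \<in> N" for R
  proof (cases "R \<in> regions G H")
    case R: True
    let ?I = "inner_vertices G H R" and ?N = "{m \<in> N. m \<inter> inner_vertices G H R \<noteq> {}}"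
    \<comment> \<open>Otherwise the matching would pair the odd number of inner vertices among
      themselves.\<close>
    have "\<exists>m\<in>?N. \<not> m \<subseteq> ?I"
    proof (rule ccontr)
      assume "\<not> (\<exists>m\<in>?N. \<not> m \<subseteq> ?I)"
      then have "\<Union>?N \<subseteq> ?I" by blast
      moreover have "?I \<subseteq> \<Union>?N" using N(3) unfolding inner_vertices_def by blast
      ultimately have I: "?I = \<Union>?N" by blast
      have card2: "card m = 2" if "m \<in> ?N" for m using that N(1) edge_card by blast
      have fin2: "finite m" if "m \<in> ?N" for m using card2[OF that] by (intro card_ge_0_finite) simp
      have "card (\<Union>?N) = sum card ?N"
        by (intro card_Union_disjoint pairwise_subset[OF N(2)] fin2) auto
      also have "\<dots> = 2 * card ?N" using card2 by simp
      finally show False using oddR[OF R] I by simp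
    qed
    then obtain m where m: "m \<in> N" "m \<inter> ?I \<noteq> {}" "\<not> m \<subseteq> ?I" by blast
    then obtain v w where vw: "v \<in> m" "v \<in> ?I" "w \<in> m" "w \<notin> ?I" by blast
    have "card m = 2" using m(1) N(1) edge_card by blast
    then have mvw: "m = {v, w}" using vw by (auto simp: card_2_iff)
    then have "w \<in> verts H" using inner_vertices_closed[OF R vw(2)] m(1) N(1) vw(4) by blast
    then show ?thesis using vw(2) mvw m(1) by (intro exI[of _ "(v, w)"]) simp
  qed blast
  then obtain g where g: "\<And>R. R \<in> regions G H \<Longrightarrow>
      fst (g R) \<in> inner_vertices G H R \<and> snd (g R) \<in> verts H \<and> {fst (g R), snd (g R)} \<in> N"
    by metis
  have gH: "fst (g R) \<notin> verts H" if "R \<in> regions G H" for R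
    using g[OF that] unfolding inner_vertices_iff by blast
  have "inj_on (\<lambda>R. snd (g R)) (regions G H)"
  proof (rule inj_onI)
    fix R R' assume R: "R \<in> regions G H" "R' \<in> regions G H" "snd (g R) = snd (g R')"
    have "{fst (g R), snd (g R)} = {fst (g R'), snd (g R')}"
      using same[of _ _ "snd (g R)"] g[OF R(1)] g[OF R(2)] R(3) by blast
    then have "fst (g R) = fst (g R')"
      using R(3) gH[OF R(1)] g[OF R(2)] by (auto simp: doubleton_eq_iff)
    then show "R = R'" using inner_vertex_region[OF R(1,2)] g[OF R(1)] g[OF R(2)] by metis
  qed
  \<comment> \<open>The ends of \<open>?e\<close> are matched to each other, so the partners of the
    faces lie in the remaining vertices of \<open>H\<close>, which are fewer than the faces.\<close>
  moreover have "snd (g R) \<in> verts H - ?e" if R: "R \<in> regions G H" for R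
  proof -
    have "{fst (g R), snd (g R)} \<noteq> ?e" using gH[OF R] eH by blast
    then have "snd (g R) \<notin> ?e" using same[of "{fst (g R), snd (g R)}" ?e] g[OF R] N(4) by blast
    then show ?thesis using g[OF R] by blast
  qed
  ultimately have "card (regions G H) \<le> card (verts H - ?e)"
    using finite_hverts by (intro card_inj_on_le[of "\<lambda>R. snd (g R)"]) auto
  also have "\<dots> < card (verts H)"
    using eH finite_hverts by (intro psubset_card_mono) auto
  finally show False using count by simp
qed

text \<open>Tutte's condition fails on \<open>verts G - e\<close>. This set is even, so the failure
  has excess at least two, and adding the two ends of \<open>e\<close> to the deleted set keeps at
  least as many pieces as deleted vertices.\<close>

lemma (in optimal_toroidal) obstruction_exists:
  assumes ev: "even (card (verts G))" and not_ext: "\<not> m_extendable 1 G"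
  obtains S P where "S \<subseteq> verts G" "2 \<le> card S" "odd_pieces (verts G) (edges G) S P" "card S \<le> card P"
proof -
  \<comment> \<open>The size demanded for 1-extendability is met, so the failure comes from a
    matching.\<close>
  have "4 \<le> card (verts G)" using three_verts ev by presburger
  then obtain M where M: "matching G M" "card M = 1" "\<not> extendable G M"
    using not_ext unfolding m_extendable_def by auto
  then obtain e where Me: "M = {e}" by (auto simp: card_1_singleton_iff)
  then have e: "e \<in> edges G" using M(1) unfolding matching_def by blast
  have e2: "card e = 2" "e \<subseteq> verts G" using e edge_card edge_subset by blast+
  let ?V = "verts G - e"
  have nomatch: "\<not> (\<exists>M'\<subseteq>edges G. pairwise disjnt M' \<and> \<Union>M' = ?V)"
  proof
    assume "\<exists>M'\<subseteq>edges G. pairwise disjnt M' \<and> \<Union>M' = ?V"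
    then obtain M' where M': "M' \<subseteq> edges G" "pairwise disjnt M'" "\<Union>M' = ?V" by blast
    have "disjnt e m" "disjnt m e" if "m \<in> M'" for m using M'(3) that unfolding disjnt_def by blast+
    then have "pairwise disjnt (insert e M')" using M'(2) unfolding pairwise_insert by blast
    moreover have "\<Union>(insert e M') = verts G" using M'(3) e2(2) by auto
    ultimately have "perfect_matching G (insert e M')"
      unfolding perfect_matching_def matching_def using M'(1) e by blast
    then show False using M(3) Me unfolding extendable_def by blast
  qed
  have finV: "finite ?V" using finite_verts by simp
  obtain S P where SP: "S \<subseteq> ?V" "odd_pieces ?V (edges G) S P" "card S < card P"
    using tutte[OF finV, of "edges G"] nomatch by (meson not_le)
  have "card ?V = card (verts G) - 2"
    using card_Diff_subset[of e "verts G"] e2 finite_subset[OF e2(2) finite_verts] by simp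
  then have "even (card ?V)" using ev by simp
  then obtain P' where P': "odd_pieces ?V (edges G) S P'" "card S + 2 \<le> card P'"
    using odd_pieces_excess_two[OF SP(2) finV SP(1) _ SP(3)] by blast
  have "card (S \<union> e) = card S + 2"
  proof -
    have "finite S" "finite e" using finite_subset[OF SP(1) finV] finite_subset[OF e2(2) finite_verts] by auto
    moreover have "S \<inter> e = {}" using SP(1) by blast
    ultimately show ?thesis using card_Un_disjoint e2(1) by metis
  qed
  moreover have "odd_pieces (verts G) (edges G) (S \<union> e) P'"
  proof -
    have "verts G - (S \<union> e) = ?V - S" by blast
    then show ?thesis using P'(1) unfolding odd_pieces_def by simp
  qed
  ultimately show thesis using that[of "S \<union> e" P'] SP(1) e2(2) P'(2) by auto
qed

section \<open>The quadrangulation spanned by a Tutte obstruction\<close>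

locale odd_obstruction = optimal_toroidal +
  fixes S :: "'a set" and P :: "'a set set"
  assumes S_verts: "S \<subseteq> verts G" and S_card: "2 \<le> card S"
    and pieces: "odd_pieces (verts G) (edges G) S P" and P_card: "card S \<le> card P"
begin

text \<open>Taking all non-crossing edges inside \<open>S\<close> ensures that a non-crossing edge
  missing from \<open>H\<close> has an end outside \<open>S\<close>. Through this end a piece
  continues from one quadrangle to the next.\<close>

definition H :: "'a ugraph" where
  "H = \<lparr>verts = S, edges = {e \<in> edges (quad_subgraph G). e \<subseteq> S}\<rparr>"

lemma verts_H [simp]: "verts H = S"
  unfolding H_def by simp

lemma edges_H: "e \<in> edges H \<longleftrightarrow> e \<in> edges (quad_subgraph G) \<and> e \<subseteq> S"
  unfolding H_def by simp

end

sublocale odd_obstruction \<subseteq> optimal_subgraph G H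
proof unfold_locales
  show "subgraph H (quad_subgraph G)"
    using S_verts edges_H unfolding subgraph_def quad_subgraph_def by auto
  show "e \<in> edges H \<Longrightarrow> e \<subseteq> verts H" for e using edges_H by simp
qed

context odd_obstruction
begin

lemma piece:
  assumes "X \<in> P"
  shows "X \<subseteq> verts G - S" "odd (card X)" "x \<in> X \<Longrightarrow> y \<in> verts G \<Longrightarrow> y \<notin> S \<Longrightarrow> {x, y} \<in> edges G \<Longrightarrow> y \<in> X"
  using pieces assms unfolding odd_pieces_def by blast+

lemma pieces_eq: "X \<in> P \<Longrightarrow> Y \<in> P \<Longrightarrow> x \<in> X \<Longrightarrow> x \<in> Y \<Longrightarrow> X = Y"
  using pieces unfolding odd_pieces_def pairwise_def disjnt_def by blast

text \<open>The corners of a quadrangle are pairwise adjacent, so if one of them lies in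
  \<open>X\<close>, all corners outside \<open>S\<close> do. Within a region one passes between
  quadrangles only across an edge outside \<open>H\<close>; its end outside \<open>S\<close> is a
  corner on both sides and carries the property over.\<close>

lemma inner_vertices_in_piece:
  assumes R: "R \<in> regions G H" and X: "X \<in> P" "v \<in> X" "v \<in> inner_vertices G H R"
  shows "inner_vertices G H R \<subseteq> X"
proof
  let ?\<Psi> = "{d. corners d - S \<subseteq> X}"
  have spread: "d \<in> ?\<Psi>" if d: "d \<in> darts G" and z: "z \<in> corners d" "z \<in> X" for d z
  proof -
    have "y \<in> X" if y: "y \<in> corners d" "y \<notin> S" for y
    proof (cases "y = z")
      case False
      then have "{z, y} \<in> edges G" using corners_adjacent[OF d z(1) y(1)] by blast
      then show ?thesis using piece(3)[OF X(1) z(2) _ y(2)] corners_verts[OF d] y(1) by blast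
    qed (use z in simp)
    then show ?thesis by blast
  qed
  obtain q where q: "(Vertex v, q) \<in> R" using X(3) unfolding inner_vertices_iff by blast
  have RD: "R \<subseteq> darts G" by (rule region_subset[OF R])
  have "R \<subseteq> ?\<Psi>"
  proof (rule region_minimal[OF R q])
    show "(Vertex v, q) \<in> ?\<Psi>" using spread[OF _ corners_fst X(2)] q RD by blast
    show "next_dart G d \<in> ?\<Psi>" if "d \<in> R" "d \<in> ?\<Psi>" for d
      using that corners_next[of d] RD by auto
    show "(q, p) \<in> ?\<Psi>" if pq: "(p, q) \<in> R" "(p, q) \<in> ?\<Psi>" "{p, q} \<notin> hsegs H" for p q
    proof -
      have d: "(p, q) \<in> darts G" "(q, p) \<in> darts G" using pq(1) RD dart_sym by blast+
      consider (pc) x u where "p = Crossing x" "q = Vertex u" | (qc) x u where "q = Crossing x" "p = Vertex u"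
        | (v) u w where "p = Vertex u" "q = Vertex w"
        using d dart_xx by (cases p; cases q) auto
      then show ?thesis
      proof cases
        case v
        have "{u, w} \<in> edges (quad_subgraph G)" using d(1) v dart_vv by simp
        moreover have "{u, w} \<notin> edges H" using pq(3) v hseg_iff by simp
        ultimately obtain z where z: "z \<in> {u, w}" "z \<notin> S" using edges_H by blast
        have "z \<in> corners (p, q)" "z \<in> corners (q, p)"
          using z(1) corners_fst corners_snd d v by (auto simp del: corners.simps)
        then show ?thesis using spread[OF d(2)] pq(2) z(2) by blast
      qed (use pq in auto)
    qed
  qed
  then show "w \<in> X" if "w \<in> inner_vertices G H R" for w
    using that corners_fst[of w] RD unfolding inner_vertices_iff by fastforce
qed

lemma inner_region_ex: "v \<in> verts G \<Longrightarrow> v \<notin> S \<Longrightarrow> \<exists>R\<in>regions G H. v \<in> inner_vertices G H R"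
  using darts_at_vertex[of v] region_ex unfolding inner_vertices_iff by fastforce

lemma piece_region: "X \<in> P \<Longrightarrow> \<exists>R\<in>regions G H. inner_vertices G H R \<noteq> {} \<and> inner_vertices G H R \<subseteq> X"
proof -
  assume X: "X \<in> P"
  then obtain v where v: "v \<in> X" using piece(2)[OF X] by (metis card.empty equals0I even_zero)
  then obtain R where "R \<in> regions G H" "v \<in> inner_vertices G H R"
    using inner_region_ex[of v] piece(1)[OF X] by blast
  then show ?thesis using inner_vertices_in_piece[OF _ X v] by blast
qed

lemma tight:
  shows "R \<in> regions G H \<Longrightarrow> R \<noteq> darts G" "R \<in> regions G H \<Longrightarrow> card (boundary H R) = 4"
    "R \<in> regions G H \<Longrightarrow> euler_region H R = 1"
    "R \<in> regions G H \<Longrightarrow> inner_vertices G H R \<in> P"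
proof -
  obtain \<rho> where \<rho>: "\<And>X. X \<in> P \<Longrightarrow> \<rho> X \<in> regions G H"
    "\<And>X. X \<in> P \<Longrightarrow> inner_vertices G H (\<rho> X) \<noteq> {}" "\<And>X. X \<in> P \<Longrightarrow> inner_vertices G H (\<rho> X) \<subseteq> X"
    using piece_region by metis
  have inj: "inj_on \<rho> P"
  proof (rule inj_onI)
    fix X Y assume XY: "X \<in> P" "Y \<in> P" "\<rho> X = \<rho> Y"
    then obtain v where "v \<in> X" "v \<in> Y" using \<rho>(2)[OF XY(1)] \<rho>(3)[OF XY(1)] \<rho>(3)[OF XY(2)] by auto
    then show "X = Y" using pieces_eq XY(1,2) by blast
  qed
  have PR: "card P \<le> card (regions G H)"
    by (rule card_inj_on_le[OF inj]) (use \<rho>(1) finite_regions in auto)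
  \<comment> \<open>A region equal to the whole torus would be the only one, whereas the pieces
    force at least \<open>card S \<ge> 2\<close> regions.\<close>
  have nd: "R \<noteq> darts G" if R: "R \<in> regions G H" for R
  proof
    assume "R = darts G"
    then have "R' = R" if R': "R' \<in> regions G H" for R'
      using region_nonempty[OF R'] region_subset[OF R'] region_eqI[OF R' R] by blast
    then have "card (regions G H) \<le> card {R}" by (intro card_mono) auto
    then show False using PR P_card S_card by simp
  qed
  then show "R \<in> regions G H \<Longrightarrow> R \<noteq> darts G" .
  \<comment> \<open>Twice the surplus of a region over the minimal contribution 1, so that no halves
    occur. Every value is nonnegative, while the total
    \<open>2 * card S - 2 * card (regions G H)\<close> is at most 0.\<close>
  let ?b = "\<lambda>R. int (card (boundary H R)) - 2 * euler_region H R - 2"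
  have b4: "4 \<le> card (boundary H R)" if "R \<in> regions G H" for R using card_boundary_ge nd that by blast
  have "S \<noteq> {}" using S_card by auto
  then have e1: "euler_region H R \<le> 1" if "R \<in> regions G H" for R using euler_region_le_1[OF that] by simp
  have nonneg: "0 \<le> ?b R" if "R \<in> regions G H" for R using b4[OF that] e1[OF that] by simp
  have "(\<Sum>R\<in>regions G H. ?b R)
    = int (\<Sum>R\<in>regions G H. card (boundary H R)) - 2 * (\<Sum>R\<in>regions G H. euler_region H R) - 2 * int (card (regions G H))"
    by (simp add: sum_subtractf sum_distrib_left)
  also have "\<dots> = 2 * int (card S) - 2 * int (card (regions G H))"
    unfolding sum_boundary sum_euler_region face_counts(1) by simp
  finally have sumb: "(\<Sum>R\<in>regions G H. ?b R) = 2 * int (card S) - 2 * int (card (regions G H))" .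
  have "0 \<le> (\<Sum>R\<in>regions G H. ?b R)" by (rule sum_nonneg) (rule nonneg)
  then have eqs: "card (regions G H) = card P" "(\<Sum>R\<in>regions G H. ?b R) = 0"
    using sumb PR P_card by linarith+
  have b0: "?b R = 0" if R: "R \<in> regions G H" for R
    using sum_nonneg_eq_0_iff[OF finite_regions, of H ?b] nonneg eqs(2) R by blast
  then show "card (boundary H R) = 4" "euler_region H R = 1" if R: "R \<in> regions G H"
    using b0[OF R] b4[OF R] e1[OF R] by linarith+
  \<comment> \<open>As regions and pieces are equally many, every region hosts a piece. A piece
    cannot extend into a second region, because that one hosts a different piece; hence it is
    exactly the set of inner vertices.\<close>
  have surj: "\<rho> ` P = regions G H"
    using \<rho>(1) card_image[OF inj] eqs(1) finite_regions by (intro card_subset_eq) auto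
  show "inner_vertices G H R \<in> P" if R: "R \<in> regions G H"
  proof -
    obtain X where X: "X \<in> P" "R = \<rho> X" using surj R by blast
    have "X \<subseteq> inner_vertices G H R"
    proof
      fix w assume w: "w \<in> X"
      then obtain R' where R': "R' \<in> regions G H" "w \<in> inner_vertices G H R'"
        using inner_region_ex[of w] piece(1)[OF X(1)] by blast
      then obtain Y where Y: "Y \<in> P" "R' = \<rho> Y" using surj by blast
      then have "w \<in> Y" using \<rho>(3) R'(2) by blast
      then have "X = Y" using pieces_eq X(1) Y(1) w by blast
      then show "w \<in> inner_vertices G H R" using R'(2) X Y by simp
    qed
    then have "inner_vertices G H R = X" using \<rho>(3) X by blast
    then show ?thesis using X(1) by simp
  qed
qed

text \<open>Otherwise the isolated vertex could be removed from \<open>H\<close>, raising the Euler characteristic of its face to \<open>2\<close>.\<close>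

lemma no_isolated: "v \<in> verts H \<Longrightarrow> \<exists>w. {v, w} \<in> edges H"
proof (rule ccontr)
  assume v: "v \<in> verts H" and isolated: "\<nexists>w. {v, w} \<in> edges H"
  let ?H = "\<lparr>verts = S - {v}, edges = edges H\<rparr> :: 'a ugraph"
  have vS: "v \<in> S" using v by simp
  have eS: "e \<subseteq> S - {v}" if e: "e \<in> edges H" for e
  proof -
    have e': "e \<subseteq> S" "e \<in> edges G" using e edges_H unfolding quad_subgraph_def by auto
    obtain x y where xy: "e = {x, y}" using edge_card[OF e'(2)] by (meson card_2_iff)
    have "x \<noteq> v" "y \<noteq> v" using isolated e unfolding xy by (auto simp: insert_commute)
    then show ?thesis using e'(1) xy by blast
  qed
  interpret H': drawn_subgraph G ?H
  proof unfold_locales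
    show "subgraph ?H (quad_subgraph G)" using sub unfolding subgraph_def by auto
    show "e \<subseteq> verts ?H" if "e \<in> edges ?H" for e using eS that by simp
  qed
  \<comment> \<open>Regions depend only on the edges of \<open>H\<close>, so deleting the isolated
    vertex just turns it into an inner point.\<close>
  have regs: "regions G ?H = regions G H" unfolding regions_def glue_def by simp
  have vG: "v \<in> verts G" using vS S_verts by blast
  then obtain q where q: "(Vertex v, q) \<in> darts G" using darts_at_vertex by blast
  obtain R where R: "R \<in> regions G H" "(Vertex v, q) \<in> R" using region_ex[OF q] by blast
  have "inner_points G ?H R = insert (Vertex v) (inner_points G H R)"
    using R(2) vG vS unfolding inner_points_def points_def by auto
  moreover have "Vertex v \<notin> inner_points G H R" using vS unfolding inner_points_def by simp
  moreover have "finite (inner_points G H R)" unfolding inner_points_def using finite_points by simp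
  moreover have "inner_segments G ?H R = inner_segments G H R" unfolding inner_segments_def by simp
  ultimately have "euler_region ?H R = euler_region H R + 1" unfolding euler_region_def by simp
  moreover have "S - {v} \<noteq> {}"
  proof
    assume "S - {v} = {}"
    then have "card S \<le> card {v}" by (intro card_mono) auto
    then show False using S_card by simp
  qed
  then have "euler_region ?H R \<le> 1" using H'.euler_region_le_1[of R] R(1) regs by simp
  ultimately show False using tight(3)[OF R(1)] by simp
qed

text \<open>Each region is bounded by a single cycle, so its boundary vertices lie in one component
  of \<open>H\<close>. Regions on the two sides of an edge of \<open>H\<close> share that component,
  and the torus is connected, so one component meets the boundary of every region. Since no vertex
  of \<open>H\<close> is isolated, each one occurs on such a boundary.\<close>

lemma connected_H: "connected_graph H"
proof -
  let ?E = "{(a, b). {a, b} \<in> edges H}"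
  have path: "(a, b) \<in> ?E\<^sup>*" if a: "a \<in> S" and b: "b \<in> S" for a b
  proof -
    let ?A = "{w. (a, w) \<in> ?E\<^sup>*}"
    have step: "y \<in> ?A" if "x \<in> ?A" "{x, y} \<in> edges H" for x y
      using that by (auto intro: rtrancl_into_rtrancl)
    have bd: "p \<in> Vertex ` ?A" if R: "R \<in> regions G H" and x: "(Vertex x, q') \<in> boundary H R" "x \<in> ?A"
      and p: "(p, q) \<in> boundary H R" for R x q' p q
    proof -
      obtain c where c: "length c = 4" "bounded_by_cycle G H R c"
        using bounded_by_four_cycle[OF R tight(1)[OF R] tight(2)[OF R]] by blast
      have B: "boundary H R = cycle_darts c" and cyc: "is_cycle H c"
        using c(2) unfolding bounded_by_cycle_iff by auto
      have E: "{c ! i, c ! (Suc i mod 4)} \<in> edges H" if "i < 4" for i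
        using cyc that c(1) unfolding is_cycle_def subgraph_def cycle_graph_def by auto
      have mod4: "Suc 0 mod 4 = 1" "Suc 1 mod 4 = 2" "Suc 2 mod 4 = 3" "Suc 3 mod 4 = 0" by simp_all
      have e: "{c ! 0, c ! 1} \<in> edges H" "{c ! 1, c ! 2} \<in> edges H" "{c ! 2, c ! 3} \<in> edges H" "{c ! 3, c ! 0} \<in> edges H"
        using E[of 0] E[of 1] E[of 2] E[of 3] unfolding mod4 by simp_all
      have e': "{c ! 1, c ! 0} \<in> edges H" "{c ! 2, c ! 1} \<in> edges H" "{c ! 3, c ! 2} \<in> edges H" "{c ! 0, c ! 3} \<in> edges H"
        using e by (simp_all only: insert_commute)
      have set_c: "\<exists>i<4. z = c ! i" if "(Vertex z, r) \<in> boundary H R" for z r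
        using that c(1) unfolding B cycle_darts_def by auto
      have four: "i = 0 \<or> i = 1 \<or> i = 2 \<or> i = 3" if "i < 4" for i :: nat using that by auto
      obtain i where i: "i < 4" "x = c ! i" using set_c[OF x(1)] by blast
      have "c ! 0 \<in> ?A"
        using four[OF i(1)] i(2) x(2) step e e' by metis
      then have all: "c ! j \<in> ?A" if "j < 4" for j
        using four[OF that] step e by metis
      have "{p, q} \<in> hsegs H" using p unfolding boundary_iff by blast
      then obtain z where z: "p = Vertex z" by (rule hseg_vertex)
      then show ?thesis using set_c[of z q] p all by blast
    qed
    \<comment> \<open>The darts in regions whose boundary lies entirely in the component
      \<open>?A\<close> of \<open>a\<close>. This set is closed under facial walks and under all
      reversals, also across edges of \<open>H\<close>, and so contains every dart.\<close>
    let ?D = "{d \<in> darts G. \<forall>R\<in>regions G H. d \<in> R \<longrightarrow> (\<forall>p q. (p, q) \<in> boundary H R \<longrightarrow> p \<in> Vertex ` ?A)}"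
    have inD: "d \<in> ?D" if R: "R \<in> regions G H" "d \<in> R" and x: "(Vertex x, q') \<in> boundary H R" "x \<in> ?A" for d R x q'
    proof -
      have "R' = R" if "R' \<in> regions G H" "d \<in> R'" for R' by (rule region_eqI[OF that(1) R(1) that(2) R(2)])
      then show ?thesis using bd[OF R(1) x] region_mem(1)[OF R] by blast
    qed
    have hdart: "\<exists>q R. (Vertex x, q) \<in> boundary H R \<and> R \<in> regions G H" if x: "x \<in> S" for x
    proof -
      obtain w where "{x, w} \<in> edges H" using no_isolated[of x] x by auto
      then have hs: "{Vertex x, Vertex w} \<in> hsegs H" using hseg_iff by blast
      then obtain R where "R \<in> regions G H" "(Vertex x, Vertex w) \<in> R" using region_ex[OF hseg_dart[OF hs]] by blast
      then show ?thesis using hs unfolding boundary_iff by blast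
    qed
    obtain qa Ra where qa: "(Vertex a, qa) \<in> boundary H Ra" "Ra \<in> regions G H" using hdart[OF a] by blast
    have "?D = darts G"
    proof (rule darts_connected)
      show "(Vertex a, qa) \<in> ?D"
        by (rule inD[OF qa(2) subsetD[OF boundary_subset qa(1)] qa(1)]) simp
      show "next_dart G d \<in> ?D" if d: "d \<in> ?D" for d
      proof -
        have "d \<in> R" if "R \<in> regions G H" "next_dart G d \<in> R" for R
          using region_prev[OF that] d by blast
        then show ?thesis using d next_dart_in by blast
      qed
      show "(q, p) \<in> ?D" if d: "(p, q) \<in> ?D" for p q
      proof (cases "{p, q} \<in> hsegs H")
        case False
        then have "{q, p} \<notin> hsegs H" by (simp add: insert_commute)
        then have "(p, q) \<in> R" if "R \<in> regions G H" "(q, p) \<in> R" for R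
          using region_rev[OF that] by blast
        moreover have "(q, p) \<in> darts G" using d dart_sym by blast
        ultimately show ?thesis using d by blast
      next
        case True
        then obtain x y where xy: "p = Vertex x" "q = Vertex y" "{x, y} \<in> edges H" by (rule hseg_vertex)
        have pq: "(p, q) \<in> darts G" "(q, p) \<in> darts G" using d dart_sym by blast+
        obtain R where "R \<in> regions G H" "(p, q) \<in> R" using region_ex[OF pq(1)] by blast
        then have "p \<in> Vertex ` ?A" using d True unfolding boundary_iff by blast
        then have y: "y \<in> ?A" using step[OF _ xy(3)] xy(1) by auto
        obtain R' where R': "R' \<in> regions G H" "(q, p) \<in> R'" using region_ex[OF pq(2)] by blast
        have "{q, p} \<in> hsegs H" using True by (simp add: insert_commute)
        then have "(Vertex y, p) \<in> boundary H R'" using R'(2) xy(2) unfolding boundary_iff by simp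
        then show ?thesis by (rule inD[OF R' _ y])
      qed
    qed blast
    moreover obtain qb Rb where qb: "(Vertex b, qb) \<in> boundary H Rb" "Rb \<in> regions G H" using hdart[OF b] by blast
    have "(Vertex b, qb) \<in> Rb" using qb(1) unfolding boundary_iff by blast
    ultimately have "Vertex b \<in> Vertex ` ?A" using qb region_mem(1)[OF qb(2)] by blast
    then show ?thesis by auto
  qed
  have "e \<subseteq> S \<and> card e = 2" if "e \<in> edges H" for e
    using that edges_H edge_card[of e] unfolding quad_subgraph_def by auto
  moreover have "finite S" by (rule finite_subset[OF S_verts finite_verts])
  moreover have "S \<noteq> {}" using S_card by auto
  ultimately show ?thesis unfolding connected_graph_def verts_H using path by blast
qed

lemma quadrangulation_H: "quadrangulation G H"
  unfolding quadrangulation_def two_cell_iff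
  using connected_H tight bounded_by_four_cycle by blast

lemma facial_cycles_barrier:
  assumes "facial_cycle G H c"
  shows "barrier_cycle G 4 c"
proof -
  obtain R where R: "R \<in> regions G H" and c: "bounded_by_cycle G H R c"
    using assms unfolding facial_cycle_def by blast
  have len: "length c = 4" using card_bounding_cycle[OF c] tight(2)[OF R] by simp
  have "is_cycle (quad_subgraph G) c"
    using c sub unfolding bounded_by_cycle_iff is_cycle_def subgraph_def by auto
  moreover have "euler_region (cycle_graph c) R = 1"
    using tight(3)[OF R] inner_of_bounding_cycle[OF R c no_isolated] unfolding euler_region_def by simp
  moreover have "odd (card (inner_vertices G (cycle_graph c) R))"
    using inner_vertices_of_bounding_cycle[OF R c no_isolated] piece(2)[OF tight(4)[OF R]] by simp
  ultimately show ?thesis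
    unfolding barrier_cycle_def two_cell_iff using len region_of_bounding_cycle[OF R c] by blast
qed

end

theorem theorem3:
  fixes G :: "'a drawing"
  assumes "optimal_one_toroidal G"
    and "even (card (verts G))"
  shows "m_extendable 1 G \<longleftrightarrow>
    \<not> (\<exists>H. subgraph H (quad_subgraph G) \<and>
           quadrangulation G H \<and>
           (\<forall>c. facial_cycle G H c \<longrightarrow> barrier_cycle G 4 c))"
proof -
  interpret optimal_toroidal G
    using assms(1) unfolding optimal_one_toroidal_def one_toroidal_def by unfold_locales auto
  show ?thesis
  proof
    assume "m_extendable 1 G"
    then show "\<not> (\<exists>H. subgraph H (quad_subgraph G) \<and> quadrangulation G H \<and>
        (\<forall>c. facial_cycle G H c \<longrightarrow> barrier_cycle G 4 c))"
      using barrier_quadrangulation_not_extendable by blast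
  next
    assume no: "\<not> (\<exists>H. subgraph H (quad_subgraph G) \<and> quadrangulation G H \<and>
        (\<forall>c. facial_cycle G H c \<longrightarrow> barrier_cycle G 4 c))"
    show "m_extendable 1 G"
    proof (rule ccontr)
      assume "\<not> m_extendable 1 G"
      then obtain S P where "S \<subseteq> verts G" "2 \<le> card S" "odd_pieces (verts G) (edges G) S P" "card S \<le> card P"
        by (rule obstruction_exists[OF assms(2)])
      then interpret odd_obstruction G S P by unfold_locales
      show False using no sub quadrangulation_H facial_cycles_barrier by blast
    qed
  qed
qed

end
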